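(* Let $k$ be a field and let $\mathcal{C}$ be a $k$-linear, Hom-finite, Krull-Schmidt, connected triangulated category. Let $\Gamma$ be a stable component of the Auslander-Reiten quiver of $\mathcal{C}$ and suppose that the tree class of $\Gamma$ is a Dynkin diagram. Then $\Gamma$ contains every indecomposable object of $\mathcal{C}$ (up to isomorphism). Furthermore, $\mathcal{C}$ is locally finite. Consequently, $\mathcal{C}$ has Auslander-Reiten triangles, and $\mathcal{C}$ has only finitely many shift-classes of indecomposable objects (that is, the isomorphism classes of indecomposable objects fall into finitely many orbits under the shift $[1]$).
   Context: $\mathcal{C}$ is Hom-finite if $\dim_k\operatorname{Hom}_{\mathcal{C}}(X,Y)<\infty$ for all indecomposable $X,Y$. It is Krull-Schmidt if every object is a finite direct sum of indecomposable objects, each with local endomorphism ring. It is connected if the indecomposable objects cannot be partitioned into two (nonempty) classes with no non-zero homomorphisms, in either direction, between objects in different classes. It is locally finite if it is Hom-finite and, for each indecomposable $X$, there are only finitely many isomorphism classes of indecomposable $Y$ with $\operatorname{Hom}_{\mathcal{C}}(X,Y)\neq 0$ or $\operatorname{Hom}_{\mathcal{C}}(Y,X)\neq 0$. Auslander-Reiten triangles: a distinguished triangle $U\to V\to W\xrightarrow{w}U[1]$ with $U,W$ indecomposable, $w\ne 0$, and such that every morphism $X\to W$ which is not a split epimorphism factors through $V\to W$ (equivalently, every morphism $U\to X$ which is not a split monomorphism factors through $U\to V$). One writes $U=\tau W$, $W=\tau^{-1}U$. $\mathcal{C}$ has Auslander-Reiten triangles if every indecomposable object is both the third term of one such triangle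 and the first term of one such triangle. Auslander-Reiten quiver: vertices are the isomorphism classes of indecomposable objects; there is an arrow $X\to Y$ if there is an irreducible morphism $X\to Y$. Where Auslander-Reiten triangles exist, the arrow $X\to Y$ is labelled by $(a,b)$, where $a$ is the multiplicity of $X$ as a summand of the middle term of the Auslander-Reiten triangle ending at $Y$, and $b$ is the multiplicity of $Y$ in the middle term of the one starting at $X$. A stable component $\Gamma$ is a connected component of the Auslander-Reiten quiver such that for every indecomposable $M\in\Gamma$: (1) for every $n\in\mathbb{Z}$, $\tau^nM$ is defined (the relevant Auslander-Reiten triangles exist) and lies in $\Gamma$; (2) every irreducible morphism beginning or ending at $M$ lies in $\Gamma$. It is not assumed that $\Gamma$ is closed under shift, nor that Auslander-Reiten triangles exist elsewhere in $\mathcal{C}$. Tree class: for a tree $T$ whose edges carry valuations, choose an orientation; $\mathbb{Z}T$ has vertices $(n,x)$, $n\in\mathbb{Z}$, $x\in T_0$, and, for each arrow $x\to y$ of $T$ with valuation $(a,b)$, arrows $(n,x)\to(n,y)$ with valuation $(a,b)$ and $(n,y)\to(n+1,x)$ with valuation $(b,a)$; its translation is $\tau(n,x)=(n-1,x)$. By known theorems (Riedtmann; Xiao-Zhu) $\Gamma\cong\mathbb{Z}T/G$ for a valued tree $T$ and a group $G$ of automorphisms of $\mathbb{Z}T$, where $\mathbb{Z}T\to\Gamma$ is a covering (it commutes with $\tau$, preserves valuations, and is bijective on immediate successors and on immediate predecessors of each vertex). The valued tree $T$ is determined up to isomorphism by $\Gamma$ and is called the tree class of $\Gamma$. Dynkin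 diagrams: the finite valued trees $A_n, B_n, C_n, D_n, E_6, E_7, E_8, F_4, G_2$ (a double bond is an edge with valuation $(1,2)$ or $(2,1)$, a triple bond an edge with valuation $(1,3)$ or $(3,1)$, all other edges having valuation $(1,1)$). *)

theory Defs
  imports
    "HOL-Algebra.Bij"
    "HOL-Algebra.Ideal"
    "Jordan_Normal_Form.Missing_VectorSpace"
begin

section \<open>Linear categories\<close>

text \<open>
  Composition and shift on morphisms take bare morphisms; all axioms and notions below mention the
  source and target explicitly, so hom-sets need not be disjoint.
\<close>

record ('k, 'o, 'm) lin_cat =
  Ob :: "'o set"
  Hom :: "'o \<Rightarrow> 'o \<Rightarrow> ('k, 'm) module"
  comp :: "'m \<Rightarrow> 'm \<Rightarrow> 'm" (infixl \<open>\<cdot>\<index>\<close> 70)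
  ident :: "'o \<Rightarrow> 'm"

abbreviation mor :: "('k, 'o, 'm, 'z) lin_cat_scheme \<Rightarrow> 'o \<Rightarrow> 'o \<Rightarrow> 'm set" where
  "mor C X Y \<equiv> carrier (Hom C X Y)"

locale linear_category =
  fixes K :: "('k, 'r) ring_scheme" and C :: "('k, 'o, 'm, 'z) lin_cat_scheme" (structure)
  assumes field: "field K"
    and vectorspace_Hom: "X \<in> Ob C \<Longrightarrow> Y \<in> Ob C \<Longrightarrow> vectorspace K (Hom C X Y)"
    and ident_mor: "X \<in> Ob C \<Longrightarrow> ident C X \<in> mor C X X"
    and comp_linear_left: "X \<in> Ob C \<Longrightarrow> Y \<in> Ob C \<Longrightarrow> Z \<in> Ob C \<Longrightarrow> f \<in> mor C X Y \<Longrightarrow>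
      (\<lambda>g. g \<cdot> f) \<in> module_hom K (Hom C Y Z) (Hom C X Z)"
    and comp_linear_right: "X \<in> Ob C \<Longrightarrow> Y \<in> Ob C \<Longrightarrow> Z \<in> Ob C \<Longrightarrow> g \<in> mor C Y Z \<Longrightarrow>
      (\<lambda>f. g \<cdot> f) \<in> module_hom K (Hom C X Y) (Hom C X Z)"
    and comp_assoc: "W \<in> Ob C \<Longrightarrow> X \<in> Ob C \<Longrightarrow> Y \<in> Ob C \<Longrightarrow> Z \<in> Ob C \<Longrightarrow>
      f \<in> mor C W X \<Longrightarrow> g \<in> mor C X Y \<Longrightarrow> h \<in> mor C Y Z \<Longrightarrow> (h \<cdot> g) \<cdot> f = h \<cdot> (g \<cdot> f)"
    and comp_ident_left: "X \<in> Ob C \<Longrightarrow> Y \<in> Ob C \<Longrightarrow> f \<in> mor C X Y \<Longrightarrow> ident C Y \<cdot> f = f"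
    and comp_ident_right: "X \<in> Ob C \<Longrightarrow> Y \<in> Ob C \<Longrightarrow> f \<in> mor C X Y \<Longrightarrow> f \<cdot> ident C X = f"

definition split_mono :: "('k, 'o, 'm, 'z) lin_cat_scheme \<Rightarrow> 'o \<Rightarrow> 'o \<Rightarrow> 'm \<Rightarrow> bool" where
  "split_mono C X Y f \<longleftrightarrow> f \<in> mor C X Y \<and> (\<exists>r \<in> mor C Y X. r \<cdot>\<^bsub>C\<^esub> f = ident C X)"

definition split_epi :: "('k, 'o, 'm, 'z) lin_cat_scheme \<Rightarrow> 'o \<Rightarrow> 'o \<Rightarrow> 'm \<Rightarrow> bool" where
  "split_epi C X Y f \<longleftrightarrow> f \<in> mor C X Y \<and> (\<exists>s \<in> mor C Y X. f \<cdot>\<^bsub>C\<^esub> s = ident C Y)"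

definition isomorphism :: "('k, 'o, 'm, 'z) lin_cat_scheme \<Rightarrow> 'o \<Rightarrow> 'o \<Rightarrow> 'm \<Rightarrow> bool" where
  "isomorphism C X Y f \<longleftrightarrow> f \<in> mor C X Y \<and>
     (\<exists>g \<in> mor C Y X. g \<cdot>\<^bsub>C\<^esub> f = ident C X \<and> f \<cdot>\<^bsub>C\<^esub> g = ident C Y)"

definition isomorphic :: "('k, 'o, 'm, 'z) lin_cat_scheme \<Rightarrow> 'o \<Rightarrow> 'o \<Rightarrow> bool" where
  "isomorphic C X Y \<longleftrightarrow> X \<in> Ob C \<and> Y \<in> Ob C \<and> (\<exists>f. isomorphism C X Y f)"

definition iso_class :: "('k, 'o, 'm, 'z) lin_cat_scheme \<Rightarrow> 'o \<Rightarrow> 'o set" where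
  "iso_class C X = {Y. isomorphic C X Y}"

definition zero_object :: "('k, 'o, 'm, 'z) lin_cat_scheme \<Rightarrow> 'o \<Rightarrow> bool" where
  "zero_object C Z \<longleftrightarrow> Z \<in> Ob C \<and>
     (\<forall>X \<in> Ob C. mor C X Z = {\<zero>\<^bsub>Hom C X Z\<^esub>} \<and> mor C Z X = {\<zero>\<^bsub>Hom C Z X\<^esub>})"

text \<open>\<open>X\<close> is a direct sum (biproduct) of the finite family \<open>Ys\<close>; the empty family gives the zero objects.\<close>

definition direct_sum :: "('k, 'o, 'm, 'z) lin_cat_scheme \<Rightarrow> 'o \<Rightarrow> 'o list \<Rightarrow> bool" where
  "direct_sum C X Ys \<longleftrightarrow> X \<in> Ob C \<and> set Ys \<subseteq> Ob C \<and>
     (\<exists>i p. (\<forall>j < length Ys. i j \<in> mor C (Ys ! j) X \<and> p j \<in> mor C X (Ys ! j)) \<and>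
        (\<forall>j < length Ys. \<forall>l < length Ys.
           p l \<cdot>\<^bsub>C\<^esub> i j = (if j = l then ident C (Ys ! j) else \<zero>\<^bsub>Hom C (Ys ! j) (Ys ! l)\<^esub>)) \<and>
        (\<Oplus>\<^bsub>Hom C X X\<^esub> j \<in> {..<length Ys}. i j \<cdot>\<^bsub>C\<^esub> p j) = ident C X)"

locale additive_category = linear_category +
  assumes direct_sum_exists: "set Ys \<subseteq> Ob C \<Longrightarrow> \<exists>X. direct_sum C X Ys"

definition indecomposable :: "('k, 'o, 'm, 'z) lin_cat_scheme \<Rightarrow> 'o \<Rightarrow> bool" where
  "indecomposable C X \<longleftrightarrow> X \<in> Ob C \<and> \<not> zero_object C X \<and>
     (\<forall>A B. direct_sum C X [A, B] \<longrightarrow> zero_object C A \<or> zero_object C B)"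

definition endo_ring :: "('k, 'o, 'm, 'z) lin_cat_scheme \<Rightarrow> 'o \<Rightarrow> 'm ring" where
  "endo_ring C X = \<lparr>carrier = mor C X X, mult = comp C, one = ident C X,
     zero = \<zero>\<^bsub>Hom C X X\<^esub>, add = add (Hom C X X)\<rparr>"

text \<open>The non-units form a two-sided ideal; as \<open>\<zero>\<close> is then a non-unit, the ring is nonzero.\<close>

definition local_ring :: "('a, 'b) ring_scheme \<Rightarrow> bool" where
  "local_ring R \<longleftrightarrow> ideal (carrier R - Units R) R"

definition hom_finite :: "('k, 'r) ring_scheme \<Rightarrow> ('k, 'o, 'm, 'z) lin_cat_scheme \<Rightarrow> bool" where
  "hom_finite K C \<longleftrightarrow>
     (\<forall>X Y. indecomposable C X \<longrightarrow> indecomposable C Y \<longrightarrow> vectorspace.fin_dim K (Hom C X Y))"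

definition krull_schmidt :: "('k, 'o, 'm, 'z) lin_cat_scheme \<Rightarrow> bool" where
  "krull_schmidt C \<longleftrightarrow>
     (\<forall>X \<in> Ob C. \<exists>Ys. direct_sum C X Ys \<and>
        (\<forall>Y \<in> set Ys. indecomposable C Y \<and> local_ring (endo_ring C Y)))"

definition nonzero_hom :: "('k, 'o, 'm, 'z) lin_cat_scheme \<Rightarrow> 'o \<Rightarrow> 'o \<Rightarrow> bool" where
  "nonzero_hom C X Y \<longleftrightarrow> (\<exists>f \<in> mor C X Y. f \<noteq> \<zero>\<^bsub>Hom C X Y\<^esub>)"

definition connected_category :: "('k, 'o, 'm, 'z) lin_cat_scheme \<Rightarrow> bool" where
  "connected_category C \<longleftrightarrow>
     \<not> (\<exists>A B. A \<noteq> {} \<and> B \<noteq> {} \<and> A \<inter> B = {} \<and> A \<union> B = {X. indecomposable C X} \<and>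
           (\<forall>X \<in> A. \<forall>Y \<in> B. \<not> nonzero_hom C X Y \<and> \<not> nonzero_hom C Y X))"

definition locally_finite ::
  "('k, 'r) ring_scheme \<Rightarrow> ('k, 'o, 'm, 'z) lin_cat_scheme \<Rightarrow> bool" where
  "locally_finite K C \<longleftrightarrow> hom_finite K C \<and>
     (\<forall>X. indecomposable C X \<longrightarrow>
        finite (iso_class C ` {Y. indecomposable C Y \<and> (nonzero_hom C X Y \<or> nonzero_hom C Y X)}))"

definition irreducible_mor :: "('k, 'o, 'm, 'z) lin_cat_scheme \<Rightarrow> 'o \<Rightarrow> 'o \<Rightarrow> 'm \<Rightarrow> bool" where
  "irreducible_mor C X Y f \<longleftrightarrow> X \<in> Ob C \<and> Y \<in> Ob C \<and> f \<in> mor C X Y \<and>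
     \<not> split_mono C X Y f \<and> \<not> split_epi C X Y f \<and>
     (\<forall>Z \<in> Ob C. \<forall>g \<in> mor C X Z. \<forall>h \<in> mor C Z Y.
        f = h \<cdot>\<^bsub>C\<^esub> g \<longrightarrow> split_mono C X Z g \<or> split_epi C Z Y h)"


section \<open>Triangulated categories\<close>

text \<open>\<open>dist C X Y Z u v w\<close> says that \<open>X \<rightarrow> Y \<rightarrow> Z \<rightarrow> X[1]\<close>, with maps \<open>u\<close>, \<open>v\<close>, \<open>w\<close>, is a distinguished triangle.\<close>

record ('k, 'o, 'm) tri_cat = "('k, 'o, 'm) lin_cat" +
  shift_ob :: "'o \<Rightarrow> 'o"
  shift_mor :: "'m \<Rightarrow> 'm"
  dist :: "'o \<Rightarrow> 'o \<Rightarrow> 'o \<Rightarrow> 'm \<Rightarrow> 'm \<Rightarrow> 'm \<Rightarrow> bool"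

definition candidate_triangle ::
  "('k, 'o, 'm, 'z) tri_cat_scheme \<Rightarrow> 'o \<Rightarrow> 'o \<Rightarrow> 'o \<Rightarrow> 'm \<Rightarrow> 'm \<Rightarrow> 'm \<Rightarrow> bool" where
  "candidate_triangle C X Y Z u v w \<longleftrightarrow> X \<in> Ob C \<and> Y \<in> Ob C \<and> Z \<in> Ob C \<and>
     u \<in> mor C X Y \<and> v \<in> mor C Y Z \<and> w \<in> mor C Z (shift_ob C X)"

text \<open>
  The shift is only required to be a linear auto-equivalence (fully faithful and essentially
  surjective), which is why rotation is stated as an equivalence. The last axiom is the octahedral
  axiom.
\<close>

locale triangulated_category = additive_category K C
  for K :: "('k, 'r) ring_scheme" and C :: "('k, 'o, 'm, 'z) tri_cat_scheme" (structure) +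
  assumes shift_ob: "X \<in> Ob C \<Longrightarrow> shift_ob C X \<in> Ob C"
    and shift_linear: "X \<in> Ob C \<Longrightarrow> Y \<in> Ob C \<Longrightarrow>
      shift_mor C \<in> module_hom K (Hom C X Y) (Hom C (shift_ob C X) (shift_ob C Y))"
    and shift_fully_faithful: "X \<in> Ob C \<Longrightarrow> Y \<in> Ob C \<Longrightarrow>
      bij_betw (shift_mor C) (mor C X Y) (mor C (shift_ob C X) (shift_ob C Y))"
    and shift_ident: "X \<in> Ob C \<Longrightarrow> shift_mor C (ident C X) = ident C (shift_ob C X)"
    and shift_comp: "X \<in> Ob C \<Longrightarrow> Y \<in> Ob C \<Longrightarrow> Z \<in> Ob C \<Longrightarrow> f \<in> mor C X Y \<Longrightarrow> g \<in> mor C Y Z \<Longrightarrow>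
      shift_mor C (g \<cdot> f) = shift_mor C g \<cdot> shift_mor C f"
    and shift_ess_surj: "Y \<in> Ob C \<Longrightarrow> \<exists>X \<in> Ob C. isomorphic C (shift_ob C X) Y"
    and dist_candidate: "dist C X Y Z u v w \<Longrightarrow> candidate_triangle C X Y Z u v w"
    and dist_iso: "dist C X Y Z u v w \<Longrightarrow> candidate_triangle C X' Y' Z' u' v' w' \<Longrightarrow>
      isomorphism C X X' f \<Longrightarrow> isomorphism C Y Y' g \<Longrightarrow> isomorphism C Z Z' h \<Longrightarrow>
      g \<cdot> u = u' \<cdot> f \<Longrightarrow> h \<cdot> v = v' \<cdot> g \<Longrightarrow> shift_mor C f \<cdot> w = w' \<cdot> h \<Longrightarrow>
      dist C X' Y' Z' u' v' w'"
    and dist_ident: "X \<in> Ob C \<Longrightarrow> zero_object C Z \<Longrightarrow>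
      dist C X X Z (ident C X) \<zero>\<^bsub>Hom C X Z\<^esub> \<zero>\<^bsub>Hom C Z (shift_ob C X)\<^esub>"
    and dist_exists: "X \<in> Ob C \<Longrightarrow> Y \<in> Ob C \<Longrightarrow> u \<in> mor C X Y \<Longrightarrow> \<exists>Z v w. dist C X Y Z u v w"
    and dist_rotate: "candidate_triangle C X Y Z u v w \<Longrightarrow>
      dist C X Y Z u v w \<longleftrightarrow>
      dist C Y Z (shift_ob C X) v w (\<ominus>\<^bsub>Hom C (shift_ob C X) (shift_ob C Y)\<^esub> shift_mor C u)"
    and dist_morphism: "dist C X Y Z u v w \<Longrightarrow> dist C X' Y' Z' u' v' w' \<Longrightarrow>
      f \<in> mor C X X' \<Longrightarrow> g \<in> mor C Y Y' \<Longrightarrow> g \<cdot> u = u' \<cdot> f \<Longrightarrow>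
      \<exists>h \<in> mor C Z Z'. h \<cdot> v = v' \<cdot> g \<and> shift_mor C f \<cdot> w = w' \<cdot> h"
    and octahedral: "dist C X Y Q\<^sub>1 f p\<^sub>1 d\<^sub>1 \<Longrightarrow> dist C Y Z Q\<^sub>3 g p\<^sub>3 d\<^sub>3 \<Longrightarrow>
      dist C X Z Q\<^sub>2 (g \<cdot> f) p\<^sub>2 d\<^sub>2 \<Longrightarrow>
      \<exists>a \<in> mor C Q\<^sub>1 Q\<^sub>2. \<exists>b \<in> mor C Q\<^sub>2 Q\<^sub>3.
        dist C Q\<^sub>1 Q\<^sub>2 Q\<^sub>3 a b (shift_mor C p\<^sub>1 \<cdot> d\<^sub>3) \<and>
        a \<cdot> p\<^sub>1 = p\<^sub>2 \<cdot> g \<and> d\<^sub>2 \<cdot> a = d\<^sub>1 \<and>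
        b \<cdot> p\<^sub>2 = p\<^sub>3 \<and> d\<^sub>3 \<cdot> b = shift_mor C f \<cdot> d\<^sub>2"

text \<open>
  Two isomorphism classes are related if \<open>Y \<cong> X[n]\<close> for some integer \<open>n\<close>; since the shift need not
  be strictly invertible, negative \<open>n\<close> is expressed by exchanging \<open>X\<close> and \<open>Y\<close>.
\<close>

definition shift_orbit_rel :: "('k, 'o, 'm, 'z) tri_cat_scheme \<Rightarrow> ('o set \<times> 'o set) set" where
  "shift_orbit_rel C = {(iso_class C X, iso_class C Y) | X Y.
     indecomposable C X \<and> indecomposable C Y \<and>
     (\<exists>n. isomorphic C ((shift_ob C ^^ n) X) Y \<or> isomorphic C ((shift_ob C ^^ n) Y) X)}"


section \<open>Auslander-Reiten triangles and the Auslander-Reiten quiver\<close>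

definition AR_triangle ::
  "('k, 'o, 'm, 'z) tri_cat_scheme \<Rightarrow> 'o \<Rightarrow> 'o \<Rightarrow> 'o \<Rightarrow> 'm \<Rightarrow> 'm \<Rightarrow> 'm \<Rightarrow> bool" where
  "AR_triangle C U V W u v w \<longleftrightarrow> dist C U V W u v w \<and>
     indecomposable C U \<and> indecomposable C W \<and> w \<noteq> \<zero>\<^bsub>Hom C W (shift_ob C U)\<^esub> \<and>
     (\<forall>X \<in> Ob C. \<forall>f \<in> mor C X W. \<not> split_epi C X W f \<longrightarrow> (\<exists>g \<in> mor C X V. f = v \<cdot>\<^bsub>C\<^esub> g))"

definition has_AR_triangles :: "('k, 'o, 'm, 'z) tri_cat_scheme \<Rightarrow> bool" where
  "has_AR_triangles C \<longleftrightarrow>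
     (\<forall>X. indecomposable C X \<longrightarrow>
        (\<exists>U V u v w. AR_triangle C U V X u v w) \<and> (\<exists>V W u v w. AR_triangle C X V W u v w))"

definition AR_vertices :: "('k, 'o, 'm, 'z) lin_cat_scheme \<Rightarrow> 'o set set" where
  "AR_vertices C = iso_class C ` {X. indecomposable C X}"

definition AR_arrows :: "('k, 'o, 'm, 'z) lin_cat_scheme \<Rightarrow> ('o set \<times> 'o set) set" where
  "AR_arrows C = {(x, y). x \<in> AR_vertices C \<and> y \<in> AR_vertices C \<and>
     (\<exists>X \<in> x. \<exists>Y \<in> y. \<exists>f. irreducible_mor C X Y f)}"

text \<open>\<open>n\<close> is the number of summands isomorphic to \<open>X\<close> in a decomposition of \<open>M\<close> into indecomposables.\<close>

definition summand_mult :: "('k, 'o, 'm, 'z) lin_cat_scheme \<Rightarrow> 'o \<Rightarrow> 'o \<Rightarrow> nat \<Rightarrow> bool" where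
  "summand_mult C M X n \<longleftrightarrow>
     (\<exists>Ys. direct_sum C M Ys \<and> (\<forall>Y \<in> set Ys. indecomposable C Y) \<and>
        n = length (filter (isomorphic C X) Ys))"

text \<open>
  The valuation \<open>(a, b)\<close> of an arrow, and below the translate of a vertex, are meaningful only where
  the Auslander-Reiten triangles exist; they are then unique up to isomorphism.
\<close>

definition AR_valuation :: "('k, 'o, 'm, 'z) tri_cat_scheme \<Rightarrow> 'o set \<Rightarrow> 'o set \<Rightarrow> nat \<times> nat" where
  "AR_valuation C x y =
     (THE a. \<exists>X \<in> x. \<exists>Y \<in> y. \<exists>U V u v w. AR_triangle C U V Y u v w \<and> summand_mult C V X a,
      THE b. \<exists>X \<in> x. \<exists>Y \<in> y. \<exists>V W u v w. AR_triangle C X V W u v w \<and> summand_mult C V Y b)"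

definition AR_translate_rel :: "('k, 'o, 'm, 'z) tri_cat_scheme \<Rightarrow> 'o set \<Rightarrow> 'o set \<Rightarrow> bool" where
  "AR_translate_rel C y x \<longleftrightarrow> x \<in> AR_vertices C \<and> y \<in> AR_vertices C \<and>
     (\<exists>W \<in> y. \<exists>U \<in> x. \<exists>V u v w. AR_triangle C U V W u v w)"

definition AR_translate :: "('k, 'o, 'm, 'z) tri_cat_scheme \<Rightarrow> 'o set \<Rightarrow> 'o set" where
  "AR_translate C y = (THE x. AR_translate_rel C y x)"

text \<open>\<open>x = \<tau>\<^sup>n y\<close>, all intermediate translates being defined.\<close>

definition AR_translate_power ::
  "('k, 'o, 'm, 'z) tri_cat_scheme \<Rightarrow> int \<Rightarrow> 'o set \<Rightarrow> 'o set \<Rightarrow> bool" where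
  "AR_translate_power C n y x \<longleftrightarrow>
     (if 0 \<le> n then (AR_translate_rel C ^^ nat n) y x else (AR_translate_rel C ^^ nat (- n)) x y)"

definition AR_component :: "('k, 'o, 'm, 'z) lin_cat_scheme \<Rightarrow> 'o set set \<Rightarrow> bool" where
  "AR_component C \<Gamma> \<longleftrightarrow>
     (\<exists>x \<in> AR_vertices C. \<Gamma> = {y. (x, y) \<in> (AR_arrows C \<union> (AR_arrows C)\<inverse>)\<^sup>*})"

definition stable_component :: "('k, 'o, 'm, 'z) tri_cat_scheme \<Rightarrow> 'o set set \<Rightarrow> bool" where
  "stable_component C \<Gamma> \<longleftrightarrow> AR_component C \<Gamma> \<and>
     (\<forall>M \<in> \<Gamma>.
        (\<forall>n. \<exists>N \<in> \<Gamma>. AR_translate_power C n M N) \<and>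
        (\<forall>N. (M, N) \<in> AR_arrows C \<or> (N, M) \<in> AR_arrows C \<longrightarrow> N \<in> \<Gamma>))"


section \<open>Valued translation quivers and tree classes\<close>

record 'a vt_quiver =
  q_verts :: "'a set"
  q_arrows :: "('a \<times> 'a) set"
  q_val :: "'a \<Rightarrow> 'a \<Rightarrow> nat \<times> nat"
  q_trans :: "'a \<Rightarrow> 'a"

definition AR_subquiver :: "('k, 'o, 'm, 'z) tri_cat_scheme \<Rightarrow> 'o set set \<Rightarrow> 'o set vt_quiver" where
  "AR_subquiver C \<Gamma> = \<lparr>q_verts = \<Gamma>, q_arrows = AR_arrows C \<inter> \<Gamma> \<times> \<Gamma>,
     q_val = AR_valuation C, q_trans = AR_translate C\<rparr>"

text \<open>
  An undirected graph with symmetric edge set. If \<open>val T x y = (a, b)\<close> is the valuation of an edge read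
  from \<open>x\<close> to \<open>y\<close>, then its valuation read from \<open>y\<close> to \<open>x\<close> is \<open>(b, a)\<close>.
\<close>

record 'v valued_graph =
  verts :: "'v set"
  edges :: "('v \<times> 'v) set"
  val :: "'v \<Rightarrow> 'v \<Rightarrow> nat \<times> nat"

definition valued_tree :: "'v valued_graph \<Rightarrow> bool" where
  "valued_tree T \<longleftrightarrow> verts T \<noteq> {} \<and> edges T \<subseteq> verts T \<times> verts T \<and> sym (edges T) \<and> irrefl (edges T) \<and>
     (\<forall>(x, y) \<in> edges T. fst (val T x y) > 0 \<and> snd (val T x y) > 0 \<and>
        val T y x = prod.swap (val T x y)) \<and>
     (\<forall>x \<in> verts T. \<forall>y \<in> verts T. (x, y) \<in> (edges T)\<^sup>*) \<and>
     \<not> (\<exists>p. length p \<ge> 3 \<and> distinct p \<and> successively (\<lambda>x y. (x, y) \<in> edges T) p \<and>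
           (last p, hd p) \<in> edges T)"

definition orientation :: "'v valued_graph \<Rightarrow> ('v \<times> 'v) set \<Rightarrow> bool" where
  "orientation T \<Omega> \<longleftrightarrow> \<Omega> \<union> \<Omega>\<inverse> = edges T \<and> \<Omega> \<inter> \<Omega>\<inverse> = {}"

text \<open>
  Both \<open>(n, x) \<rightarrow> (n, y)\<close> and \<open>(n, y) \<rightarrow> (n + 1, x)\<close> carry the valuation of the edge read in the
  direction of the arrow, which is \<open>(a, b)\<close> and \<open>(b, a)\<close> respectively.
\<close>

definition Z_quiver :: "'v valued_graph \<Rightarrow> ('v \<times> 'v) set \<Rightarrow> (int \<times> 'v) vt_quiver" where
  "Z_quiver T \<Omega> = \<lparr>q_verts = UNIV \<times> verts T,
     q_arrows = {((n, x), (n, y)) | n x y. (x, y) \<in> \<Omega>} \<union>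
                {((n, y), (n + 1, x)) | n x y. (x, y) \<in> \<Omega>},
     q_val = (\<lambda>p q. val T (snd p) (snd q)),
     q_trans = (\<lambda>(n, x). (n - 1, x))\<rparr>"

definition quiver_automorphism :: "'a vt_quiver \<Rightarrow> ('a \<Rightarrow> 'a) \<Rightarrow> bool" where
  "quiver_automorphism Q g \<longleftrightarrow> g \<in> Bij (q_verts Q) \<and>
     (\<forall>x \<in> q_verts Q. g (q_trans Q x) = q_trans Q (g x)) \<and>
     (\<forall>x \<in> q_verts Q. \<forall>y \<in> q_verts Q. (g x, g y) \<in> q_arrows Q \<longleftrightarrow> (x, y) \<in> q_arrows Q) \<and>
     (\<forall>(x, y) \<in> q_arrows Q. q_val Q (g x) (g y) = q_val Q x y)"

definition covering :: "'a vt_quiver \<Rightarrow> 'b vt_quiver \<Rightarrow> ('a \<Rightarrow> 'b) \<Rightarrow> bool" where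
  "covering Q R \<pi> \<longleftrightarrow> \<pi> ` q_verts Q = q_verts R \<and>
     (\<forall>x \<in> q_verts Q. \<pi> (q_trans Q x) = q_trans R (\<pi> x)) \<and>
     (\<forall>(x, y) \<in> q_arrows Q. (\<pi> x, \<pi> y) \<in> q_arrows R \<and> q_val R (\<pi> x) (\<pi> y) = q_val Q x y) \<and>
     (\<forall>x \<in> q_verts Q.
        bij_betw \<pi> {y. (x, y) \<in> q_arrows Q} {z. (\<pi> x, z) \<in> q_arrows R} \<and>
        bij_betw \<pi> {y. (y, x) \<in> q_arrows Q} {z. (z, \<pi> x) \<in> q_arrows R})"

text \<open>
  An isomorphism of the quotient of \<open>Z_quiver T \<Omega>\<close> by \<open>G\<close> with \<open>Q\<close>, composed with the covering onto
  that quotient, is a covering of \<open>Q\<close> whose fibres are the \<open>G\<close>-orbits.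
\<close>

definition has_tree_class :: "'a vt_quiver \<Rightarrow> 'v valued_graph \<Rightarrow> bool" where
  "has_tree_class Q T \<longleftrightarrow> valued_tree T \<and>
     (\<exists>\<Omega> G \<pi>. orientation T \<Omega> \<and>
        subgroup G (BijGroup (q_verts (Z_quiver T \<Omega>))) \<and>
        (\<forall>g \<in> G. quiver_automorphism (Z_quiver T \<Omega>) g) \<and>
        covering (Z_quiver T \<Omega>) Q \<pi> \<and>
        (\<forall>p \<in> q_verts (Z_quiver T \<Omega>). \<forall>q \<in> q_verts (Z_quiver T \<Omega>).
           \<pi> p = \<pi> q \<longleftrightarrow> (\<exists>g \<in> G. g p = q)))"


section \<open>Dynkin diagrams\<close>

definition simply_laced :: "nat \<Rightarrow> (nat \<times> nat) set \<Rightarrow> nat valued_graph" where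
  "simply_laced n E = \<lparr>verts = {..<n}, edges = E \<union> E\<inverse>, val = (\<lambda>_ _. (1, 1))\<rparr>"

definition set_val :: "'v \<Rightarrow> 'v \<Rightarrow> nat \<times> nat \<Rightarrow> 'v valued_graph \<Rightarrow> 'v valued_graph" where
  "set_val x y c T = T\<lparr>val := (\<lambda>u v. if (u, v) = (x, y) then c
     else if (u, v) = (y, x) then prod.swap c else val T u v)\<rparr>"

definition line :: "nat \<Rightarrow> (nat \<times> nat) set" where
  "line n = {(i, i + 1) | i. i + 1 < n}"

definition A_diagram :: "nat \<Rightarrow> nat valued_graph" where
  "A_diagram n = simply_laced n (line n)"

definition B_diagram :: "nat \<Rightarrow> nat valued_graph" where
  "B_diagram n = set_val (n - 2) (n - 1) (1, 2) (simply_laced n (line n))"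

definition C_diagram :: "nat \<Rightarrow> nat valued_graph" where
  "C_diagram n = set_val (n - 2) (n - 1) (2, 1) (simply_laced n (line n))"

definition D_diagram :: "nat \<Rightarrow> nat valued_graph" where
  "D_diagram n = simply_laced n (line (n - 1) \<union> {(n - 3, n - 1)})"

definition E_diagram :: "nat \<Rightarrow> nat valued_graph" where
  "E_diagram n = simply_laced n (line (n - 1) \<union> {(2, n - 1)})"

definition F4_diagram :: "nat valued_graph" where
  "F4_diagram = set_val 1 2 (1, 2) (simply_laced 4 (line 4))"

definition G2_diagram :: "nat valued_graph" where
  "G2_diagram = set_val 0 1 (1, 3) (simply_laced 2 (line 2))"

definition dynkin_diagrams :: "nat valued_graph set" where
  "dynkin_diagrams =
     {A_diagram n | n. n \<ge> 1} \<union> {B_diagram n | n. n \<ge> 2} \<union> {C_diagram n | n. n \<ge> 2} \<union>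
     {D_diagram n | n. n \<ge> 4} \<union> {E_diagram 6, E_diagram 7, E_diagram 8} \<union>
     {F4_diagram, G2_diagram}"

definition valued_graph_iso :: "'v valued_graph \<Rightarrow> 'w valued_graph \<Rightarrow> bool" where
  "valued_graph_iso S T \<longleftrightarrow>
     (\<exists>f. bij_betw f (verts S) (verts T) \<and>
        (\<forall>x \<in> verts S. \<forall>y \<in> verts S. (f x, f y) \<in> edges T \<longleftrightarrow> (x, y) \<in> edges S) \<and>
        (\<forall>(x, y) \<in> edges S. val T (f x) (f y) = val S x y))"

definition is_dynkin :: "'v valued_graph \<Rightarrow> bool" where
  "is_dynkin T \<longleftrightarrow> (\<exists>D \<in> dynkin_diagrams. valued_graph_iso T D)"

end

theory Submission
  imports Complex_Main Defs
begin

text \<open>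
  For an indecomposable object \<open>M\<close>, the function \<open>X \<mapsto> dim Hom(M, X)\<close> is additive on the
  Auslander-Reiten triangles ending at \<open>W\<close> unless \<open>W\<close> is isomorphic to \<open>M\<close> or \<open>M[1]\<close>. Pulled back
  along the covering by \<open>\<int>T\<close> it is a non-negative integral function whose slices evolve by an isometry
  of a positive definite form, as \<open>T\<close> is a Dynkin diagram; an additive half-infinite sequence of slices
  is therefore periodic and then zero. Either \<open>\<Gamma>\<close> is finite or the fibres of the covering are, and in
  both cases only finitely many vertices of \<open>\<Gamma>\<close> receive a non-zero morphism from \<open>M\<close>.

  If \<open>N\<close> lies in \<open>\<Gamma>\<close> and \<open>N \<rightarrow> M\<close> is non-zero, factoring repeatedly through left almost split morphisms
  gives a chain of radical morphisms with non-zero composites through this finite set of classes, which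
  must stop; so \<open>M\<close> is in \<open>\<Gamma>\<close>, at the end of a path from \<open>N\<close>. Applied to the connecting morphisms
  \<open>W \<rightarrow> (\<tau>W)[1]\<close> this shows that \<open>\<Gamma>\<close> is stable under \<open>[1]\<close>, and lifting the resulting infinite path to
  \<open>\<int>T\<close>, which has finitely many \<open>\<tau>\<close>-orbits, yields \<open>\<tau>\<^sup>c y[i] = y\<close> with \<open>i, c > 0\<close> for every vertex \<open>y\<close>.
  Hence \<open>[1]\<close> is onto \<open>\<Gamma>\<close> and has finitely many orbits. Finally a non-zero morphism \<open>M \<rightarrow> U[1]\<close> with \<open>U\<close> in
  \<open>\<Gamma>\<close> forces a non-zero morphism \<open>\<tau>\<^sup>-\<^sup>1 U \<rightarrow> M\<close>, so \<open>\<Gamma>\<close> is closed under non-zero morphisms in both directions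
  and connectedness applies.
\<close>

section \<open>Dimensions of vector spaces\<close>

text \<open>Auslander-Reiten triangles are given only inside \<Gamma>, so no Serre functor is at
  hand. Its substitute is a socle property of the connecting morphism \<open>w\<close> of such a
  triangle \<open>U, V, W\<close>: \<open>w\<close> factors through every non-zero morphism into
  \<open>U[1]\<close> and is killed by every morphism into \<open>W\<close> that is not a split
  epimorphism. The first half relates morphisms into and out of \<Gamma>, the second counts summands
  and makes valuations well defined. Passing between consecutive slices of \<int>T is the Coxeter
  transformation of \<open>T\<close>. Its fixed vectors are isotropic for the Tits form, which is
  why the sum over a period vanishes. Definiteness is not drawn from root systems; each diagram only
  has to carry a positive weight exceeding half of the weighted sum over the neighbours. The
  exceptional meshes, those ending at \<open>M\<close> or \<open>M[1]\<close>, could recur for ever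
  if fibres were infinite, leaving no additive tail. But a repetition in one \<tau>-orbit of \<int>T
  spreads to neighbouring orbits, as vertices have finitely many successors, and then \<Gamma> is
  finite.\<close>

lemma linear_mapI:
  assumes "vectorspace K V" "vectorspace K W" "T \<in> module_hom K V W"
  shows "linear_map K V W T"
  using assms by (simp add: linear_map_def mod_hom_def mod_hom_axioms_def vectorspace_def)

lemma (in vectorspace) subspaceI:
  assumes "W \<subseteq> carrier V" "\<zero>\<^bsub>V\<^esub> \<in> W"
    and "\<And>v w. v \<in> W \<Longrightarrow> w \<in> W \<Longrightarrow> v \<oplus>\<^bsub>V\<^esub> w \<in> W"
    and "\<And>c v. c \<in> carrier K \<Longrightarrow> v \<in> W \<Longrightarrow> c \<odot>\<^bsub>V\<^esub> v \<in> W"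
  shows "subspace K W V"
  using assms vectorspace_axioms module_axioms by (simp add: subspace_def submodule_def)

text \<open>Spanning sets of the kernel and of the target, the latter lifted along \<open>T\<close>,
  together span \<open>V\<close>. Rank-nullity presupposes that \<open>V\<close> is
  finite-dimensional, and \<open>hom_finite\<close> speaks only of indecomposables, so finiteness
  has to be propagated first.\<close>

lemma (in linear_map) fin_dim_of_ker_im:
  assumes surj: "T ` carrier V = carrier W" and W_fin: "W.fin_dim"
    and ker_fin: "vectorspace.fin_dim K (V.vs kerT)"
  shows "V.fin_dim"
proof -
  have sm_ker: "submodule K kerT V" using kerT_is_subspace by (simp add: subspace_def)
  interpret Ker: vectorspace K "V.vs kerT"
    using kerT_is_subspace by (rule V.subspace_is_vs)
  obtain A where A: "finite A" "A \<subseteq> kerT" "Ker.span A = kerT"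
    using ker_fin unfolding Ker.fin_dim_def by auto
  have ker_sub: "kerT \<subseteq> carrier V" by (auto simp: ker_def)
  have spA: "V.module.span A = kerT"
    using V.module.span_li_not_depend(1)[OF A(2) sm_ker] A(3) by simp
  obtain D where D: "finite D" "D \<subseteq> carrier W" "W.module.span D = carrier W"
    using W_fin unfolding W.fin_dim_def by auto
  obtain B where B: "finite B" "B \<subseteq> carrier V" "D = T ` B"
    using D(1,2) surj by (metis finite_subset_image)
  have smB: "submodule K (V.module.span B) V" by (rule V.module.span_is_submodule[OF B(2)])
  have spB_sub: "V.module.span B \<subseteq> carrier V" by (rule V.module.span_is_subset2[OF B(2)])
  have im_sub: "subspace K (T ` V.module.span B) W"
  proof (rule W.subspaceI)
    show "T ` V.module.span B \<subseteq> carrier W" using spB_sub by auto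
    show "\<zero>\<^bsub>W\<^esub> \<in> T ` V.module.span B"
      by (rule image_eqI[where f = T, OF T0_is_0[symmetric] submodule.zero_closed[OF smB]])
    fix v w assume "v \<in> T ` V.module.span B" "w \<in> T ` V.module.span B"
    then obtain v' w' where "v = T v'" "w = T w'" "v' \<in> V.module.span B" "w' \<in> V.module.span B" by auto
    then have "v \<oplus>\<^bsub>W\<^esub> w = T (v' \<oplus>\<^bsub>V\<^esub> w')" using spB_sub by (simp add: subsetD)
    then show "v \<oplus>\<^bsub>W\<^esub> w \<in> T ` V.module.span B"
      using submodule.m_closed[OF smB \<open>v' \<in> V.module.span B\<close> \<open>w' \<in> V.module.span B\<close>] by auto
  next
    fix c v assume c: "c \<in> carrier K" and "v \<in> T ` V.module.span B"
    then obtain v' where v': "v = T v'" "v' \<in> V.module.span B" by auto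
    then have "c \<odot>\<^bsub>W\<^esub> v = T (c \<odot>\<^bsub>V\<^esub> v')" using spB_sub c by (simp add: subsetD)
    then show "c \<odot>\<^bsub>W\<^esub> v \<in> T ` V.module.span B"
      using submodule.smult_closed[OF smB c v'(2)] by auto
  qed
  have "D \<subseteq> T ` V.module.span B"
    using V.module.in_own_span[OF B(2)] B(3) by auto
  then have TB: "carrier W \<subseteq> T ` V.module.span B"
    using W.module.span_is_subset[OF _ W.is_module[OF im_sub], of D] D(3) by simp
  have AB: "A \<union> B \<subseteq> carrier V" using A(2) ker_sub B(2) by auto
  have smAB: "submodule K (V.module.span (A \<union> B)) V" by (rule V.module.span_is_submodule[OF AB])
  have "carrier V \<subseteq> V.module.span (A \<union> B)"
  proof
    fix v assume v: "v \<in> carrier V"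
    then obtain s where s: "s \<in> V.module.span B" "T v = T s"
      using TB T_im[OF v] by blast
    have sc: "s \<in> carrier V" using s(1) spB_sub by auto
    have "T (v \<ominus>\<^bsub>V\<^esub> s) = \<zero>\<^bsub>W\<^esub>" using v sc s(2) by (simp add: a_minus_def W.module.M.r_neg)
    then have "v \<ominus>\<^bsub>V\<^esub> s \<in> V.module.span A" using v sc spA by (simp add: ker_def)
    then have 1: "v \<ominus>\<^bsub>V\<^esub> s \<in> V.module.span (A \<union> B)"
      using V.module.span_is_monotone[of A "A \<union> B"] by auto
    have 2: "s \<in> V.module.span (A \<union> B)" using V.module.span_is_monotone[of B "A \<union> B"] s(1) by auto
    have "v = (v \<ominus>\<^bsub>V\<^esub> s) \<oplus>\<^bsub>V\<^esub> s"
      using v sc by (simp add: a_minus_def V.module.M.a_assoc V.module.M.l_neg)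
    then show "v \<in> V.module.span (A \<union> B)" using submodule.m_closed[OF smAB 1 2] by simp
  qed
  then have "V.module.span (A \<union> B) = carrier V" using V.module.span_is_subset2[OF AB] by auto
  then show ?thesis unfolding V.fin_dim_def using A(1) B(1) AB by blast
qed

text \<open>Independent subsets of \<open>W\<close> have at most \<open>dim\<close> elements, so a
  maximal one exists and is a basis of \<open>W\<close>; if it has \<open>dim\<close> elements, it
  is also a basis of the whole space.\<close>

lemma (in vectorspace) subspace_fin_dim:
  assumes fd: "fin_dim" and W: "subspace K W V"
  shows "vectorspace.fin_dim K (vs W)" "vectorspace.dim K (vs W) \<le> dim"
    "vectorspace.dim K (vs W) = dim \<Longrightarrow> W = carrier V"
proof -
  interpret W: vectorspace K "vs W" using W by (rule subspace_is_vs)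
  have sm: "submodule K W V" using W by (simp add: subspace_def)
  have sub: "W \<subseteq> carrier V" using sm by (simp add: submodule_def)
  have li: "W.lin_indpt S \<longleftrightarrow> lin_indpt S" if "S \<subseteq> W" for S
    using span_li_not_depend(2)[OF that sm] by simp
  have bound: "finite S \<and> card S \<le> dim" if "S \<subseteq> W \<and> W.lin_indpt S" for S
    using that li sub li_le_dim[OF fd, of S] by auto
  have empty_li: "W.lin_indpt {}"
    by (metis W.finite_lin_indpt2 empty_iff empty_subsetI finite.emptyI)
  obtain S where S: "finite S" "maximal S (\<lambda>S. S \<subseteq> W \<and> W.lin_indpt S)"
    using maximal_exists[of "\<lambda>S. S \<subseteq> W \<and> W.lin_indpt S" dim "{}"] bound empty_li by auto
  have bas: "W.basis S" using W.max_li_is_basis[of S] S(2) by simp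
  then show "W.fin_dim" unfolding W.fin_dim_def W.basis_def using S(1) by auto
  have dS: "W.dim = card S" using W.dim_basis S(1) bas by simp
  have SW: "S \<subseteq> W" "W.lin_indpt S" "W.span S = W" using bas unfolding W.basis_def by auto
  show "W.dim \<le> dim" using bound[of S] SW dS by simp
  assume eq: "W.dim = dim"
  have "basis S"
    using dim_li_is_basis[OF fd S(1)] SW li sub dS eq by auto
  then have "span S = carrier V" unfolding basis_def by simp
  then show "W = carrier V" using span_li_not_depend(1)[OF SW(1) sm] SW(3) by simp
qed

text \<open>Rank-nullity twice: the kernel of \<open>T\<close> is the image of \<open>S\<close>, and
  the injective \<open>S\<close> preserves dimension.\<close>

lemma dim_short_exact:
  assumes V: "vectorspace K V1" "vectorspace K V2" "vectorspace K V3"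
    and fd: "vectorspace.fin_dim K V2" "vectorspace.fin_dim K V1"
    and S: "S \<in> module_hom K V1 V2" "inj_on S (carrier V1)"
    and T: "T \<in> module_hom K V2 V3" "T ` carrier V2 = carrier V3"
    and ex: "S ` carrier V1 = {v \<in> carrier V2. T v = \<zero>\<^bsub>V3\<^esub>}"
  shows "vectorspace.dim K V2 = vectorspace.dim K V1 + vectorspace.dim K V3"
proof -
  interpret T: linear_map K V2 V3 T by (intro linear_mapI V T)
  interpret S: linear_map K V1 V2 S by (intro linear_mapI V S)
  have "vectorspace.dim K (V3\<lparr>carrier := T.im\<rparr>) + vectorspace.dim K (V2\<lparr>carrier := T.ker\<rparr>) = T.V.dim"
    by (rule T.rank_nullity) (rule fd)
  moreover have "T.im = carrier V3" using T(2) by (simp add: T.im_def)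
  moreover have "T.ker = S.im" using ex by (auto simp: T.ker_def S.im_def)
  moreover have "vectorspace.dim K (V2\<lparr>carrier := S.im\<rparr>) = S.V.dim"
    using S.rank_nullity[OF fd(2)] S.inj_imp_dim_ker0[OF S(2)] by simp
  ultimately show ?thesis by simp
qed

text \<open>Induction on \<open>n\<close>: the last projection is onto with kernel \<open>U\<close>,
  and the remaining projections decompose \<open>U\<close>. Phrasing the decomposition by
  projections alone covers both \<open>Hom(M, X)\<close> and the socle spaces below, where the
  projections are given by composition.\<close>

lemma dim_direct_sum:
  fixes n :: nat
  assumes "vectorspace K V"
    and "\<And>j. j < n \<Longrightarrow> vectorspace K (W j)"
    and "\<And>j. j < n \<Longrightarrow> vectorspace.fin_dim K (W j)"
    and "\<And>j. j < n \<Longrightarrow> P j \<in> module_hom K V (W j)"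
    and "\<And>j g. j < n \<Longrightarrow> g \<in> carrier (W j) \<Longrightarrow>
      \<exists>f \<in> carrier V. P j f = g \<and> (\<forall>l < n. l \<noteq> j \<longrightarrow> P l f = \<zero>\<^bsub>W l\<^esub>)"
    and "\<And>f. f \<in> carrier V \<Longrightarrow> (\<And>j. j < n \<Longrightarrow> P j f = \<zero>\<^bsub>W j\<^esub>) \<Longrightarrow> f = \<zero>\<^bsub>V\<^esub>"
  shows "vectorspace.fin_dim K V \<and> vectorspace.dim K V = (\<Sum>j<n. vectorspace.dim K (W j))"
  using assms
proof (induction n arbitrary: V)
  case 0
  interpret vectorspace K V by fact
  have "carrier V = {\<zero>\<^bsub>V\<^esub>}" using 0(6) by auto
  then have g: "gen_set {}" by (simp add: span_empty)
  then have "fin_dim" unfolding fin_dim_def by (metis empty_subsetI finite.emptyI)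
  moreover have "dim \<le> card {}" using gen_ge_dim[of "{}"] g by simp
  ultimately show ?case by simp
next
  case (Suc n)
  interpret T: linear_map K V "W n" "P n" using Suc.prems by (intro linear_mapI) auto
  define U where "U = V\<lparr>carrier := T.ker\<rparr>"
  have U: "vectorspace K U"
    unfolding U_def using T.kerT_is_subspace by (rule T.V.subspace_is_vs)
  have ker: "T.ker = {v \<in> carrier V. P n v = \<zero>\<^bsub>W n\<^esub>}" by (simp add: T.ker_def)
  have IH: "vectorspace.fin_dim K U \<and> vectorspace.dim K U = (\<Sum>j<n. vectorspace.dim K (W j))"
  proof (rule Suc.IH[OF U])
    fix j assume j: "j < n"
    show "vectorspace K (W j)" "vectorspace.fin_dim K (W j)" using Suc.prems j by auto
    show "P j \<in> module_hom K U (W j)"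
      using Suc.prems(4)[of j] j by (auto simp: module_hom_def U_def ker)
    fix g assume "g \<in> carrier (W j)"
    then obtain f where f: "f \<in> carrier V" "P j f = g" "\<forall>l < Suc n. l \<noteq> j \<longrightarrow> P l f = \<zero>\<^bsub>W l\<^esub>"
      using Suc.prems(5)[of j g] j by auto
    then show "\<exists>f \<in> carrier U. P j f = g \<and> (\<forall>l < n. l \<noteq> j \<longrightarrow> P l f = \<zero>\<^bsub>W l\<^esub>)"
      using j by (intro bexI[of _ f]) (auto simp: U_def ker)
  next
    fix f assume "f \<in> carrier U" "\<And>j. j < n \<Longrightarrow> P j f = \<zero>\<^bsub>W j\<^esub>"
    then show "f = \<zero>\<^bsub>U\<^esub>" using Suc.prems(6)[of f] by (auto simp: U_def ker less_Suc_eq)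
  qed
  have surj: "P n ` carrier V = carrier (W n)"
  proof
    show "carrier (W n) \<subseteq> P n ` carrier V"
    proof
      fix g assume "g \<in> carrier (W n)"
      then obtain f where "f \<in> carrier V" "P n f = g" using Suc.prems(5)[of n g] by auto
      then show "g \<in> P n ` carrier V" by auto
    qed
  qed auto
  have fd: "T.V.fin_dim"
    using T.fin_dim_of_ker_im[OF surj] Suc.prems(3)[of n] IH by (simp add: U_def)
  have "T.im = carrier (W n)" using surj by (simp add: T.im_def)
  then have "vectorspace.dim K (W n) + vectorspace.dim K U = T.V.dim"
    using T.rank_nullity[OF fd] by (simp add: U_def)
  then show ?case using fd IH by simp
qed

lemma (in vectorspace) carrier_of_dim_zero:
  assumes fd: "fin_dim" and "dim = 0"
  shows "carrier V = {\<zero>\<^bsub>V\<^esub>}"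
proof -
  obtain B where B: "finite B" "basis B" using finite_basis_exists[OF fd] by blast
  then have "B = {}" using dim_basis[OF B] assms(2) by simp
  then show ?thesis using B(2) span_empty by (simp add: basis_def)
qed

lemma module_hom_restrict:
  assumes "f \<in> module_hom R M N" "A \<subseteq> carrier M" "f ` A \<subseteq> B"
  shows "f \<in> module_hom R (M\<lparr>carrier := A\<rparr>) (N\<lparr>carrier := B\<rparr>)"
  using assms by (simp add: module_hom_def subset_iff Pi_iff image_subset_iff)

lemma (in vectorspace) subspaces_dim:
  assumes fd: "fin_dim" and A: "subspace K A V" and B: "subspace K B V" and sub: "A \<subseteq> B"
  shows "vectorspace.dim K (vs A) \<le> vectorspace.dim K (vs B)"
    "vectorspace.dim K (vs A) = vectorspace.dim K (vs B) \<Longrightarrow> A = B"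
proof -
  interpret B: vectorspace K "vs B" using B by (rule subspace_is_vs)
  have "submodule K A V" using A by (simp add: subspace_def)
  then have AB: "subspace K A (vs B)"
    using sub by (intro B.subspaceI) (auto simp: submodule_def)
  have "B.fin_dim" by (rule subspace_fin_dim(1)[OF fd B])
  note B.subspace_fin_dim(2,3)[OF this AB]
  then show "vectorspace.dim K (vs A) \<le> vectorspace.dim K (vs B)"
    "vectorspace.dim K (vs A) = vectorspace.dim K (vs B) \<Longrightarrow> A = B" by simp_all
qed

text \<open>The dimensions form a decreasing sequence of naturals, constant from its minimum on, and
  nested subspaces of equal dimension coincide.\<close>

lemma (in vectorspace) decreasing_subspaces_stabilise:
  fixes L :: "nat \<Rightarrow> 'c set"
  assumes fd: "fin_dim" and L: "\<And>n. subspace K (L n) V" and dec: "\<And>n. L (Suc n) \<subseteq> L n"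
  shows "\<exists>m. \<forall>n\<ge>m. L (Suc n) = L n"
proof -
  define d where "d n = vectorspace.dim K (vs (L n))" for n
  have mono: "d (Suc n) \<le> d n" for n
    unfolding d_def using subspaces_dim(1)[OF fd L L dec] .
  obtain m where m: "\<And>n. d m \<le> d n"
    using ex_has_least_nat[of "\<lambda>_. True" 0 d] by blast
  have const: "d n = d m" if "n \<ge> m" for n
    using that
  proof (induction n rule: dec_induct)
    case (step n)
    then show ?case using mono[of n] m[of "Suc n"] by simp
  qed simp
  then have "d (Suc n) = d n" if "n \<ge> m" for n
    using const[OF that] const[of "Suc n"] that by linarith
  then show ?thesis
    unfolding d_def using subspaces_dim(2)[OF fd L L dec] by blast
qed

section \<open>Additive functions of finite type\<close>

text \<open>All assumptions are invariant under reversing \<Omega>, which later lets one result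
  treat the slices going to the right and those going to the left.\<close>

locale finite_type_form =
  fixes V :: "'v set" and \<Omega> :: "('v \<times> 'v) set" and a :: "'v \<Rightarrow> 'v \<Rightarrow> nat" and c d :: "'v \<Rightarrow> real"
  assumes fin: "finite V"
    and antisymmetric: "\<Omega> \<inter> \<Omega>\<inverse> = {}"
    and c_pos: "x \<in> V \<Longrightarrow> 0 < c x"
    and d_pos: "x \<in> V \<Longrightarrow> 0 < d x"
    and superharmonic: "x \<in> V \<Longrightarrow>
      (\<Sum>z\<in>V. if (z, x) \<in> \<Omega> \<union> \<Omega>\<inverse> then real (a z x) * c z else 0) < 2 * c x"
    and symmetrizable: "(z, x) \<in> \<Omega> \<Longrightarrow> d x * real (a z x) = d z * real (a x z)"
begin

definition weight :: "'v \<Rightarrow> 'v \<Rightarrow> real" where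
  "weight z x = (if (z, x) \<in> \<Omega> then d x * real (a z x) else 0)"

text \<open>The Euler form of the oriented valued graph, which is not symmetric. Its quadratic form
  \<open>form v v\<close> is the Tits form and does not depend on the orientation.\<close>

definition form :: "('v \<Rightarrow> real) \<Rightarrow> ('v \<Rightarrow> real) \<Rightarrow> real" where
  "form u v = (\<Sum>x\<in>V. d x * u x * v x) - (\<Sum>x\<in>V. \<Sum>z\<in>V. weight z x * u x * v z)"

text \<open>With \<open>A\<close> the matrix of \<open>form\<close>, the relation \<open>successor v v'\<close> is \<open>A v' = - A\<^sup>T v\<close>.\<close>

definition successor :: "('v \<Rightarrow> real) \<Rightarrow> ('v \<Rightarrow> real) \<Rightarrow> bool" where
  "successor v v' \<longleftrightarrow> (\<forall>x\<in>V. d x * (v x + v' x) =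
     (\<Sum>z\<in>V. weight z x * v' z) + (\<Sum>z\<in>V. weight x z * v z))"

text \<open>Pair \<open>A v' = - A^T v\<close> with \<open>u\<close>; exchanging the two summations
  is the transposition. The relation \<open>successor\<close> is that of the Coxeter transformation,
  and using the identity twice gives the invariance of the quadratic form.\<close>

lemma form_successor:
  assumes "successor v v'"
  shows "form u v' = - form v u"
proof -
  have "(\<Sum>x\<in>V. u x * (d x * (v x + v' x))) =
    (\<Sum>x\<in>V. u x * ((\<Sum>z\<in>V. weight z x * v' z) + (\<Sum>z\<in>V. weight x z * v z)))"
    using assms by (intro sum.cong) (auto simp: successor_def)
  moreover have "(\<Sum>x\<in>V. \<Sum>z\<in>V. weight x z * v z * u x) = (\<Sum>x\<in>V. \<Sum>z\<in>V. weight z x * v x * u z)"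
    by (rule sum.swap)
  ultimately show ?thesis
    by (simp add: form_def algebra_simps sum.distrib sum_distrib_left)
qed

lemma form_invariant: "successor v v' \<Longrightarrow> form v' v' = form v v"
  by (simp add: form_successor)

text \<open>Weighted arithmetic-geometric mean: each product \<open>v x * v z\<close> is estimated
  with the ratio of \<open>c z\<close> and \<open>c x\<close>, which makes the off-diagonal part
  diagonal. The diagonal coefficient left over is positive because \<open>c\<close> is strictly
  superharmonic.\<close>

lemma form_bound:
  obtains e where "\<And>x. x \<in> V \<Longrightarrow> 0 < e x" "\<And>v. (\<Sum>x\<in>V. e x * (v x)\<^sup>2) \<le> form v v"
proof
  define m where "m x = (\<Sum>z\<in>V. (weight z x + weight x z) * c z)" for x
  define e where "e x = d x - m x / (2 * c x)" for x
  have w_nonneg: "0 \<le> weight z x" if "x \<in> V" for z x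
    using d_pos[OF that] by (simp add: weight_def)
  fix x assume x: "x \<in> V"
  \<comment> \<open>Each edge at \<open>x\<close> contributes to only one of the two weights, and
    \<open>symmetrizable\<close> turns the outgoing weight \<open>d z * a x z\<close> into
    \<open>d x * a z x\<close>.\<close>
  have "m x = d x * (\<Sum>z\<in>V. if (z, x) \<in> \<Omega> \<union> \<Omega>\<inverse> then real (a z x) * c z else 0)"
    unfolding m_def sum_distrib_left
    using antisymmetric symmetrizable[of x] by (intro sum.cong) (auto simp: weight_def)
  also have "\<dots> < d x * (2 * c x)"
    by (intro mult_strict_left_mono superharmonic d_pos x)
  finally show "0 < e x"
    using c_pos[OF x] by (simp add: e_def field_simps)
next
  fix v :: "'v \<Rightarrow> real"
  define m where "m x = (\<Sum>z\<in>V. (weight z x + weight x z) * c z)" for x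
  have amgm: "s * t \<le> (s\<^sup>2 * q / p + t\<^sup>2 * p / q) / 2" if "0 < p" "0 < q" for s t p q :: real
  proof -
    have "0 \<le> (s * q - t * p)\<^sup>2 / (2 * p * q)" using that by simp
    also have "\<dots> = (s\<^sup>2 * q / p + t\<^sup>2 * p / q) / 2 - s * t"
      using that by (simp add: field_simps power2_eq_square)
    finally show ?thesis by simp
  qed
  have "(\<Sum>x\<in>V. \<Sum>z\<in>V. weight z x * v x * v z) \<le>
    (\<Sum>x\<in>V. \<Sum>z\<in>V. weight z x * (((v x)\<^sup>2 * c z / c x + (v z)\<^sup>2 * c x / c z) / 2))"
  proof (intro sum_mono)
    fix x z assume "x \<in> V" "z \<in> V"
    then show "weight z x * v x * v z \<le> weight z x * (((v x)\<^sup>2 * c z / c x + (v z)\<^sup>2 * c x / c z) / 2)"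
      using amgm[OF c_pos c_pos, of x z "v x" "v z"] d_pos[of x]
      by (simp add: mult.assoc mult_left_mono weight_def)
  qed
  also have "\<dots> = (\<Sum>x\<in>V. \<Sum>z\<in>V. weight z x * (v x)\<^sup>2 * c z / (2 * c x)) +
      (\<Sum>x\<in>V. \<Sum>z\<in>V. weight z x * (v z)\<^sup>2 * c x / (2 * c z))"
    unfolding sum.distrib[symmetric]
    by (intro sum.cong refl) (simp add: algebra_simps add_divide_distrib)
  also have "(\<Sum>x\<in>V. \<Sum>z\<in>V. weight z x * (v z)\<^sup>2 * c x / (2 * c z)) =
      (\<Sum>x\<in>V. \<Sum>z\<in>V. weight x z * (v x)\<^sup>2 * c z / (2 * c x))"
    by (rule sum.swap)
  also have "(\<Sum>x\<in>V. \<Sum>z\<in>V. weight z x * (v x)\<^sup>2 * c z / (2 * c x)) + \<dots> = (\<Sum>x\<in>V. m x / (2 * c x) * (v x)\<^sup>2)"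
    by (simp add: m_def sum.distrib[symmetric] sum_distrib_left sum_distrib_right sum_divide_distrib
        algebra_simps add_divide_distrib)
  finally show "(\<Sum>x\<in>V. (d x - (\<Sum>z\<in>V. (weight z x + weight x z) * c z) / (2 * c x)) * (v x)\<^sup>2) \<le> form v v"
    by (simp add: form_def m_def algebra_simps sum_subtractf power2_eq_square)
qed

lemma form_zero:
  assumes "form v v = 0" "x \<in> V"
  shows "v x = 0"
proof -
  obtain e where e: "\<And>x. x \<in> V \<Longrightarrow> 0 < e x" "\<And>v. (\<Sum>x\<in>V. e x * (v x)\<^sup>2) \<le> form v v"
    by (rule form_bound) blast
  have nonneg: "0 \<le> e x * (v x)\<^sup>2" if "x \<in> V" for x using e(1)[OF that] by simp
  then have "(\<Sum>x\<in>V. e x * (v x)\<^sup>2) = 0"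
    using e(2)[of v] assms(1) sum_nonneg[of V "\<lambda>x. e x * (v x)\<^sup>2"] by simp
  then have "e x * (v x)\<^sup>2 = 0"
    using sum_nonneg_eq_0_iff[OF fin nonneg] assms(2) by simp
  then show ?thesis using e(1)[OF assms(2)] by simp
qed

text \<open>
  The form is invariant along the sequence and positive definite, so the sequence takes only
  finitely many values. The sum over a period is its own successor, hence isotropic, hence zero.
\<close>

lemma additive_zero:
  fixes f :: "nat \<Rightarrow> 'v \<Rightarrow> nat"
  assumes add: "\<And>k x. x \<in> V \<Longrightarrow> f k x + f (Suc k) x =
      (\<Sum>z\<in>V. if (z, x) \<in> \<Omega> then a z x * f (Suc k) z else 0) +
      (\<Sum>z\<in>V. if (x, z) \<in> \<Omega> then a z x * f k z else 0)"
    and x: "x \<in> V"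
  shows "f k x = 0"
proof -
  define F where "F k x = real (f k x)" for k x
  have suc: "successor (F k) (F (Suc k))" for k
    unfolding successor_def
  proof
    fix x assume x: "x \<in> V"
    have "d x * (F k x + F (Suc k) x) = d x * real (f k x + f (Suc k) x)"
      by (simp add: F_def)
    also have "\<dots> = (\<Sum>z\<in>V. weight z x * F (Suc k) z) + (\<Sum>z\<in>V. weight x z * F k z)"
      unfolding add[OF x] of_nat_add of_nat_sum distrib_left sum_distrib_left
      using symmetrizable[of x]
      by (intro arg_cong2[of _ _ _ _ "(+)"] sum.cong) (auto simp: weight_def F_def)
    finally show "d x * (F k x + F (Suc k) x) =
      (\<Sum>z\<in>V. weight z x * F (Suc k) z) + (\<Sum>z\<in>V. weight x z * F k z)" .
  qed
  have inv: "form (F k) (F k) = form (F 0) (F 0)" for k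
    by (induction k) (simp_all add: form_invariant[OF suc])
  obtain e where e: "\<And>x. x \<in> V \<Longrightarrow> 0 < e x" "\<And>v. (\<Sum>x\<in>V. e x * (v x)\<^sup>2) \<le> form v v"
    by (rule form_bound) blast
  define q where "q = form (F 0) (F 0)"
  define B where "B x = nat \<lceil>q / e x\<rceil>" for x
  have "f k x \<le> B x" if x: "x \<in> V" for k x
  proof -
    have "e x * (F k x)\<^sup>2 \<le> (\<Sum>x\<in>V. e x * (F k x)\<^sup>2)"
      using fin x e(1) by (intro member_le_sum) (auto simp: less_imp_le)
    also have "\<dots> \<le> q" using e(2)[of "F k"] inv[of k] by (simp add: q_def)
    finally have "(F k x)\<^sup>2 \<le> q / e x" using e(1)[OF x] by (simp add: field_simps)
    \<comment> \<open>Integrality enters here: a natural number is at most its own square, so the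
      bound on the square bounds the number.\<close>
    moreover have "F k x \<le> (F k x)\<^sup>2"
      unfolding F_def power2_eq_square of_nat_mult[symmetric] of_nat_le_iff by simp
    ultimately have "real (f k x) \<le> q / e x" unfolding F_def by linarith
    then show ?thesis unfolding B_def by linarith
  qed
  then have "range (\<lambda>k. restrict (f k) V) \<subseteq> (\<Pi>\<^sub>E x\<in>V. {..B x})" by auto
  then have "finite (range (\<lambda>k. restrict (f k) V))"
    by (rule finite_subset) (intro finite_PiE fin finite_atMost)
  then have "\<not> inj (\<lambda>k. restrict (f k) V)"
    using finite_imageD infinite_UNIV_nat by blast
  then obtain k m where "k \<noteq> m" "restrict (f k) V = restrict (f m) V"
    unfolding inj_def by blast
  then obtain k m where km: "k < m" "restrict (f k) V = restrict (f m) V"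
    by (metis nat_neq_iff)
  have fkm: "F k x = F m x" if "x \<in> V" for x
    using km(2) that by (metis F_def restrict_apply')
  define S where "S x = (\<Sum>i=k..<m. F i x)" for x
  have S': "(\<Sum>i=k..<m. F (Suc i) x) = S x" if "x \<in> V" for x
  proof -
    have "(\<Sum>i=k..<m. F (Suc i) x) = (\<Sum>i=Suc k..<Suc m. F i x)"
      by (rule sum.shift_bounds_Suc_ivl[symmetric])
    also have "F k x + \<dots> = (\<Sum>i=k..<Suc m. F i x)"
      using km(1) by (simp add: sum.atLeast_Suc_lessThan)
    finally show ?thesis using fkm[OF that] km(1) by (simp add: S_def)
  qed
  have "successor S S"
    unfolding successor_def
  proof
    fix x assume x: "x \<in> V"
    have "d x * (S x + S x) = d x * (S x + (\<Sum>i=k..<m. F (Suc i) x))"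
      by (simp only: S'[OF x])
    also have "\<dots> = (\<Sum>i=k..<m. d x * (F i x + F (Suc i) x))"
      by (simp add: S_def sum_distrib_left sum.distrib distrib_left)
    also have "\<dots> = (\<Sum>i=k..<m. (\<Sum>z\<in>V. weight z x * F (Suc i) z) + (\<Sum>z\<in>V. weight x z * F i z))"
      using suc x by (simp add: successor_def)
    also have "\<dots> = (\<Sum>z\<in>V. weight z x * (\<Sum>i=k..<m. F (Suc i) z)) + (\<Sum>z\<in>V. weight x z * S z)"
      by (simp add: sum.distrib sum_distrib_left S_def sum.swap[of _ V])
    finally show "d x * (S x + S x) = (\<Sum>z\<in>V. weight z x * S z) + (\<Sum>z\<in>V. weight x z * S z)"
      using S' by simp
  qed
  then have "form S S = 0" using form_successor[of S S S] by simp
  then have "S x = 0" if "x \<in> V" for x using form_zero that by blast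
  then have "F k x = 0" if "x \<in> V" for x
    using that km(1) sum_nonneg_eq_0_iff[of "{k..<m}" "\<lambda>i. F i x"] by (auto simp: S_def F_def)
  then have "form (F k) (F k) = 0" by (simp add: form_def)
  \<comment> \<open>The vanishing is known so far only for the slice where the period starts;
    invariance of the form carries it to every slice, including the earlier ones.\<close>
  then have "form (F j) (F j) = 0" for j using inv by metis
  then show ?thesis using form_zero x by (force simp: F_def)
qed

end

section \<open>Weights on Dynkin diagrams\<close>

text \<open>Here \<open>c\<close> is a strictly superharmonic weight and \<open>d\<close> symmetrises the Cartan matrix.\<close>

definition finite_type_weights :: "'v valued_graph \<Rightarrow> ('v \<Rightarrow> real) \<Rightarrow> ('v \<Rightarrow> real) \<Rightarrow> bool" where
  "finite_type_weights T c d \<longleftrightarrow> finite (verts T) \<and>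
     (\<forall>x\<in>verts T. 0 < c x \<and> 0 < d x \<and>
        (\<Sum>z\<in>verts T. if (z, x) \<in> edges T then real (fst (val T z x)) * c z else 0) < 2 * c x) \<and>
     (\<forall>(z, x) \<in> edges T. d x * real (fst (val T z x)) = d z * real (fst (val T x z)))"

lemma finite_type_weightsI:
  assumes "finite (verts T)"
    and "\<And>x. x \<in> verts T \<Longrightarrow> 0 < c x" "\<And>x. x \<in> verts T \<Longrightarrow> 0 < d x"
    and "\<And>x. x \<in> verts T \<Longrightarrow>
      (\<Sum>z\<in>verts T. if (z, x) \<in> edges T then real (fst (val T z x)) * c z else 0) < 2 * c x"
    and "\<And>z x. (z, x) \<in> edges T \<Longrightarrow> d x * real (fst (val T z x)) = d z * real (fst (val T x z))"
  shows "finite_type_weights T c d"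
  using assms by (auto simp: finite_type_weights_def)

lemma finite_type_weights_iso:
  assumes f: "bij_betw f (verts S) (verts T)"
    and edges: "\<And>x y. x \<in> verts S \<Longrightarrow> y \<in> verts S \<Longrightarrow> (f x, f y) \<in> edges T \<longleftrightarrow> (x, y) \<in> edges S"
    and val: "\<And>x y. (x, y) \<in> edges S \<Longrightarrow> val T (f x) (f y) = val S x y"
    and sub: "edges S \<subseteq> verts S \<times> verts S" and sym: "sym (edges S)"
    and T: "finite_type_weights T c d"
  shows "finite_type_weights S (\<lambda>x. c (f x)) (\<lambda>x. d (f x))"
proof -
  have f_in: "f x \<in> verts T" if "x \<in> verts S" for x using f that by (auto simp: bij_betw_def)
  have "(\<Sum>z\<in>verts S. if (z, x) \<in> edges S then real (fst (val S z x)) * c (f z) else 0) =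
    (\<Sum>z\<in>verts T. if (z, f x) \<in> edges T then real (fst (val T z (f x))) * c z else 0)"
    if "x \<in> verts S" for x
    unfolding sum.reindex_bij_betw[OF f, symmetric]
    using edges val that by (intro sum.cong refl) auto
  moreover have "d (f x) * real (fst (val S z x)) = d (f z) * real (fst (val S x z))"
    if zx: "(z, x) \<in> edges S" for z x
  proof -
    have "(f z, f x) \<in> edges T" using zx sub edges by auto
    moreover have "(x, z) \<in> edges S" using zx sym by (auto simp: sym_def)
    ultimately show ?thesis using T val[OF zx] val[of x z] by (auto simp: finite_type_weights_def)
  qed
  ultimately show ?thesis
    using T f_in bij_betw_finite[OF f] by (auto simp: finite_type_weights_def)
qed

lemma sum_neighbours_path:
  fixes g :: "nat \<Rightarrow> real"
  assumes "x < n"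
  shows "(\<Sum>z<n. if z + 1 = x \<or> x + 1 = z then g z else 0) =
    (if 0 < x then g (x - 1) else 0) + (if x + 1 < n then g (x + 1) else 0)"
proof -
  \<comment> \<open>The inner guard \<open>0 < x\<close> is needed because truncated subtraction
    makes \<open>x - 1\<close> equal to \<open>x\<close> at \<open>x = 0\<close>.\<close>
  have "(\<Sum>z<n. if z + 1 = x \<or> x + 1 = z then g z else 0) =
    (\<Sum>z<n. if z = x - 1 then (if 0 < x then g z else 0) else 0) + (\<Sum>z<n. if z = x + 1 then g z else 0)"
    unfolding sum.distrib[symmetric] by (intro sum.cong) auto
  then show ?thesis using assms by (cases x) simp_all
qed

lemma sum_line:
  fixes g :: "nat \<Rightarrow> real"
  assumes "x < n"
  shows "(\<Sum>z<n. if (z, x) \<in> line n \<union> (line n)\<inverse> then g z else 0) =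
    (if 0 < x then g (x - 1) else 0) + (if x + 1 < n then g (x + 1) else 0)"
  unfolding sum_neighbours_path[OF assms, symmetric] using assms
  by (intro sum.cong refl) (auto simp: line_def)

text \<open>
  On a path the sequence \<open>(i + 1) (2 n - i)\<close>, indexed from \<open>0\<close>, has second differences \<open>- 2\<close> and is
  increasing; halving its last value accounts for the double edge of type \<open>B\<close> and for the fork of
  type \<open>D\<close>. In types \<open>E\<close> the weights are the coefficients of the sum of the
  positive roots, in types \<open>F\<close> and \<open>G\<close> a rescaling of them.
\<close>

definition path_weight :: "nat \<Rightarrow> nat \<Rightarrow> real" where
  "path_weight n i = (real i + 1) * (2 * real n - real i)"

lemma path_weight_pos: "i < n \<Longrightarrow> 0 < path_weight n i"
  by (simp add: path_weight_def)

lemma path_weight_concave: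
  "0 < i \<Longrightarrow> path_weight n (i - 1) + path_weight n (i + 1) = 2 * path_weight n i - 2"
  by (cases i) (simp_all add: path_weight_def algebra_simps)

text \<open>The concavity identity at the end vertex, with the value 0 that the polynomial takes at
  index \<open>-1\<close>.\<close>

lemma path_weight_first: "path_weight n 1 = 2 * path_weight n 0 - 2"
  by (simp add: path_weight_def algebra_simps)

lemma path_weight_less: "0 < i \<Longrightarrow> i < n \<Longrightarrow> path_weight n (i - 1) < path_weight n i"
  by (cases i) (simp_all add: path_weight_def algebra_simps)

text \<open>At a vertex with a right neighbour the deficit is the second difference; at the last
  vertex the only possible neighbour is smaller.\<close>

lemma A_weights: "finite_type_weights (A_diagram n) (path_weight n) (\<lambda>_. 1)"
proof -
  have "(\<Sum>z<n. if (z, x) \<in> line n \<union> (line n)\<inverse> then path_weight n z else 0) < 2 * path_weight n x"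
    if "x < n" for x
    unfolding sum_line[OF that]
    using that path_weight_concave[of x n] path_weight_first[of n] path_weight_less[of x n]
      path_weight_pos[of x n]
    by (cases "x = 0") (auto)
  then show ?thesis
    by (auto simp: finite_type_weights_def A_diagram_def simply_laced_def path_weight_pos cong: if_cong)
qed

text \<open>At \<open>n - 2\<close> the multiplicity 2 of the last vertex undoes its halving, so
  concavity is intact there; at \<open>n - 1\<close> the condition becomes
  \<open>path_weight n (n - 2) < path_weight n (n - 1)\<close>.\<close>

lemma B_weights:
  assumes "n \<ge> 2"
  shows "finite_type_weights (B_diagram n)
    (\<lambda>i. if i = n - 1 then path_weight n i / 2 else path_weight n i) (\<lambda>i. if i = n - 1 then 2 else 1)"
proof -
  obtain m where n: "n = Suc (Suc m)" using assms by (metis add_2_eq_Suc le_Suc_ex)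
  define c where "c = (\<lambda>i. if i = n - 1 then path_weight n i / 2 else path_weight n i)"
  have diagram: "verts (B_diagram n) = {..<n}" "edges (B_diagram n) = line n \<union> (line n)\<inverse>"
    by (simp_all add: B_diagram_def set_val_def simply_laced_def)
  have super: "(\<Sum>z<n. if (z, x) \<in> line n \<union> (line n)\<inverse> then real (fst (val (B_diagram n) z x)) * c z else 0) < 2 * c x"
    if x: "x < n" for x
    unfolding sum_line[OF x]
    using n x path_weight_concave[of x n] path_weight_first[of n] path_weight_less[of x n]
      path_weight_pos[of x n]
    by (cases "x = 0"; cases "x = Suc m"; cases "x = m")
       (auto simp: c_def B_diagram_def set_val_def simply_laced_def)
  have symm: "(if x = n - 1 then 2 else 1) * real (fst (val (B_diagram n) z x)) =
      (if z = n - 1 then 2 else 1) * real (fst (val (B_diagram n) x z))"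
    if "(z, x) \<in> line n \<union> (line n)\<inverse>" for z x
    using that n by (auto simp: B_diagram_def set_val_def simply_laced_def line_def)
  have pos: "0 < c x" if "x < n" for x using that by (simp add: c_def path_weight_pos)
  show ?thesis
    unfolding c_def[symmetric]
    by (rule finite_type_weightsI) (use super symm pos in \<open>simp_all only: diagram lessThan_iff finite_lessThan\<close>, simp)
qed

text \<open>The multiplicity 2 is now read towards the last vertex, where the condition is twice the
  monotonicity of the unmodified sequence; hence no halving.\<close>

lemma C_weights:
  assumes "n \<ge> 2"
  shows "finite_type_weights (C_diagram n) (path_weight n) (\<lambda>i. if i = n - 1 then 1 else 2)"
proof -
  obtain m where n: "n = Suc (Suc m)" using assms by (metis add_2_eq_Suc le_Suc_ex)
  have diagram: "verts (C_diagram n) = {..<n}" "edges (C_diagram n) = line n \<union> (line n)\<inverse>"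
    by (simp_all add: C_diagram_def set_val_def simply_laced_def)
  have super: "(\<Sum>z<n. if (z, x) \<in> line n \<union> (line n)\<inverse> then real (fst (val (C_diagram n) z x)) * path_weight n z else 0)
      < 2 * path_weight n x"
    if x: "x < n" for x
    unfolding sum_line[OF x]
    using n x path_weight_concave[of x n] path_weight_first[of n] path_weight_less[of x n]
      path_weight_pos[of x n]
    by (cases "x = 0"; cases "x = Suc m"; cases "x = m")
       (auto simp: C_diagram_def set_val_def simply_laced_def)
  have symm: "(if x = n - 1 then 1 else 2) * real (fst (val (C_diagram n) z x)) =
      (if z = n - 1 then 1 else 2) * real (fst (val (C_diagram n) x z))"
    if "(z, x) \<in> line n \<union> (line n)\<inverse>" for z x
    using that n by (auto simp: C_diagram_def set_val_def simply_laced_def line_def)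
  show ?thesis
    by (rule finite_type_weightsI)
      (use super symm path_weight_pos in \<open>simp_all only: diagram lessThan_iff finite_lessThan\<close>, simp)
qed

lemma D_weights:
  assumes "n \<ge> 4"
  shows "finite_type_weights (D_diagram n)
    (\<lambda>i. if n - 2 \<le> i then path_weight n (n - 2) / 2 else path_weight n i) (\<lambda>_. 1)"
proof -
  obtain m where n: "n = Suc (Suc (Suc (Suc m)))"
    using assms by (metis add_2_eq_Suc le_Suc_ex numeral_Bit0 add.assoc)
  define c where "c = (\<lambda>i. if n - 2 \<le> i then path_weight n (n - 2) / 2 else path_weight n i)"
  define E where "E = line (n - 1) \<union> {(n - 3, n - 1)}"
  have diagram: "verts (D_diagram n) = {..<n}" "edges (D_diagram n) = E \<union> E\<inverse>"
    "val (D_diagram n) = (\<lambda>_ _. (1, 1))"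
    by (simp_all add: D_diagram_def simply_laced_def E_def)
  have EE: "(z, x) \<in> E \<union> E\<inverse> \<longleftrightarrow> (z, x) \<in> line (n - 1) \<union> (line (n - 1))\<inverse> \<or>
      (z = Suc m \<and> x = Suc (Suc (Suc m))) \<or> (x = Suc m \<and> z = Suc (Suc (Suc m)))" for z x
    by (auto simp: E_def n)
  have "(\<Sum>z<n. if (z, x) \<in> E \<union> E\<inverse> then c z else 0) < 2 * c x" if x: "x < n" for x
  \<comment> \<open>The vertex \<open>n - 1\<close> lies off the path \<open>0, ..., n - 2\<close>
    and hangs at \<open>n - 3\<close>. Its condition is monotonicity; at \<open>n - 3\<close> the
    two halved ends add up to one full path value.\<close>
  proof (cases "x = Suc (Suc (Suc m))")
    case True
    have "(\<Sum>z<n. if (z, x) \<in> E \<union> E\<inverse> then c z else 0) = (\<Sum>z<n. if z = Suc m then c z else 0)"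
      unfolding EE using True n by (intro sum.cong refl) (auto simp: line_def)
    also have "\<dots> = path_weight n (Suc m)" using n by (simp add: c_def)
    also have "\<dots> < path_weight n (Suc (Suc m))"
      using path_weight_less[of "Suc (Suc m)" n] n by simp
    finally show ?thesis using True n by (simp add: c_def)
  next
    case False
    then have x: "x < n - 1" using x n by simp
    have "(\<Sum>z<n. if (z, x) \<in> E \<union> E\<inverse> then c z else 0) =
        (\<Sum>z<n - 1. if (z, x) \<in> E \<union> E\<inverse> then c z else 0) + (if x = Suc m then c (n - 1) else 0)"
      using x unfolding EE by (auto simp: n lessThan_Suc line_def)
    also have "(\<Sum>z<n - 1. if (z, x) \<in> E \<union> E\<inverse> then c z else 0) =
        (\<Sum>z<n - 1. if (z, x) \<in> line (n - 1) \<union> (line (n - 1))\<inverse> then c z else 0)"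
      unfolding EE using x n by (intro sum.cong refl) auto
    also have "\<dots> = (if 0 < x then c (x - 1) else 0) + (if x + 1 < n - 1 then c (x + 1) else 0)"
      by (rule sum_line[OF x])
    finally have eq: "(\<Sum>z<n. if (z, x) \<in> E \<union> E\<inverse> then c z else 0) =
      (if 0 < x then c (x - 1) else 0) + (if x + 1 < n - 1 then c (x + 1) else 0) +
      (if x = Suc m then c (n - 1) else 0)" .
    show ?thesis
      unfolding eq
      using n x path_weight_concave[of x n] path_weight_first[of n] path_weight_less[of x n]
        path_weight_pos[of x n]
      by (cases "x = 0"; cases "x = Suc m"; cases "x = Suc (Suc m)") (auto simp: c_def)
  qed
  moreover have "0 < c x" if "x < n" for x using that n by (simp add: c_def path_weight_pos)
  ultimately show ?thesis
    unfolding finite_type_weights_def c_def[symmetric] diagram fst_conv of_nat_1 mult_1 by simp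
qed

lemma line_iff: "(i, j) \<in> line n \<longleftrightarrow> j = i + 1 \<and> j < n"
  by (auto simp: line_def)

lemmas diagram_simps =
  finite_type_weights_def simply_laced_def set_val_def line_iff lessThan_nat_numeral

lemma E6_weights:
  "finite_type_weights (E_diagram 6) (\<lambda>i. real ([16, 30, 42, 30, 16, 22] ! i)) (\<lambda>_. 1)"
  by (simp add: E_diagram_def diagram_simps)

lemma E7_weights:
  "finite_type_weights (E_diagram 7) (\<lambda>i. real ([34, 66, 96, 75, 52, 27, 49] ! i)) (\<lambda>_. 1)"
  by (simp add: E_diagram_def diagram_simps)

lemma E8_weights:
  "finite_type_weights (E_diagram 8) (\<lambda>i. real ([92, 182, 270, 220, 168, 114, 58, 136] ! i)) (\<lambda>_. 1)"
  by (simp add: E_diagram_def diagram_simps)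

lemma F4_weights:
  "finite_type_weights F4_diagram (\<lambda>i. real ([16, 30, 21, 11] ! i)) (\<lambda>i. if i < 2 then 1 else 2)"
  by (simp add: F4_diagram_def diagram_simps) (auto simp: line_iff)

lemma G2_weights:
  "finite_type_weights G2_diagram (\<lambda>i. real ([5, 3] ! i)) (\<lambda>i. if i = 0 then 1 else 3)"
  by (simp add: G2_diagram_def diagram_simps) (auto simp: line_iff)

lemma dynkin_weights:
  assumes tree: "valued_tree T" and T: "is_dynkin T"
  shows "\<exists>c d. finite_type_weights T c d"
proof -
  obtain D where D: "D \<in> dynkin_diagrams" "valued_graph_iso T D"
    using T by (auto simp: is_dynkin_def)
  have "\<exists>c d. finite_type_weights D c d"
    using D(1) A_weights B_weights C_weights D_weights E6_weights E7_weights E8_weights F4_weights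
      G2_weights unfolding dynkin_diagrams_def by blast
  then obtain c d where cd: "finite_type_weights D c d" by blast
  obtain f where f: "bij_betw f (verts T) (verts D)"
    "\<forall>x\<in>verts T. \<forall>y\<in>verts T. (f x, f y) \<in> edges D \<longleftrightarrow> (x, y) \<in> edges T"
    "\<forall>(x, y)\<in>edges T. val D (f x) (f y) = val T x y"
    using D(2) by (auto simp: valued_graph_iso_def)
  have "finite_type_weights T (\<lambda>x. c (f x)) (\<lambda>x. d (f x))"
    by (rule finite_type_weights_iso[OF f(1) _ _ _ _ cd]) (use f tree in \<open>auto simp: valued_tree_def\<close>)
  then show ?thesis by blast
qed

section \<open>Linear categories and biproducts\<close>

context linear_category
begin

text \<open>Hom-sets may overlap and the axioms ask for objects separately; bundling the three facts
  turns each typing judgement into a single premise.\<close>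

definition arr :: "'o \<Rightarrow> 'o \<Rightarrow> 'm \<Rightarrow> bool" where
  "arr X Y f \<longleftrightarrow> X \<in> Ob C \<and> Y \<in> Ob C \<and> f \<in> mor C X Y"

abbreviation zero_mor :: "'o \<Rightarrow> 'o \<Rightarrow> 'm" where
  "zero_mor X Y \<equiv> \<zero>\<^bsub>Hom C X Y\<^esub>"

abbreviation diff_mor :: "'o \<Rightarrow> 'o \<Rightarrow> 'm \<Rightarrow> 'm \<Rightarrow> 'm" where
  "diff_mor X Y f g \<equiv> f \<ominus>\<^bsub>Hom C X Y\<^esub> g"

abbreviation add_mor :: "'o \<Rightarrow> 'o \<Rightarrow> 'm \<Rightarrow> 'm \<Rightarrow> 'm" where
  "add_mor X Y f g \<equiv> f \<oplus>\<^bsub>Hom C X Y\<^esub> g"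

lemma Hom_abelian_group: "X \<in> Ob C \<Longrightarrow> Y \<in> Ob C \<Longrightarrow> abelian_group (Hom C X Y)"
  using vectorspace_Hom[of X Y] by (simp add: vectorspace_def module_def)

lemma precomp_linear:
  assumes "arr X Y f" "Z \<in> Ob C" shows "linear_map K (Hom C Y Z) (Hom C X Z) (\<lambda>g. g \<cdot> f)"
  using assms by (intro linear_mapI vectorspace_Hom comp_linear_left) (auto simp: arr_def)

lemma postcomp_linear:
  assumes "arr Y Z g" "X \<in> Ob C" shows "linear_map K (Hom C X Y) (Hom C X Z) (\<lambda>f. g \<cdot> f)"
  using assms by (intro linear_mapI vectorspace_Hom comp_linear_right) (auto simp: arr_def)

lemma comp_arr: assumes "arr X Y f" "arr Y Z g" shows "arr X Z (g \<cdot> f)"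
  using assms linear_map.T_im[OF precomp_linear[OF assms(1), of Z], of g] by (auto simp: arr_def)

lemma ident_arr: "X \<in> Ob C \<Longrightarrow> arr X X (ident C X)"
  by (simp add: arr_def ident_mor)

lemma zero_arr: "X \<in> Ob C \<Longrightarrow> Y \<in> Ob C \<Longrightarrow> arr X Y (zero_mor X Y)"
  using abelian_group.axioms(1)[OF Hom_abelian_group[of X Y]] by (simp add: arr_def abelian_monoid.zero_closed)

lemma diff_arr: "arr X Y f \<Longrightarrow> arr X Y g \<Longrightarrow> arr X Y (diff_mor X Y f g)"
  using Hom_abelian_group[of X Y] by (simp add: arr_def abelian_group.minus_closed)

lemma add_arr: "arr X Y f \<Longrightarrow> arr X Y g \<Longrightarrow> arr X Y (add_mor X Y f g)"
  using abelian_group.axioms(1)[OF Hom_abelian_group[of X Y]] by (simp add: arr_def abelian_monoid.a_closed)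

lemma neg_arr: "arr X Y f \<Longrightarrow> arr X Y (\<ominus>\<^bsub>Hom C X Y\<^esub> f)"
  using Hom_abelian_group[of X Y] by (simp add: arr_def abelian_group.a_inv_closed)

lemma assoc: "arr W X f \<Longrightarrow> arr X Y g \<Longrightarrow> arr Y Z h \<Longrightarrow> (h \<cdot> g) \<cdot> f = h \<cdot> (g \<cdot> f)"
  by (auto simp: arr_def comp_assoc)

lemma id_left: "arr X Y f \<Longrightarrow> ident C Y \<cdot> f = f"
  by (auto simp: arr_def comp_ident_left)

lemma id_right: "arr X Y f \<Longrightarrow> f \<cdot> ident C X = f"
  by (auto simp: arr_def comp_ident_right)

lemma comp_zero_left: "arr X Y f \<Longrightarrow> Z \<in> Ob C \<Longrightarrow> zero_mor Y Z \<cdot> f = zero_mor X Z"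
  using linear_map.T0_is_0[OF precomp_linear] by blast

lemma comp_zero_right: "arr Y Z g \<Longrightarrow> X \<in> Ob C \<Longrightarrow> g \<cdot> zero_mor X Y = zero_mor X Z"
  using linear_map.T0_is_0[OF postcomp_linear] by blast

lemma comp_diff_left:
  "arr X Y f \<Longrightarrow> arr Y Z g \<Longrightarrow> arr Y Z g' \<Longrightarrow> diff_mor Y Z g g' \<cdot> f = diff_mor X Z (g \<cdot> f) (g' \<cdot> f)"
  using linear_map.T_minus[OF precomp_linear[of X Y f Z]] by (auto simp: arr_def)

lemma comp_diff_right:
  "arr Y Z g \<Longrightarrow> arr X Y f \<Longrightarrow> arr X Y f' \<Longrightarrow> g \<cdot> diff_mor X Y f f' = diff_mor X Z (g \<cdot> f) (g \<cdot> f')"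
  using linear_map.T_minus[OF postcomp_linear[of Y Z g X]] by (auto simp: arr_def)

lemma comp_add_left:
  "arr X Y f \<Longrightarrow> arr Y Z g \<Longrightarrow> arr Y Z g' \<Longrightarrow> add_mor Y Z g g' \<cdot> f = add_mor X Z (g \<cdot> f) (g' \<cdot> f)"
  using linear_map.T_add[OF precomp_linear[of X Y f Z]] by (auto simp: arr_def)

lemma comp_add_right:
  "arr Y Z g \<Longrightarrow> arr X Y f \<Longrightarrow> arr X Y f' \<Longrightarrow> g \<cdot> add_mor X Y f f' = add_mor X Z (g \<cdot> f) (g \<cdot> f')"
  using linear_map.T_add[OF postcomp_linear[of Y Z g X]] by (auto simp: arr_def)

lemma comp_neg_left:
  "arr X Y f \<Longrightarrow> arr Y Z g \<Longrightarrow> (\<ominus>\<^bsub>Hom C Y Z\<^esub> g) \<cdot> f = \<ominus>\<^bsub>Hom C X Z\<^esub> (g \<cdot> f)"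
  using linear_map.T_neg[OF precomp_linear[of X Y f Z]] by (auto simp: arr_def)

lemma comp_neg_right:
  "arr Y Z g \<Longrightarrow> arr X Y f \<Longrightarrow> g \<cdot> (\<ominus>\<^bsub>Hom C X Y\<^esub> f) = \<ominus>\<^bsub>Hom C X Z\<^esub> (g \<cdot> f)"
  using linear_map.T_neg[OF postcomp_linear[of Y Z g X]] by (auto simp: arr_def)

lemma diff_eq_zero_iff:
  assumes "arr X Y f" "arr X Y g"
  shows "diff_mor X Y f g = zero_mor X Y \<longleftrightarrow> f = g"
proof -
  interpret abelian_group "Hom C X Y" using assms Hom_abelian_group by (simp add: arr_def)
  have f: "f \<in> mor C X Y" and g: "g \<in> mor C X Y" using assms by (auto simp: arr_def)
  have "f = add_mor X Y (diff_mor X Y f g) g" using f g by (simp add: a_minus_def a_assoc l_neg)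
  moreover have "diff_mor X Y f f = zero_mor X Y" using f by (simp add: a_minus_def r_neg)
  ultimately show ?thesis using g l_zero by metis
qed

lemma neg_inject:
  assumes "arr X Y f" "arr X Y g" "\<ominus>\<^bsub>Hom C X Y\<^esub> f = \<ominus>\<^bsub>Hom C X Y\<^esub> g"
  shows "f = g"
proof -
  interpret abelian_group "Hom C X Y" using assms Hom_abelian_group by (simp add: arr_def)
  show ?thesis using assms by (metis arr_def minus_minus)
qed

lemma neg_neg: assumes "arr X Y f" shows "\<ominus>\<^bsub>Hom C X Y\<^esub> (\<ominus>\<^bsub>Hom C X Y\<^esub> f) = f"
proof -
  interpret abelian_group "Hom C X Y" using assms Hom_abelian_group by (simp add: arr_def)
  show ?thesis using assms by (simp add: arr_def)
qed

lemma neg_zero: assumes "X \<in> Ob C" "Y \<in> Ob C"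
  shows "\<ominus>\<^bsub>Hom C X Y\<^esub> (zero_mor X Y) = zero_mor X Y"
proof -
  interpret abelian_group "Hom C X Y" using assms Hom_abelian_group by simp
  show ?thesis by simp
qed

lemma neg_eq_zero_iff: assumes "arr X Y f"
  shows "\<ominus>\<^bsub>Hom C X Y\<^esub> f = zero_mor X Y \<longleftrightarrow> f = zero_mor X Y"
  using neg_inject[OF assms zero_arr] neg_zero assms by (auto simp: arr_def)

lemma add_diff_mor: assumes "arr X Y f" "arr X Y g"
  shows "add_mor X Y f (diff_mor X Y g f) = g" "diff_mor X Y (add_mor X Y f g) f = g"
proof -
  interpret abelian_group "Hom C X Y" using assms Hom_abelian_group by (simp add: arr_def)
  have f: "f \<in> mor C X Y" and g: "g \<in> mor C X Y" using assms by (auto simp: arr_def)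
  have "add_mor X Y (diff_mor X Y g f) f = g" using f g by (simp add: a_minus_def a_assoc l_neg)
  then show "add_mor X Y f (diff_mor X Y g f) = g" using f g by (simp add: a_comm)
  have "diff_mor X Y (add_mor X Y g f) f = g" using f g by (simp add: a_minus_def a_assoc r_neg)
  then show "diff_mor X Y (add_mor X Y f g) f = g" using f g by (simp add: a_comm)
qed

lemma zero_diff: assumes "arr X Y f"
  shows "diff_mor X Y f (zero_mor X Y) = f"
proof -
  interpret abelian_group "Hom C X Y" using assms Hom_abelian_group by (simp add: arr_def)
  show ?thesis using assms by (simp add: arr_def a_minus_def)
qed

lemma zero_objectI:
  assumes "X \<in> Ob C" "ident C X = zero_mor X X"
  shows "zero_object C X"
proof -
  have "f = zero_mor X Y" if "Y \<in> Ob C" "f \<in> mor C X Y" for Y f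
    using that assms id_right[of X Y f] comp_zero_right[of X Y f X] by (simp add: arr_def)
  moreover have "f = zero_mor Y X" if "Y \<in> Ob C" "f \<in> mor C Y X" for Y f
    using that assms id_left[of Y X f] comp_zero_left[of Y X f X] by (simp add: arr_def)
  ultimately show ?thesis
    using assms(1) zero_arr by (auto simp: zero_object_def arr_def)
qed

lemma zero_object_arr:
  assumes "zero_object C X" "arr X Y f" shows "f = zero_mor X Y"
  using assms by (auto simp: zero_object_def arr_def)

lemma zero_object_arr':
  assumes "zero_object C Y" "arr X Y f" shows "f = zero_mor X Y"
  using assms by (auto simp: zero_object_def arr_def)

lemma zero_object_iff: "X \<in> Ob C \<Longrightarrow> zero_object C X \<longleftrightarrow> ident C X = zero_mor X X"
  using zero_objectI zero_object_arr ident_arr by blast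

lemma isomorphismI:
  "arr X Y f \<Longrightarrow> arr Y X g \<Longrightarrow> g \<cdot> f = ident C X \<Longrightarrow> f \<cdot> g = ident C Y \<Longrightarrow> isomorphism C X Y f"
  by (auto simp: isomorphism_def arr_def)

lemma isomorphismE:
  assumes "isomorphism C X Y f" "X \<in> Ob C" "Y \<in> Ob C"
  obtains g where "arr X Y f" "arr Y X g" "g \<cdot> f = ident C X" "f \<cdot> g = ident C Y"
    "isomorphism C Y X g"
  using assms by (auto simp: isomorphism_def arr_def)

lemma isomorphism_comp:
  assumes f: "isomorphism C X Y f" and g: "isomorphism C Y Z g" and ob: "X \<in> Ob C" "Y \<in> Ob C" "Z \<in> Ob C"
  shows "isomorphism C X Z (g \<cdot> f)"
proof -
  obtain f' where f': "arr X Y f" "arr Y X f'" "f' \<cdot> f = ident C X" "f \<cdot> f' = ident C Y"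
    using isomorphismE[OF f ob(1,2)] .
  obtain g' where g': "arr Y Z g" "arr Z Y g'" "g' \<cdot> g = ident C Y" "g \<cdot> g' = ident C Z"
    using isomorphismE[OF g ob(2,3)] .
  have "(f' \<cdot> g') \<cdot> (g \<cdot> f) = f' \<cdot> ((g' \<cdot> g) \<cdot> f)"
    using assoc[OF comp_arr[OF f'(1) g'(1)] g'(2) f'(2)] assoc[OF f'(1) g'(1,2)] by simp
  moreover have "(g \<cdot> f) \<cdot> (f' \<cdot> g') = g \<cdot> ((f \<cdot> f') \<cdot> g')"
    using assoc[OF comp_arr[OF g'(2) f'(2)] f'(1) g'(1)] assoc[OF g'(2) f'(2,1)] by simp
  ultimately show ?thesis
    using f' g' by (intro isomorphismI[of _ _ _ "f' \<cdot> g'"] comp_arr) (auto simp: id_left)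
qed

lemma isomorphism_ident: "X \<in> Ob C \<Longrightarrow> isomorphism C X X (ident C X)"
  using ident_arr id_left by (intro isomorphismI) auto

lemma isomorphic_refl: "X \<in> Ob C \<Longrightarrow> isomorphic C X X"
  using isomorphism_ident by (auto simp: isomorphic_def)

lemma isomorphicE:
  assumes "isomorphic C X Y"
  obtains f g where "arr X Y f" "arr Y X g" "g \<cdot> f = ident C X" "f \<cdot> g = ident C Y"
    "isomorphism C X Y f" "isomorphism C Y X g"
proof -
  obtain f where "isomorphism C X Y f" "X \<in> Ob C" "Y \<in> Ob C"
    using assms by (auto simp: isomorphic_def)
  then show ?thesis using isomorphismE that by blast
qed

lemma isomorphicI: "isomorphism C X Y f \<Longrightarrow> X \<in> Ob C \<Longrightarrow> Y \<in> Ob C \<Longrightarrow> isomorphic C X Y"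
  by (auto simp: isomorphic_def)

lemma isomorphic_sym: assumes "isomorphic C X Y" shows "isomorphic C Y X"
  using assms by (rule isomorphicE) (auto simp: isomorphic_def arr_def)

lemma isomorphic_trans: assumes "isomorphic C X Y" "isomorphic C Y Z" shows "isomorphic C X Z"
proof -
  obtain f where "isomorphism C X Y f" "X \<in> Ob C" "Y \<in> Ob C"
    using assms(1) by (auto simp: isomorphic_def)
  moreover obtain g where "isomorphism C Y Z g" "Z \<in> Ob C"
    using assms(2) by (auto simp: isomorphic_def)
  ultimately show ?thesis using isomorphism_comp isomorphicI by blast
qed

lemma iso_class_eq_iff:
  "X \<in> Ob C \<Longrightarrow> Y \<in> Ob C \<Longrightarrow> iso_class C X = iso_class C Y \<longleftrightarrow> isomorphic C X Y"
  unfolding iso_class_def using isomorphic_refl isomorphic_sym isomorphic_trans by blast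

lemma mem_iso_class: "Y \<in> iso_class C X \<longleftrightarrow> isomorphic C X Y"
  by (simp add: iso_class_def)

section \<open>Finite sums of morphisms and biproducts\<close>

lemma finsum_arr:
  assumes "finite A" "X \<in> Ob C" "Y \<in> Ob C" "\<And>j. j \<in> A \<Longrightarrow> arr X Y (h j)"
  shows "arr X Y (\<Oplus>\<^bsub>Hom C X Y\<^esub> j\<in>A. h j)"
proof -
  interpret abelian_group "Hom C X Y" using assms Hom_abelian_group by simp
  show ?thesis using assms finsum_closed[of h A] by (auto simp: arr_def)
qed

lemma comp_finsum_right:
  assumes "finite A" "arr Y Z g" "X \<in> Ob C" "\<And>j. j \<in> A \<Longrightarrow> arr X Y (h j)"
  shows "g \<cdot> (\<Oplus>\<^bsub>Hom C X Y\<^esub> j\<in>A. h j) = (\<Oplus>\<^bsub>Hom C X Z\<^esub> j\<in>A. g \<cdot> h j)"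
  using assms(1,4)
proof (induction A)
  case empty
  interpret Y: abelian_group "Hom C X Y" using assms Hom_abelian_group by (simp add: arr_def)
  interpret Z: abelian_group "Hom C X Z" using assms Hom_abelian_group by (simp add: arr_def)
  show ?case using comp_zero_right assms by simp
next
  case (insert a A)
  have ob: "X \<in> Ob C" "Y \<in> Ob C" "Z \<in> Ob C" using assms by (auto simp: arr_def)
  interpret Y: abelian_group "Hom C X Y" using ob Hom_abelian_group by simp
  interpret Z: abelian_group "Hom C X Z" using ob Hom_abelian_group by simp
  have "\<And>j. j \<in> insert a A \<Longrightarrow> arr X Z (g \<cdot> h j)" using insert.prems assms(2) comp_arr by blast
  then have "(\<Oplus>\<^bsub>Hom C X Z\<^esub> j\<in>insert a A. g \<cdot> h j) = add_mor X Z (g \<cdot> h a) (\<Oplus>\<^bsub>Hom C X Z\<^esub> j\<in>A. g \<cdot> h j)"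
    using insert.hyps by (intro Z.finsum_insert) (auto simp: arr_def)
  moreover have "(\<Oplus>\<^bsub>Hom C X Y\<^esub> j\<in>insert a A. h j) = add_mor X Y (h a) (\<Oplus>\<^bsub>Hom C X Y\<^esub> j\<in>A. h j)"
    using insert.hyps insert.prems by (intro Y.finsum_insert) (auto simp: arr_def)
  ultimately show ?case
    using insert.IH insert.prems comp_add_right[OF assms(2), of X "h a" "\<Oplus>\<^bsub>Hom C X Y\<^esub> j\<in>A. h j"]
      finsum_arr[OF insert.hyps(1) ob(1,2), of h] by simp
qed

lemma comp_finsum_left:
  assumes "finite A" "arr X Y f" "Z \<in> Ob C" "\<And>j. j \<in> A \<Longrightarrow> arr Y Z (h j)"
  shows "(\<Oplus>\<^bsub>Hom C Y Z\<^esub> j\<in>A. h j) \<cdot> f = (\<Oplus>\<^bsub>Hom C X Z\<^esub> j\<in>A. h j \<cdot> f)"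
  using assms(1,4)
proof (induction A)
  case empty
  interpret Y: abelian_group "Hom C Y Z" using assms Hom_abelian_group by (simp add: arr_def)
  interpret Z: abelian_group "Hom C X Z" using assms Hom_abelian_group by (simp add: arr_def)
  show ?case using comp_zero_left assms by simp
next
  case (insert a A)
  have ob: "X \<in> Ob C" "Y \<in> Ob C" "Z \<in> Ob C" using assms by (auto simp: arr_def)
  interpret Y: abelian_group "Hom C Y Z" using ob Hom_abelian_group by simp
  interpret Z: abelian_group "Hom C X Z" using ob Hom_abelian_group by simp
  have "\<And>j. j \<in> insert a A \<Longrightarrow> arr X Z (h j \<cdot> f)" using insert.prems assms(2) comp_arr by blast
  then have "(\<Oplus>\<^bsub>Hom C X Z\<^esub> j\<in>insert a A. h j \<cdot> f) = add_mor X Z (h a \<cdot> f) (\<Oplus>\<^bsub>Hom C X Z\<^esub> j\<in>A. h j \<cdot> f)"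
    using insert.hyps by (intro Z.finsum_insert) (auto simp: arr_def)
  moreover have "(\<Oplus>\<^bsub>Hom C Y Z\<^esub> j\<in>insert a A. h j) = add_mor Y Z (h a) (\<Oplus>\<^bsub>Hom C Y Z\<^esub> j\<in>A. h j)"
    using insert.hyps insert.prems by (intro Y.finsum_insert) (auto simp: arr_def)
  ultimately show ?case
    using insert.IH insert.prems comp_add_left[OF assms(2), of Z "h a" "\<Oplus>\<^bsub>Hom C Y Z\<^esub> j\<in>A. h j"]
      finsum_arr[OF insert.hyps(1) ob(2,3), of h] by simp
qed

lemma finsum_zero_mor:
  assumes "X \<in> Ob C" "Y \<in> Ob C" "\<And>j. j \<in> A \<Longrightarrow> h j = zero_mor X Y"
  shows "(\<Oplus>\<^bsub>Hom C X Y\<^esub> j\<in>A. h j) = zero_mor X Y"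
proof -
  interpret abelian_group "Hom C X Y" using assms Hom_abelian_group by simp
  have "(\<Oplus>\<^bsub>Hom C X Y\<^esub> j\<in>A. h j) = (\<Oplus>\<^bsub>Hom C X Y\<^esub> j\<in>A. zero_mor X Y)"
    using assms(3) by (intro finsum_cong') auto
  then show ?thesis by simp
qed

text \<open>\<open>direct_sum\<close> with its injections and projections named, so that they can be
  composed with.\<close>

definition biproduct :: "'o \<Rightarrow> 'o list \<Rightarrow> (nat \<Rightarrow> 'm) \<Rightarrow> (nat \<Rightarrow> 'm) \<Rightarrow> bool" where
  "biproduct X Ys i p \<longleftrightarrow> X \<in> Ob C \<and> set Ys \<subseteq> Ob C \<and>
     (\<forall>j < length Ys. arr (Ys ! j) X (i j) \<and> arr X (Ys ! j) (p j)) \<and>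
     (\<forall>j < length Ys. \<forall>l < length Ys.
        p l \<cdot> i j = (if j = l then ident C (Ys ! j) else zero_mor (Ys ! j) (Ys ! l))) \<and>
     (\<Oplus>\<^bsub>Hom C X X\<^esub> j \<in> {..<length Ys}. i j \<cdot> p j) = ident C X"

lemma direct_sum_iff: "direct_sum C X Ys \<longleftrightarrow> (\<exists>i p. biproduct X Ys i p)"
proof -
  have "(\<forall>j < length Ys. arr (Ys ! j) X (i j) \<and> arr X (Ys ! j) (p j)) \<longleftrightarrow>
    (\<forall>j < length Ys. i j \<in> mor C (Ys ! j) X \<and> p j \<in> mor C X (Ys ! j))"
    if "X \<in> Ob C" "set Ys \<subseteq> Ob C" for i p
    using that nth_mem[of _ Ys] by (auto simp: arr_def)
  then show ?thesis unfolding direct_sum_def biproduct_def by (simp cong: conj_cong)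
qed

text \<open>Inserting the decomposition of the identity writes \<open>f\<close> as the sum of the
  \<open>(f \<cdot> i j) \<cdot> p j\<close>.\<close>

lemma biproduct_jointly_epi:
  assumes b: "biproduct X Ys i p" and f: "arr X Z f"
    and zero: "\<And>j. j < length Ys \<Longrightarrow> f \<cdot> i j = zero_mor (Ys ! j) Z"
  shows "f = zero_mor X Z"
proof -
  have ob: "X \<in> Ob C" "Z \<in> Ob C" using f by (auto simp: arr_def)
  have arrs: "arr (Ys ! j) X (i j)" "arr X (Ys ! j) (p j)" if "j < length Ys" for j
    using b that by (auto simp: biproduct_def)
  have "f \<cdot> (i j \<cdot> p j) = zero_mor X Z" if "j < length Ys" for j
    using assoc[OF arrs(2) arrs(1) f, OF that that] zero[OF that] comp_zero_left[OF arrs(2) ob(2), OF that]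
    by simp
  then have "(\<Oplus>\<^bsub>Hom C X Z\<^esub> j \<in> {..<length Ys}. f \<cdot> (i j \<cdot> p j)) = zero_mor X Z"
    using ob by (intro finsum_zero_mor) auto
  moreover have "f \<cdot> (\<Oplus>\<^bsub>Hom C X X\<^esub> j \<in> {..<length Ys}. i j \<cdot> p j) =
    (\<Oplus>\<^bsub>Hom C X Z\<^esub> j \<in> {..<length Ys}. f \<cdot> (i j \<cdot> p j))"
    using arrs by (intro comp_finsum_right f ob) (auto intro: comp_arr)
  ultimately show ?thesis using b id_right[OF f] by (simp add: biproduct_def)
qed

lemma biproduct_jointly_mono:
  assumes b: "biproduct X Ys i p" and f: "arr Z X f"
    and zero: "\<And>j. j < length Ys \<Longrightarrow> p j \<cdot> f = zero_mor Z (Ys ! j)"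
  shows "f = zero_mor Z X"
proof -
  have ob: "X \<in> Ob C" "Z \<in> Ob C" using f by (auto simp: arr_def)
  have arrs: "arr (Ys ! j) X (i j)" "arr X (Ys ! j) (p j)" if "j < length Ys" for j
    using b that by (auto simp: biproduct_def)
  have "(i j \<cdot> p j) \<cdot> f = zero_mor Z X" if "j < length Ys" for j
    using assoc[OF f arrs(2) arrs(1), OF that that] zero[OF that] comp_zero_right[OF arrs(1) ob(2), OF that]
    by simp
  then have "(\<Oplus>\<^bsub>Hom C Z X\<^esub> j \<in> {..<length Ys}. (i j \<cdot> p j) \<cdot> f) = zero_mor Z X"
    using ob by (intro finsum_zero_mor) auto
  moreover have "(\<Oplus>\<^bsub>Hom C X X\<^esub> j \<in> {..<length Ys}. i j \<cdot> p j) \<cdot> f =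
    (\<Oplus>\<^bsub>Hom C Z X\<^esub> j \<in> {..<length Ys}. (i j \<cdot> p j) \<cdot> f)"
    using arrs by (intro comp_finsum_left f ob) (auto intro: comp_arr)
  ultimately show ?thesis using b id_left[OF f] by (simp add: biproduct_def)
qed

lemma direct_sum_iso:
  assumes "direct_sum C X Ys" "isomorphic C X X'"
  shows "direct_sum C X' Ys"
proof -
  obtain i p where b: "biproduct X Ys i p" using assms(1) by (auto simp: direct_sum_iff)
  obtain f g where f: "arr X X' f" and g: "arr X' X g" and gf: "g \<cdot> f = ident C X" and fg: "f \<cdot> g = ident C X'"
    using assms(2) by (rule isomorphicE)
  have ob: "X \<in> Ob C" "X' \<in> Ob C" using f by (auto simp: arr_def)
  have arrs: "arr (Ys ! j) X (i j)" "arr X (Ys ! j) (p j)" if "j < length Ys" for j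
    using b that by (auto simp: biproduct_def)
  have ip: "arr X X (i j \<cdot> p j)" if "j < length Ys" for j using arrs that comp_arr by blast
  have "(p l \<cdot> g) \<cdot> (f \<cdot> i j) = p l \<cdot> i j" if "j < length Ys" "l < length Ys" for j l
  proof -
    have "(p l \<cdot> g) \<cdot> (f \<cdot> i j) = p l \<cdot> (g \<cdot> (f \<cdot> i j))"
      using assoc[OF comp_arr[OF arrs(1)[OF that(1)] f] g arrs(2)[OF that(2)]] .
    also have "\<dots> = p l \<cdot> i j"
      using assoc[OF arrs(1)[OF that(1)] f g] gf id_left[OF arrs(1)[OF that(1)]] by simp
    finally show ?thesis .
  qed
  moreover have "(\<Oplus>\<^bsub>Hom C X' X'\<^esub> j \<in> {..<length Ys}. (f \<cdot> i j) \<cdot> (p j \<cdot> g)) = ident C X'"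
  proof -
    interpret abelian_group "Hom C X' X'" using ob Hom_abelian_group by simp
    have "(\<Oplus>\<^bsub>Hom C X' X'\<^esub> j \<in> {..<length Ys}. (f \<cdot> i j) \<cdot> (p j \<cdot> g)) =
      (\<Oplus>\<^bsub>Hom C X' X'\<^esub> j \<in> {..<length Ys}. f \<cdot> ((i j \<cdot> p j) \<cdot> g))"
    proof (rule finsum_cong')
      show "(\<lambda>j. f \<cdot> ((i j \<cdot> p j) \<cdot> g)) \<in> {..<length Ys} \<rightarrow> mor C X' X'"
        using comp_arr[OF comp_arr[OF g ip] f] by (auto simp: arr_def)
      fix j assume "j \<in> {..<length Ys}"
      then have j: "j < length Ys" by simp
      show "(f \<cdot> i j) \<cdot> (p j \<cdot> g) = f \<cdot> ((i j \<cdot> p j) \<cdot> g)"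
        using assoc[OF comp_arr[OF g arrs(2)[OF j]] arrs(1)[OF j] f] assoc[OF g arrs(2)[OF j] arrs(1)[OF j]]
        by simp
    qed simp
    also have "\<dots> = f \<cdot> (\<Oplus>\<^bsub>Hom C X' X\<^esub> j \<in> {..<length Ys}. (i j \<cdot> p j) \<cdot> g)"
      using comp_arr[OF g ip] ob by (intro comp_finsum_right[symmetric] f) auto
    also have "(\<Oplus>\<^bsub>Hom C X' X\<^esub> j \<in> {..<length Ys}. (i j \<cdot> p j) \<cdot> g) =
      (\<Oplus>\<^bsub>Hom C X X\<^esub> j \<in> {..<length Ys}. i j \<cdot> p j) \<cdot> g"
      using ip ob by (intro comp_finsum_left[symmetric] g) auto
    finally show ?thesis using b fg id_left[OF g] by (simp add: biproduct_def)
  qed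
  moreover have "arr (Ys ! j) X' (f \<cdot> i j)" "arr X' (Ys ! j) (p j \<cdot> g)" if "j < length Ys" for j
    using arrs[OF that] f g comp_arr by blast+
  ultimately have "biproduct X' Ys (\<lambda>j. f \<cdot> i j) (\<lambda>j. p j \<cdot> g)"
    using b ob by (simp add: biproduct_def)
  then show ?thesis by (auto simp: direct_sum_iff)
qed

lemma direct_sum_single:
  assumes "isomorphic C X Y" shows "direct_sum C X [Y]"
proof -
  obtain f g where f: "arr X Y f" and g: "arr Y X g" and gf: "g \<cdot> f = ident C X" and fg: "f \<cdot> g = ident C Y"
    using assms by (rule isomorphicE)
  interpret abelian_group "Hom C X X" using f Hom_abelian_group by (auto simp: arr_def)
  have "biproduct X [Y] (\<lambda>_. g) (\<lambda>_. f)"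
    using f g gf fg comp_arr[OF f g] by (auto simp: biproduct_def arr_def lessThan_Suc)
  then show ?thesis by (auto simp: direct_sum_iff)
qed

end

section \<open>Objects with local endomorphism ring\<close>

context linear_category
begin

text \<open>For a non-zero object this is locality of the endomorphism ring, in the form that
  \<open>f\<close> or \<open>1 - f\<close> is invertible. Stated with isomorphisms rather than with
  an ideal, it is easily moved along isomorphisms and along the shift.\<close>

definition local_object :: "'o \<Rightarrow> bool" where
  "local_object X \<longleftrightarrow> X \<in> Ob C \<and> \<not> zero_object C X \<and>
     (\<forall>f. arr X X f \<longrightarrow> isomorphism C X X f \<or> isomorphism C X X (diff_mor X X (ident C X) f))"

lemma local_objectD:
  assumes "local_object X"
  shows "X \<in> Ob C" "\<not> zero_object C X" "ident C X \<noteq> zero_mor X X"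
  using assms zero_objectI by (auto simp: local_object_def)

lemma local_object_cases:
  assumes "local_object X" "arr X X f"
  obtains "isomorphism C X X f" | "isomorphism C X X (diff_mor X X (ident C X) f)"
  using assms by (auto simp: local_object_def)

lemma iso_cancel_left:
  assumes g: "isomorphism C Y Z g" and f: "arr X Y f" "arr X Y f'" "Z \<in> Ob C" and eq: "g \<cdot> f = g \<cdot> f'"
  shows "f = f'"
proof -
  obtain h where h: "arr Y Z g" "arr Z Y h" "h \<cdot> g = ident C Y"
    using isomorphismE[OF g] f by (auto simp: arr_def)
  then show ?thesis using assoc[OF f(1) h(1,2)] assoc[OF f(2) h(1,2)] eq f id_left by metis
qed

text \<open>A Nakayama argument: \<open>1 - a\<close> is invertible and annihilates
  \<open>f\<close>. A radical endomorphism can thus fix only zero.\<close>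

lemma left_zero_of_unit:
  assumes loc: "local_object X" and a: "arr X X a" "\<not> isomorphism C X X a"
    and f: "arr W X f" "f = a \<cdot> f"
  shows "f = zero_mor W X"
proof -
  have ob: "X \<in> Ob C" "W \<in> Ob C" using f by (auto simp: arr_def)
  have iso: "isomorphism C X X (diff_mor X X (ident C X) a)"
    using local_object_cases[OF loc a(1)] a(2) by blast
  have "diff_mor X X (ident C X) a \<cdot> f = zero_mor W X"
    using comp_diff_left[OF f(1) ident_arr[OF ob(1)] a(1)] id_left[OF f(1)] f diff_eq_zero_iff[OF f(1) f(1)]
    by simp
  moreover have "arr X X (diff_mor X X (ident C X) a)" using diff_arr ident_arr ob a by blast
  ultimately show ?thesis
    using iso_cancel_left[OF iso f(1) zero_arr[OF ob(2,1)] ob(1)] comp_zero_right ob by simp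
qed

text \<open>The idempotent \<open>f \<cdot> r\<close> of the local object \<open>Y\<close> is either
  invertible, and then equals the identity by cancellation, or radical, and then
  \<open>f = (f \<cdot> r) \<cdot> f\<close> vanishes.\<close>

lemma iso_of_idempotent_splitting:
  assumes f: "arr X Y f" and r: "arr Y X r" and rf: "r \<cdot> f = ident C X"
    and X: "\<not> zero_object C X" and loc: "local_object Y"
  shows "f \<cdot> r = ident C Y"
proof -
  have ob: "X \<in> Ob C" "Y \<in> Ob C" using f by (auto simp: arr_def)
  have fr: "arr Y Y (f \<cdot> r)" using comp_arr[OF r f] .
  have frf: "(f \<cdot> r) \<cdot> f = f" using assoc[OF f r f] rf id_right[OF f] by simp
  consider (1) "isomorphism C Y Y (f \<cdot> r)" | (2) "\<not> isomorphism C Y Y (f \<cdot> r)" by blast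
  then show ?thesis
  proof cases
    case 1
    have "(f \<cdot> r) \<cdot> (f \<cdot> r) = (f \<cdot> r) \<cdot> ident C Y"
      using assoc[OF r f fr] frf id_right[OF fr] by simp
    then show ?thesis
      using iso_cancel_left[OF 1 fr ident_arr[OF ob(2)] ob(2)] by simp
  next
    case 2
    then have "f = zero_mor X Y" using left_zero_of_unit[OF loc fr 2 f] frf by simp
    then have "ident C X = zero_mor X X" using rf comp_zero_right[OF r ob(1)] by simp
    then show ?thesis using X zero_objectI ob by blast
  qed
qed

lemma split_mono_iso:
  assumes f: "arr X Y f" "split_mono C X Y f" and X: "\<not> zero_object C X" and loc: "local_object Y"
  shows "isomorphism C X Y f"
proof -
  obtain r where r: "arr Y X r" "r \<cdot> f = ident C X"
    using f by (auto simp: split_mono_def arr_def)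
  then show ?thesis using iso_of_idempotent_splitting[OF f(1) r X loc] f(1) isomorphismI by blast
qed

lemma split_epi_iso:
  assumes f: "arr X Y f" "split_epi C X Y f" and Y: "\<not> zero_object C Y" and loc: "local_object X"
  shows "isomorphism C X Y f"
proof -
  obtain s where s: "arr Y X s" "f \<cdot> s = ident C Y"
    using f by (auto simp: split_epi_def arr_def)
  then show ?thesis using iso_of_idempotent_splitting[OF s(1) f(1) s(2) Y loc] f(1) isomorphismI by blast
qed

lemma isomorphism_split:
  assumes "isomorphism C X Y f" "X \<in> Ob C" "Y \<in> Ob C"
  shows "split_mono C X Y f" "split_epi C X Y f"
  using assms by (auto simp: isomorphism_def split_mono_def split_epi_def)

lemma split_mono_of_iso_comp:
  assumes f: "arr X Y f" and g: "arr Y X g" and iso: "isomorphism C X X (g \<cdot> f)"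
  shows "split_mono C X Y f"
proof -
  have ob: "X \<in> Ob C" using f by (auto simp: arr_def)
  obtain h where h: "arr X X h" "h \<cdot> (g \<cdot> f) = ident C X" using isomorphismE[OF iso ob ob] .
  then have "(h \<cdot> g) \<cdot> f = ident C X" "arr Y X (h \<cdot> g)"
    using assoc[OF f g h(1)] comp_arr[OF g h(1)] by auto
  then show ?thesis using f by (auto simp: split_mono_def arr_def)
qed

lemma split_epi_of_iso_comp:
  assumes f: "arr X Y f" and g: "arr Y X g" and iso: "isomorphism C Y Y (f \<cdot> g)"
  shows "split_epi C X Y f"
proof -
  have ob: "Y \<in> Ob C" using f by (auto simp: arr_def)
  obtain h where h: "arr Y Y h" "(f \<cdot> g) \<cdot> h = ident C Y" using isomorphismE[OF iso ob ob] .
  then have "f \<cdot> (g \<cdot> h) = ident C Y" "arr Y X (g \<cdot> h)"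
    using assoc[OF h(1) g f] comp_arr[OF h(1) g] by auto
  then show ?thesis using f by (auto simp: split_epi_def arr_def)
qed

text \<open>After normalising the sum to the identity by \<open>h\<close>, the two terms are
  \<open>h \<cdot> f\<close> and \<open>1 - h \<cdot> f\<close>, and locality applies. An
  endomorphism with an invertible multiple is a split monomorphism, hence invertible.\<close>

lemma iso_of_sum:
  assumes loc: "local_object X" and f: "arr X X f" and g: "arr X X g"
    and iso: "isomorphism C X X (add_mor X X f g)"
  shows "isomorphism C X X f \<or> isomorphism C X X g"
proof (rule ccontr)
  assume none: "\<not> ?thesis"
  have ob: "X \<in> Ob C" using f by (auto simp: arr_def)
  obtain h where h: "arr X X h" "h \<cdot> add_mor X X f g = ident C X"
    using isomorphismE[OF iso ob ob] .
  have hf: "arr X X (h \<cdot> f)" "arr X X (h \<cdot> g)" using comp_arr h f g by blast+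
  have "add_mor X X (h \<cdot> f) (h \<cdot> g) = ident C X"
    using comp_add_right[OF h(1) f g] h(2) by simp
  then have hg: "h \<cdot> g = diff_mor X X (ident C X) (h \<cdot> f)"
    using add_diff_mor(2)[OF hf] by simp
  have "f \<noteq> zero_mor X X \<or> g \<noteq> zero_mor X X"
  proof (rule ccontr)
    assume "\<not> ?thesis"
    then have "ident C X = zero_mor X X"
      using \<open>add_mor X X (h \<cdot> f) (h \<cdot> g) = ident C X\<close> comp_zero_right[OF h(1) ob] add_diff_mor(1)[OF zero_arr zero_arr]
        zero_diff[OF zero_arr] ob by metis
    then show False using local_objectD[OF loc] by simp
  qed
  have "isomorphism C X X (h \<cdot> f) \<or> isomorphism C X X (h \<cdot> g)"
    using local_object_cases[OF loc hf(1)] hg by metis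
  then show False
    using none split_mono_of_iso_comp[OF f h(1)] split_mono_of_iso_comp[OF g h(1)]
      split_mono_iso[OF f] split_mono_iso[OF g] loc local_objectD[OF loc] by blast
qed

lemma iso_of_finsum:
  assumes loc: "local_object X" and A: "finite A" "\<And>j. j \<in> A \<Longrightarrow> arr X X (h j)"
    and iso: "isomorphism C X X (\<Oplus>\<^bsub>Hom C X X\<^esub> j\<in>A. h j)"
  shows "\<exists>j\<in>A. isomorphism C X X (h j)"
  using A iso
proof (induction A)
  case empty
  have ob: "X \<in> Ob C" using loc by (rule local_objectD)
  interpret abelian_group "Hom C X X" using ob Hom_abelian_group by simp
  have "isomorphism C X X (zero_mor X X)" using empty by simp
  then obtain g where g: "arr X X g" "g \<cdot> zero_mor X X = ident C X"
    using isomorphismE[OF _ ob ob] by blast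
  then have "ident C X = zero_mor X X" using comp_zero_right[OF g(1) ob] by simp
  then show ?case using local_objectD[OF loc] by simp
next
  case (insert a A)
  have ob: "X \<in> Ob C" using loc by (rule local_objectD)
  interpret abelian_group "Hom C X X" using ob Hom_abelian_group by simp
  have "(\<Oplus>\<^bsub>Hom C X X\<^esub> j\<in>insert a A. h j) = add_mor X X (h a) (\<Oplus>\<^bsub>Hom C X X\<^esub> j\<in>A. h j)"
    using insert by (intro finsum_insert) (auto simp: arr_def)
  then show ?case
    using insert iso_of_sum[OF loc, of "h a" "\<Oplus>\<^bsub>Hom C X X\<^esub> j\<in>A. h j"]
      finsum_arr[OF insert.hyps(1) ob ob, of h] by auto
qed

text \<open>\<open>f\<close> and \<open>1 - f\<close> cannot both lie in the ideal of non-units, as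
  their sum is the identity.\<close>

lemma local_object_of_local_ring:
  assumes X: "X \<in> Ob C" and loc: "local_ring (endo_ring C X)"
  shows "local_object X"
proof -
  let ?R = "endo_ring C X"
  have carr: "carrier ?R = mor C X X" by (simp add: endo_ring_def)
  have units: "f \<in> Units ?R \<longleftrightarrow> isomorphism C X X f" for f
    by (auto simp: Units_def endo_ring_def isomorphism_def)
  interpret ideal "mor C X X - Units ?R" ?R using loc by (simp add: local_ring_def carr)
  have zero_nonunit: "zero_mor X X \<notin> Units ?R"
    using additive_subgroup.zero_closed[OF additive_subgroup_axioms] by (simp add: endo_ring_def)
  have "\<not> zero_object C X"
  proof
    assume "zero_object C X"
    then have "ident C X = zero_mor X X" using X zero_object_iff by blast
    then show False using zero_nonunit units isomorphism_ident[OF X] by simp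
  qed
  moreover have "isomorphism C X X f \<or> isomorphism C X X (diff_mor X X (ident C X) f)" if f: "arr X X f" for f
  proof (rule ccontr)
    assume none: "\<not> ?thesis"
    have "arr X X (diff_mor X X (ident C X) f)" using f ident_arr X diff_arr by blast
    then have "add_mor X X f (diff_mor X X (ident C X) f) \<in> mor C X X - Units ?R"
      using none f units additive_subgroup.a_closed[OF additive_subgroup_axioms, of f "diff_mor X X (ident C X) f"]
      by (simp add: endo_ring_def arr_def)
    then have "\<not> isomorphism C X X (ident C X)"
      using add_diff_mor(1)[OF f ident_arr[OF X]] units by simp
    then show False using isomorphism_ident[OF X] by simp
  qed
  ultimately show ?thesis using X by (simp add: local_object_def)
qed

lemma local_object_iso:
  assumes loc: "local_object X" and iso: "isomorphic C X Y"
  shows "local_object Y"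
proof -
  obtain f g where f: "arr X Y f" and g: "arr Y X g" and gf: "g \<cdot> f = ident C X" and fg: "f \<cdot> g = ident C Y"
    and isof: "isomorphism C X Y f" and isog: "isomorphism C Y X g"
    using iso by (rule isomorphicE)
  have ob: "X \<in> Ob C" "Y \<in> Ob C" using f by (auto simp: arr_def)
  have "ident C Y \<noteq> zero_mor Y Y"
  proof
    assume "ident C Y = zero_mor Y Y"
    then have "f = zero_mor X Y" using id_left[OF f] comp_zero_left[OF f ob(2)] by simp
    then show False using gf comp_zero_right[OF g ob(1)] local_objectD[OF loc] by simp
  qed
  moreover have "isomorphism C Y Y a \<or> isomorphism C Y Y (diff_mor Y Y (ident C Y) a)" if a: "arr Y Y a" for a
  proof -
    have conj: "isomorphism C Y Y b" if b: "arr Y Y b" and i: "isomorphism C X X (g \<cdot> (b \<cdot> f))" for b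
    proof -
      have "isomorphism C Y Y (f \<cdot> ((g \<cdot> (b \<cdot> f)) \<cdot> g))"
        using isomorphism_comp[OF isomorphism_comp[OF isog i] isof] ob by simp
      moreover have "f \<cdot> ((g \<cdot> (b \<cdot> f)) \<cdot> g) = b"
      proof -
        have bf: "arr X Y (b \<cdot> f)" using comp_arr f b by blast
        have "(g \<cdot> (b \<cdot> f)) \<cdot> g = g \<cdot> b"
          using assoc[OF g bf g] assoc[OF g f b] fg id_right[OF b] by simp
        then show ?thesis using assoc[OF b g f] fg id_left[OF b] by simp
      qed
      ultimately show ?thesis by simp
    qed
    have af: "arr X Y (a \<cdot> f)" using comp_arr f a by blast
    have gaf: "arr X X (g \<cdot> (a \<cdot> f))" using comp_arr af g by blast
    have "g \<cdot> (diff_mor Y Y (ident C Y) a \<cdot> f) = diff_mor X X (ident C X) (g \<cdot> (a \<cdot> f))"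
      using comp_diff_left[OF f ident_arr[OF ob(2)] a] id_left[OF f] comp_diff_right[OF g f af] gf by simp
    then show ?thesis
      using local_object_cases[OF loc gaf] conj[OF a] conj[OF diff_arr[OF ident_arr[OF ob(2)] a]] by metis
  qed
  ultimately show ?thesis using ob zero_object_iff by (auto simp: local_object_def)
qed

lemma direct_sum_pairE:
  assumes "direct_sum C X [A, B]"
  obtains a b p q where "arr A X a" "arr B X b" "arr X A p" "arr X B q" "p \<cdot> a = ident C A" "q \<cdot> b = ident C B"
    "q \<cdot> a = zero_mor A B" "p \<cdot> b = zero_mor B A" "add_mor X X (a \<cdot> p) (b \<cdot> q) = ident C X"
proof -
  obtain i p where b: "biproduct X [A, B] i p" using assms by (auto simp: direct_sum_iff)
  have arrs: "arr A X (i 0)" "arr B X (i 1)" "arr X A (p 0)" "arr X B (p 1)"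
    using b by (auto simp: biproduct_def less_Suc_eq)
  interpret abelian_group "Hom C X X" using b Hom_abelian_group by (auto simp: biproduct_def)
  have "(\<Oplus>\<^bsub>Hom C X X\<^esub> j \<in> {..<Suc (Suc 0)}. i j \<cdot> p j) = add_mor X X (i 0 \<cdot> p 0) (i 1 \<cdot> p 1)"
    using comp_arr[OF arrs(3,1)] comp_arr[OF arrs(4,2)] by (simp add: lessThan_Suc arr_def a_comm)
  moreover have "p l \<cdot> i j = (if j = l then ident C ([A, B] ! j) else zero_mor ([A, B] ! j) ([A, B] ! l))"
    if "j < 2" "l < 2" for j l using b that by (simp add: biproduct_def)
  from this[of 0 0] this[of 1 1] this[of 0 1] this[of 1 0]
  have "p 0 \<cdot> i 0 = ident C A" "p 1 \<cdot> i 1 = ident C B" "p 1 \<cdot> i 0 = zero_mor A B" "p 0 \<cdot> i 1 = zero_mor B A"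
    by simp_all
  ultimately show ?thesis using that[OF arrs] b by (simp add: biproduct_def)
qed

lemma direct_sum_pairI:
  assumes arrs: "arr A X a" "arr B X b" "arr X A p" "arr X B q" and "p \<cdot> a = ident C A" "q \<cdot> b = ident C B"
    "q \<cdot> a = zero_mor A B" "p \<cdot> b = zero_mor B A" "add_mor X X (a \<cdot> p) (b \<cdot> q) = ident C X"
  shows "direct_sum C X [A, B]"
proof -
  have ob: "X \<in> Ob C" using arrs by (auto simp: arr_def)
  interpret abelian_group "Hom C X X" using ob Hom_abelian_group by simp
  have "biproduct X [A, B] (\<lambda>j. if j = 0 then a else b) (\<lambda>j. if j = 0 then p else q)"
    using assms ob comp_arr[OF arrs(3,1)] comp_arr[OF arrs(4,2)]
    by (auto simp: biproduct_def less_Suc_eq lessThan_Suc arr_def a_comm)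
  then show ?thesis by (auto simp: direct_sum_iff)
qed

text \<open>A non-zero summand \<open>A\<close> embeds by a split monomorphism, so
  \<open>a \<cdot> p\<close> is the identity, and the injection of \<open>B\<close>, equal to
  \<open>a \<cdot> (p \<cdot> b)\<close>, is zero.\<close>

lemma local_object_indecomposable:
  assumes loc: "local_object X"
  shows "indecomposable C X"
  unfolding indecomposable_def
proof (intro conjI allI impI local_objectD[OF loc])
  fix A B assume "direct_sum C X [A, B]"
  then obtain a b p q where ab: "arr A X a" "arr B X b" "arr X A p" "arr X B q" and eq: "p \<cdot> a = ident C A"
    "q \<cdot> b = ident C B" "q \<cdot> a = zero_mor A B" "p \<cdot> b = zero_mor B A" "add_mor X X (a \<cdot> p) (b \<cdot> q) = ident C X"
    by (rule direct_sum_pairE)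
  have ob: "X \<in> Ob C" "A \<in> Ob C" "B \<in> Ob C" using ab by (auto simp: arr_def)
  show "zero_object C A \<or> zero_object C B"
  proof (cases "zero_object C A")
    case False
    have "split_mono C A X a" using ab eq by (auto simp: split_mono_def arr_def)
    then have ap: "a \<cdot> p = ident C X"
      using iso_of_idempotent_splitting[OF ab(1,3) eq(1) False loc] by simp
    have "b = a \<cdot> (p \<cdot> b)" using assoc[OF ab(2,3,1)] ap id_left[OF ab(2)] by simp
    then have "b = zero_mor B X" using eq(4) comp_zero_right[OF ab(1) ob(3)] by simp
    then have "ident C B = zero_mor B B" using eq(2) comp_zero_right[OF ab(4) ob(3)] by simp
    then show ?thesis using zero_objectI ob by blast
  qed simp
qed

end

section \<open>Exactness of distinguished triangles\<close>

context triangulated_category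
begin

section \<open>The shift functor on objects and morphisms\<close>

abbreviation sh where "sh \<equiv> shift_ob C"
abbreviation shm where "shm \<equiv> shift_mor C"

lemma dist_arr:
  assumes "dist C X Y Z u v w" shows "arr X Y u" "arr Y Z v" "arr Z (sh X) w"
  using dist_candidate[OF assms] shift_ob by (auto simp: candidate_triangle_def arr_def)

lemma zero_object_exists: obtains Z where "zero_object C Z"
proof -
  obtain Z where "direct_sum C Z []" using direct_sum_exists[of "[]"] by auto
  then obtain i p where b: "biproduct Z [] i p" by (auto simp: direct_sum_iff)
  then have Z: "Z \<in> Ob C" by (simp add: biproduct_def)
  have "ident C Z = zero_mor Z Z" using biproduct_jointly_epi[OF b ident_arr[OF Z]] by simp
  then show ?thesis using that zero_objectI Z by blast
qed

lemma shm_linear: "X \<in> Ob C \<Longrightarrow> Y \<in> Ob C \<Longrightarrow> linear_map K (Hom C X Y) (Hom C (sh X) (sh Y)) shm"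
  by (intro linear_mapI vectorspace_Hom shift_linear shift_ob)

lemma shm_arr: "arr X Y f \<Longrightarrow> arr (sh X) (sh Y) (shm f)"
  using linear_map.T_im[OF shm_linear] shift_ob by (auto simp: arr_def)

lemma shm_inject: "arr X Y f \<Longrightarrow> arr X Y g \<Longrightarrow> shm f = shm g \<Longrightarrow> f = g"
  using shift_fully_faithful[of X Y] by (auto simp: arr_def bij_betw_def inj_on_def)

lemma shm_surj:
  assumes "arr (sh X) (sh Y) g" "X \<in> Ob C" "Y \<in> Ob C" obtains f where "arr X Y f" "shm f = g"
proof -
  have "g \<in> shm ` mor C X Y"
    using shift_fully_faithful[of X Y] assms by (simp add: arr_def bij_betw_def)
  then show ?thesis using that assms by (auto simp: arr_def)
qed

lemma shm_zero: "X \<in> Ob C \<Longrightarrow> Y \<in> Ob C \<Longrightarrow> shm (zero_mor X Y) = zero_mor (sh X) (sh Y)"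
  using linear_map.T0_is_0[OF shm_linear] .

lemma shm_diff: "arr X Y f \<Longrightarrow> arr X Y g \<Longrightarrow>
    shm (diff_mor X Y f g) = diff_mor (sh X) (sh Y) (shm f) (shm g)"
  using linear_map.T_minus[OF shm_linear] by (auto simp: arr_def)

lemma shm_neg: "arr X Y f \<Longrightarrow> shm (\<ominus>\<^bsub>Hom C X Y\<^esub> f) = \<ominus>\<^bsub>Hom C (sh X) (sh Y)\<^esub> shm f"
  using linear_map.T_neg[OF shm_linear] by (auto simp: arr_def)

lemma shm_comp: "arr X Y f \<Longrightarrow> arr Y Z g \<Longrightarrow> shm (g \<cdot> f) = shm g \<cdot> shm f"
  using shift_comp by (auto simp: arr_def)

lemma shm_eq_zero: "arr X Y f \<Longrightarrow> shm f = zero_mor (sh X) (sh Y) \<Longrightarrow> f = zero_mor X Y"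
  using shm_inject[of X Y f "zero_mor X Y"] zero_arr shm_zero by (auto simp: arr_def)

lemma zero_object_shift: assumes "zero_object C Z" shows "zero_object C (sh Z)"
proof -
  have Z: "Z \<in> Ob C" using assms by (simp add: zero_object_def)
  then have "ident C (sh Z) = zero_mor (sh Z) (sh Z)"
    using assms zero_object_iff[OF Z] shift_ident[OF Z] shm_zero[OF Z Z] by simp
  then show ?thesis using zero_objectI shift_ob Z by blast
qed

lemma isomorphism_shift_iff:
  assumes "arr X Y f" shows "isomorphism C (sh X) (sh Y) (shm f) \<longleftrightarrow> isomorphism C X Y f"
proof
  have ob: "X \<in> Ob C" "Y \<in> Ob C" using assms by (auto simp: arr_def)
  {
    assume "isomorphism C X Y f"
    then obtain g where g: "arr Y X g" "g \<cdot> f = ident C X" "f \<cdot> g = ident C Y" using ob isomorphismE by metis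
    then show "isomorphism C (sh X) (sh Y) (shm f)"
      using shm_comp[OF assms g(1)] shm_comp[OF g(1) assms] shift_ident ob shm_arr assms
      by (intro isomorphismI[of _ _ _ "shm g"]) auto
  next
    assume "isomorphism C (sh X) (sh Y) (shm f)"
    then obtain g' where g': "arr (sh Y) (sh X) g'" "g' \<cdot> shm f = ident C (sh X)" "shm f \<cdot> g' = ident C (sh Y)"
      using ob shift_ob isomorphismE by metis
    then obtain g where g: "arr Y X g" "shm g = g'" using shm_surj ob by metis
    have "g \<cdot> f = ident C X"
      using g g'(2) shm_comp[OF assms g(1)] shift_ident ob
      by (intro shm_inject[OF comp_arr[OF assms g(1)] ident_arr[OF ob(1)]]) simp
    moreover have "f \<cdot> g = ident C Y"
      using g g'(3) shm_comp[OF g(1) assms] shift_ident ob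
      by (intro shm_inject[OF comp_arr[OF g(1) assms] ident_arr[OF ob(2)]]) simp
    ultimately show "isomorphism C X Y f" using isomorphismI assms g by blast
  }
qed

lemma isomorphic_shift_iff:
  assumes ob: "X \<in> Ob C" "Y \<in> Ob C" shows "isomorphic C (sh X) (sh Y) \<longleftrightarrow> isomorphic C X Y"
proof
  assume "isomorphic C (sh X) (sh Y)"
  then obtain g where g: "arr (sh X) (sh Y) g" "isomorphism C (sh X) (sh Y) g" by (rule isomorphicE)
  then obtain f where f: "arr X Y f" "shm f = g" using shm_surj ob by metis
  then show "isomorphic C X Y" using g isomorphism_shift_iff[OF f(1)] ob isomorphicI by blast
next
  assume "isomorphic C X Y"
  then obtain f where "arr X Y f" "isomorphism C X Y f" by (rule isomorphicE)
  then show "isomorphic C (sh X) (sh Y)" using isomorphism_shift_iff isomorphicI shift_ob ob by blast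
qed

lemma local_object_shift_iff:
  assumes X: "X \<in> Ob C" shows "local_object (sh X) \<longleftrightarrow> local_object X"
proof -
  have "zero_object C (sh X) \<longleftrightarrow> zero_object C X"
    using X zero_object_iff shift_ob shift_ident[OF X] shm_zero[OF X X]
      shm_eq_zero[OF ident_arr[OF X]] by metis
  moreover have "isomorphism C (sh X) (sh X) (diff_mor (sh X) (sh X) (ident C (sh X)) (shm f)) \<longleftrightarrow>
      isomorphism C X X (diff_mor X X (ident C X) f)" if "arr X X f" for f
    using that shm_diff[OF ident_arr[OF X] that] shift_ident[OF X]
      isomorphism_shift_iff[OF diff_arr[OF ident_arr[OF X] that]] by simp
  moreover have "(\<forall>f. arr (sh X) (sh X) f \<longrightarrow> P f) \<longleftrightarrow> (\<forall>f. arr X X f \<longrightarrow> P (shm f))" for P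
    using shm_surj[of X X] shm_arr[of X X] X by metis
  ultimately show ?thesis
    using X shift_ob isomorphism_shift_iff unfolding local_object_def by simp
qed

section \<open>Weak kernels and weak cokernels in distinguished triangles\<close>

lemma dist_rotate': "dist C X Y Z u v w \<Longrightarrow>
    dist C Y Z (sh X) v w (\<ominus>\<^bsub>Hom C (sh X) (sh Y)\<^esub> shm u)"
  using dist_rotate dist_candidate by blast

text \<open>Compare with the triangle on the identity of \<open>X\<close>: its third term is a zero
  object, through which the composite factors.\<close>

lemma dist_comp_zero:
  assumes d: "dist C X Y Z u v w" shows "v \<cdot> u = zero_mor X Z"
proof -
  obtain N where N: "zero_object C N" by (rule zero_object_exists)
  note a = dist_arr[OF d]
  have ob: "X \<in> Ob C" "Z \<in> Ob C" "N \<in> Ob C" using a N by (auto simp: arr_def zero_object_def)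
  obtain h where "h \<in> mor C N Z" "h \<cdot> zero_mor X N = v \<cdot> u"
    using dist_morphism[OF dist_ident[OF ob(1) N] d, of "ident C X" u] a ident_arr[OF ob(1)]
    by (auto simp: arr_def)
  then show ?thesis using comp_zero_right[of N Z h X] ob by (simp add: arr_def)
qed

lemma dist_comp_zero':
  assumes d: "dist C X Y Z u v w" shows "w \<cdot> v = zero_mor Y (sh X)"
  using dist_comp_zero[OF dist_rotate'[OF d]] .

text \<open>\<open>f\<close> and a zero morphism start a morphism from the rotated identity triangle
  of \<open>M\<close> to the rotated given triangle. Its third component lives on
  \<open>M[1]\<close> and is un-shifted by full faithfulness; the signs of the two rotations
  cancel.\<close>

lemma dist_lift:
  assumes d: "dist C X Y Z u v w" and f: "arr M Y f" "v \<cdot> f = zero_mor M Z"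
  obtains g where "arr M X g" "u \<cdot> g = f"
proof -
  obtain N where N: "zero_object C N" by (rule zero_object_exists)
  note a = dist_arr[OF d]
  have ob: "X \<in> Ob C" "Y \<in> Ob C" "Z \<in> Ob C" "N \<in> Ob C" "M \<in> Ob C"
    using a N f by (auto simp: arr_def zero_object_def)
  have z: "arr N Z (zero_mor N Z)" "arr M N (zero_mor M N)" using zero_arr ob by auto
  have "zero_mor N Z \<cdot> zero_mor M N = v \<cdot> f" using comp_zero_left[OF z(2) ob(3)] f by simp
  then obtain h where h: "h \<in> mor C (sh M) (sh X)"
    "shm f \<cdot> (\<ominus>\<^bsub>Hom C (sh M) (sh M)\<^esub> shm (ident C M)) = (\<ominus>\<^bsub>Hom C (sh X) (sh Y)\<^esub> shm u) \<cdot> h"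
    using dist_morphism[OF dist_rotate'[OF dist_ident[OF ob(5) N]] dist_rotate'[OF d], of f "zero_mor N Z"] f z
    by (auto simp: arr_def)
  obtain g where g: "arr M X g" "shm g = h" using shm_surj[of M X h] h ob shift_ob by (auto simp: arr_def)
  have "\<ominus>\<^bsub>Hom C (sh M) (sh Y)\<^esub> shm f = \<ominus>\<^bsub>Hom C (sh M) (sh Y)\<^esub> shm (u \<cdot> g)"
    using h(2) comp_neg_right[OF shm_arr[OF f(1)] ident_arr[OF shift_ob[OF ob(5)]]] shift_ident[OF ob(5)]
      id_right[OF shm_arr[OF f(1)]] comp_neg_left[OF shm_arr[OF g(1)] shm_arr[OF a(1)]] g(2)
      shm_comp[OF g(1) a(1)] by simp
  then have "shm f = shm (u \<cdot> g)"
    using neg_inject shm_arr f(1) comp_arr[OF g(1) a(1)] by blast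
  then have "f = u \<cdot> g" using shm_inject f(1) comp_arr[OF g(1) a(1)] by blast
  then show ?thesis using that g by simp
qed

lemma dist_extend:
  assumes d: "dist C X Y Z u v w" and f: "arr Y M f" "f \<cdot> u = zero_mor X M"
  obtains g where "arr Z M g" "g \<cdot> v = f"
proof -
  obtain N where N: "zero_object C N" by (rule zero_object_exists)
  note a = dist_arr[OF d]
  have ob: "X \<in> Ob C" "Y \<in> Ob C" "Z \<in> Ob C" "N \<in> Ob C" "M \<in> Ob C" "sh N \<in> Ob C"
    using a N f shift_ob by (auto simp: arr_def zero_object_def)
  \<comment> \<open>The shifted zero object is taken as third term so that this triangle is a
    rotation of one on \<open>N, M, M\<close>, which is then obtained by reading
    \<open>dist_rotate\<close> backwards.\<close>
  have "dist C M M (sh N) (ident C M) (zero_mor M (sh N)) (zero_mor (sh N) (sh M))"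
    using dist_ident ob zero_object_shift N by blast
  moreover have "\<ominus>\<^bsub>Hom C (sh N) (sh M)\<^esub> shm (zero_mor N M) = zero_mor (sh N) (sh M)"
    using shm_zero[OF ob(4,5)] neg_zero shift_ob ob by simp
  moreover have "candidate_triangle C N M M (zero_mor N M) (ident C M) (zero_mor M (sh N))"
    using ob zero_arr ident_arr by (auto simp: candidate_triangle_def arr_def)
  ultimately have d': "dist C N M M (zero_mor N M) (ident C M) (zero_mor M (sh N))"
    using dist_rotate by metis
  have z: "arr X N (zero_mor X N)" using zero_arr ob by auto
  have "f \<cdot> u = zero_mor N M \<cdot> zero_mor X N" using comp_zero_left[OF z ob(5)] f by simp
  then obtain h where h: "h \<in> mor C Z M" "h \<cdot> v = ident C M \<cdot> f"
    using dist_morphism[OF d d', of "zero_mor X N" f] f z by (auto simp: arr_def)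
  then show ?thesis using that[of h] id_left[OF f(1)] ob by (simp add: arr_def)
qed

lemma dist_lift':
  assumes d: "dist C X Y Z u v w" and f: "arr M Z f" "w \<cdot> f = zero_mor M (sh X)"
  obtains g where "arr M Y g" "v \<cdot> g = f"
  using dist_lift[OF dist_rotate'[OF d] f] .

lemma dist_extend':
  assumes d: "dist C X Y Z u v w" and f: "arr Z M f" "f \<cdot> v = zero_mor Y M"
  obtains g where "arr (sh X) M g" "g \<cdot> w = f"
  using dist_extend[OF dist_rotate'[OF d] f] .

lemma dist_shift_comp_zero:
  assumes d: "dist C X Y Z u v w" shows "shm u \<cdot> w = zero_mor Z (sh Y)"
proof -
  note a = dist_arr[OF d]
  have "(\<ominus>\<^bsub>Hom C (sh X) (sh Y)\<^esub> shm u) \<cdot> w = zero_mor Z (sh Y)"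
    using dist_comp_zero'[OF dist_rotate'[OF d]] .
  then show ?thesis
    using comp_neg_left[OF a(3) shm_arr[OF a(1)]] neg_eq_zero_iff[OF comp_arr[OF a(3) shm_arr[OF a(1)]]] by simp
qed

text \<open>Exactness one place further left: the extension is found for \<open>f[1]\<close> in the
  rotated triangle, un-shifted, and corrected by the sign that rotation introduces.\<close>

lemma dist_extend_first:
  assumes d: "dist C X Y Z u v w" and f: "arr X M f" "shm f \<cdot> w = zero_mor Z (sh M)"
  obtains g where "arr Y M g" "g \<cdot> u = f"
proof -
  note a = dist_arr[OF d]
  have ob: "X \<in> Ob C" "Y \<in> Ob C" "M \<in> Ob C" using a f by (auto simp: arr_def)
  obtain g' where g': "arr (sh Y) (sh M) g'" "g' \<cdot> (\<ominus>\<^bsub>Hom C (sh X) (sh Y)\<^esub> shm u) = shm f"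
    using dist_extend'[OF dist_rotate'[OF d] shm_arr[OF f(1)] f(2)] .
  obtain h where h: "arr Y M h" "shm h = g'" using shm_surj[OF g'(1) ob(2,3)] .
  define g where "g = \<ominus>\<^bsub>Hom C Y M\<^esub> h"
  have g: "arr Y M g" unfolding g_def using neg_arr h(1) .
  have "shm (g \<cdot> u) = (\<ominus>\<^bsub>Hom C (sh Y) (sh M)\<^esub> g') \<cdot> shm u"
    using shm_comp[OF a(1) g] shm_neg[OF h(1)] h(2) by (simp add: g_def)
  also have "\<dots> = shm f"
    using comp_neg_left[OF shm_arr[OF a(1)] g'(1)] comp_neg_right[OF g'(1) shm_arr[OF a(1)]] g'(2) by simp
  finally have "g \<cdot> u = f" using shm_inject comp_arr[OF a(1) g] f(1) by blast
  then show ?thesis using that g by blast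
qed

text \<open>The long exact sequence continued to the left. The shift need not have an inverse on
  objects, so the preimage under the connecting map is a morphism on \<open>M[1]\<close> instead of
  one into a desuspension of \<open>Z\<close>.\<close>

lemma dist_lift_third:
  assumes d: "dist C X Y Z u v w" and f: "arr M X f" "u \<cdot> f = zero_mor M Y"
  obtains g where "arr (sh M) Z g" "w \<cdot> g = shm f"
proof -
  note a = dist_arr[OF d]
  have ob: "X \<in> Ob C" "Y \<in> Ob C" "M \<in> Ob C" using a f by (auto simp: arr_def)
  have "shm u \<cdot> shm f = zero_mor (sh M) (sh Y)"
    using shm_comp[OF f(1) a(1)] f(2) shm_zero ob by simp
  then have "(\<ominus>\<^bsub>Hom C (sh X) (sh Y)\<^esub> shm u) \<cdot> shm f = zero_mor (sh M) (sh Y)"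
    using comp_neg_left[OF shm_arr[OF f(1)] shm_arr[OF a(1)]] neg_zero shift_ob ob by simp
  then show ?thesis using dist_lift'[OF dist_rotate'[OF d] shm_arr[OF f(1)]] that by blast
qed

lemma dist_shift:
  assumes d: "dist C X Y Z u v w"
  shows "dist C (sh X) (sh Y) (sh Z) (\<ominus>\<^bsub>Hom C (sh X) (sh Y)\<^esub> shm u)
    (\<ominus>\<^bsub>Hom C (sh Y) (sh Z)\<^esub> shm v) (\<ominus>\<^bsub>Hom C (sh Z) (sh (sh X))\<^esub> shm w)"
  using dist_rotate'[OF dist_rotate'[OF dist_rotate'[OF d]]] .

text \<open>The cone \<open>Z\<close> of \<open>i\<close> is the complement: \<open>p[1]\<close>
  retracts \<open>i[1]\<close>, so the connecting morphism \<open>w\<close> is zero and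
  \<open>v\<close> is epic, while \<open>1 - i \<cdot> p\<close> kills \<open>i\<close> and so
  factors as \<open>s \<cdot> v\<close>. The second conclusion recognises \<open>i\<close> as an
  isomorphism when \<open>Z\<close> is zero.\<close>

lemma split_mono_complement:
  assumes i: "arr Y X i" and p: "arr X Y p" and pi: "p \<cdot> i = ident C Y"
  obtains Z where "direct_sum C X [Y, Z]" "zero_object C Z \<longrightarrow> i \<cdot> p = ident C X"
proof -
  have ob: "X \<in> Ob C" "Y \<in> Ob C" using i by (auto simp: arr_def)
  obtain Z v w where d: "dist C Y X Z i v w" using dist_exists[of Y X i] i by (auto simp: arr_def)
  note a = dist_arr[OF d]
  have obZ: "Z \<in> Ob C" using a by (auto simp: arr_def)
  have "shm p \<cdot> (shm i \<cdot> w) = w"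
    using assoc[OF a(3) shm_arr[OF i] shm_arr[OF p]] shm_comp[OF i p] pi shift_ident[OF ob(2)] id_left[OF a(3)]
    by simp
  then have w: "w = zero_mor Z (sh Y)"
    using dist_shift_comp_zero[OF d] comp_zero_right[OF shm_arr[OF p] obZ] by simp
  have ip: "arr X X (i \<cdot> p)" using comp_arr[OF p i] .
  have "(i \<cdot> p) \<cdot> i = i" using assoc[OF i p i] pi id_right[OF i] by simp
  then have "diff_mor X X (ident C X) (i \<cdot> p) \<cdot> i = zero_mor Y X"
    using comp_diff_left[OF i ident_arr[OF ob(1)] ip] id_left[OF i] diff_eq_zero_iff[OF i i] by simp
  then obtain s where s: "arr Z X s" "s \<cdot> v = diff_mor X X (ident C X) (i \<cdot> p)"
    using dist_extend[OF d diff_arr[OF ident_arr[OF ob(1)] ip]] by blast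
  have vi: "v \<cdot> i = zero_mor Y Z" by (rule dist_comp_zero[OF d])
  have epi: "f = zero_mor Z M" if f: "arr Z M f" "f \<cdot> v = zero_mor X M" for f M
  proof -
    obtain g where g: "arr (sh Y) M g" "g \<cdot> w = f" using dist_extend'[OF d f] .
    then show ?thesis using w comp_zero_right[OF g(1) obZ] by simp
  qed
  have sv: "arr X X (s \<cdot> v)" using comp_arr[OF a(2) s(1)] .
  have "v \<cdot> (i \<cdot> p) = zero_mor X Z"
    using assoc[OF p i a(2)] vi comp_zero_left[OF p obZ] by simp
  then have "v \<cdot> (s \<cdot> v) = v"
    using s(2) comp_diff_right[OF a(2) ident_arr[OF ob(1)] ip] id_right[OF a(2)] zero_diff[OF a(2)] by simp
  then have "(v \<cdot> s) \<cdot> v = ident C Z \<cdot> v"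
    using assoc[OF a(2) s(1) a(2)] id_left[OF a(2)] by simp
  then have "diff_mor Z Z (v \<cdot> s) (ident C Z) \<cdot> v = zero_mor X Z"
    using comp_diff_left[OF a(2) comp_arr[OF s(1) a(2)] ident_arr[OF obZ]]
      diff_eq_zero_iff[OF comp_arr[OF a(2) ident_arr[OF obZ]] comp_arr[OF a(2) ident_arr[OF obZ]]] by simp
  then have vs: "v \<cdot> s = ident C Z"
    using epi[OF diff_arr[OF comp_arr[OF s(1) a(2)] ident_arr[OF obZ]]]
      diff_eq_zero_iff[OF comp_arr[OF s(1) a(2)] ident_arr[OF obZ]] by simp
  have "p \<cdot> (s \<cdot> v) = diff_mor X Y p (p \<cdot> (i \<cdot> p))"
    using s(2) comp_diff_right[OF p ident_arr[OF ob(1)] ip] id_right[OF p] by simp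
  also have "p \<cdot> (i \<cdot> p) = p" using assoc[OF p i p] pi id_left[OF p] by simp
  finally have "(p \<cdot> s) \<cdot> v = zero_mor X Y"
    using assoc[OF a(2) s(1) p] diff_eq_zero_iff[OF p p] by simp
  then have ps: "p \<cdot> s = zero_mor Z Y" using epi[OF comp_arr[OF s(1) p]] by simp
  have sum: "add_mor X X (i \<cdot> p) (s \<cdot> v) = ident C X"
    using s(2) add_diff_mor(1)[OF ip ident_arr[OF ob(1)]] by simp
  have "direct_sum C X [Y, Z]"
    by (rule direct_sum_pairI[OF i s(1) p a(2) pi vs vi ps sum])
  moreover have "i \<cdot> p = ident C X" if "zero_object C Z"
  proof -
    have "v = zero_mor X Z" using zero_object_arr'[OF that a(2)] .
    then have "s \<cdot> v = zero_mor X X" using comp_zero_right[OF s(1) ob(1)] by simp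
    then show ?thesis using s(2) diff_eq_zero_iff[OF ident_arr[OF ob(1)] ip] by simp
  qed
  ultimately show ?thesis using that by blast
qed

text \<open>One local summand of a given decomposition splits off, and indecomposability forces its
  complement to vanish. The complement comes from a cone, because indecomposability is stated for
  sums of two objects only.\<close>

lemma indecomposable_local_object:
  assumes ks: "krull_schmidt C" and X: "indecomposable C X"
  shows "local_object X"
proof -
  have ob: "X \<in> Ob C" "\<not> zero_object C X" using X by (auto simp: indecomposable_def)
  obtain Ys where Ys: "direct_sum C X Ys" "\<forall>Y \<in> set Ys. indecomposable C Y \<and> local_ring (endo_ring C Y)"
    using ks ob by (auto simp: krull_schmidt_def)
  obtain i p where b: "biproduct X Ys i p" using Ys by (auto simp: direct_sum_iff)
  have "Ys \<noteq> []"
  proof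
    assume "Ys = []"
    then have "ident C X = zero_mor X X"
      using biproduct_jointly_epi[OF b ident_arr[OF ob(1)]] by simp
    then show False using ob zero_objectI by blast
  qed
  then have l: "0 < length Ys" by simp
  let ?Y = "Ys ! 0"
  have Y: "indecomposable C ?Y" "local_ring (endo_ring C ?Y)" using Ys(2) l nth_mem by blast+
  have ip: "arr ?Y X (i 0)" "arr X ?Y (p 0)" "p 0 \<cdot> i 0 = ident C ?Y"
    using b l by (auto simp: biproduct_def)
  obtain Z where Z: "direct_sum C X [?Y, Z]" "zero_object C Z \<longrightarrow> i 0 \<cdot> p 0 = ident C X"
    using split_mono_complement[OF ip] .
  then have "zero_object C Z" using X Y by (auto simp: indecomposable_def)
  then have "isomorphic C ?Y X"
    using Z isomorphismI[OF ip] isomorphicI ip(1) ob(1) by (auto simp: arr_def)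
  then show ?thesis
    using local_object_iso local_object_of_local_ring Y by (auto simp: indecomposable_def)
qed

end

section \<open>Auslander-Reiten triangles\<close>

locale krull_schmidt_triangulated = triangulated_category K C
  for K :: "('k, 'r) ring_scheme" and C :: "('k, 'o, 'm, 'z) tri_cat_scheme" (structure) +
  assumes hom_fin: "hom_finite K C" and krull_schmidt: "krull_schmidt C"
begin

lemma indecomposable_iff_local: "indecomposable C X \<longleftrightarrow> local_object X"
  using indecomposable_local_object[OF krull_schmidt] local_object_indecomposable by blast

lemma indecomposable_ob: "indecomposable C X \<Longrightarrow> X \<in> Ob C"
  by (simp add: indecomposable_def)

lemma indecomposable_iso: "indecomposable C X \<Longrightarrow> isomorphic C X Y \<Longrightarrow> indecomposable C Y"
  using local_object_iso indecomposable_iff_local by blast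

lemma indecomposable_shift_iff: "X \<in> Ob C \<Longrightarrow> indecomposable C (sh X) \<longleftrightarrow> indecomposable C X"
  using local_object_shift_iff indecomposable_iff_local by blast

lemma decomposition:
  assumes "X \<in> Ob C"
  obtains Ys where "direct_sum C X Ys" "\<forall>Y \<in> set Ys. indecomposable C Y"
  using krull_schmidt assms unfolding krull_schmidt_def by blast

lemma AR_arr:
  assumes "AR_triangle C U V W u v w" shows "arr U V u" "arr V W v" "arr W (sh U) w"
  using dist_arr assms unfolding AR_triangle_def by blast+

lemma AR_dist: "AR_triangle C U V W u v w \<Longrightarrow> dist C U V W u v w"
  by (simp add: AR_triangle_def)

lemma AR_local:
  assumes "AR_triangle C U V W u v w" shows "local_object U" "local_object W"
  using assms indecomposable_iff_local by (auto simp: AR_triangle_def)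

lemma AR_nonzero: "AR_triangle C U V W u v w \<Longrightarrow> w \<noteq> zero_mor W (sh U)"
  by (simp add: AR_triangle_def)

text \<open>A section \<open>s\<close> of \<open>v\<close> would give
  \<open>w = (w \<cdot> v) \<cdot> s = 0\<close>.\<close>

lemma AR_not_split_epi:
  assumes AR: "AR_triangle C U V W u v w" shows "\<not> split_epi C V W v"
proof
  note a = AR_arr[OF AR]
  assume "split_epi C V W v"
  then obtain s where s: "arr W V s" "v \<cdot> s = ident C W" using a by (auto simp: split_epi_def arr_def)
  have "w = (w \<cdot> v) \<cdot> s" using assoc[OF s(1) a(2,3)] s(2) id_right[OF a(3)] by simp
  then have "w = zero_mor W (sh U)"
    using dist_comp_zero'[OF AR_dist[OF AR]] comp_zero_left[OF s(1)] a(3) by (simp add: arr_def)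
  then show False using AR_nonzero[OF AR] by simp
qed

lemma AR_not_split_mono:
  assumes AR: "AR_triangle C U V W u v w" shows "\<not> split_mono C U V u"
proof
  note a = AR_arr[OF AR]
  have ob: "U \<in> Ob C" "W \<in> Ob C" using a by (auto simp: arr_def)
  assume "split_mono C U V u"
  then obtain r where r: "arr V U r" "r \<cdot> u = ident C U" using a by (auto simp: split_mono_def arr_def)
  have "w = shm r \<cdot> (shm u \<cdot> w)"
    using assoc[OF a(3) shm_arr[OF a(1)] shm_arr[OF r(1)]] shm_comp[OF a(1) r(1)] r(2)
      shift_ident[OF ob(1)] id_left[OF a(3)] by simp
  then have "w = zero_mor W (sh U)"
    using dist_shift_comp_zero[OF AR_dist[OF AR]] comp_zero_right[OF shm_arr[OF r(1)] ob(2)] by simp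
  then show False using AR_nonzero[OF AR] by simp
qed

lemma AR_lift:
  assumes AR: "AR_triangle C U V W u v w" and f: "arr X W f" "\<not> split_epi C X W f"
  obtains g where "arr X V g" "v \<cdot> g = f"
proof -
  have "\<exists>g \<in> mor C X V. f = v \<cdot> g" using AR f by (auto simp: AR_triangle_def arr_def)
  then show ?thesis using that f AR_arr[OF AR] by (auto simp: arr_def)
qed

lemma AR_comp_zero:
  assumes AR: "AR_triangle C U V W u v w" and f: "arr X W f" "\<not> split_epi C X W f"
  shows "w \<cdot> f = zero_mor X (sh U)"
proof -
  note a = AR_arr[OF AR]
  obtain g where g: "arr X V g" "v \<cdot> g = f" using AR_lift[OF AR f] .
  have "w \<cdot> f = (w \<cdot> v) \<cdot> g" using assoc[OF g(1) a(2,3)] g(2) by simp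
  then show ?thesis
    using dist_comp_zero'[OF AR_dist[OF AR]] comp_zero_left[OF g(1)] a(3) by (simp add: arr_def)
qed

text \<open>The shift is only essentially surjective; morphisms are moved to \<open>X'[1]\<close> by
  \<open>\<theta>\<close> and \<open>\<theta>'\<close> before being un-shifted.\<close>

lemma shift_preimage:
  assumes "X \<in> Ob C" obtains X' \<theta> \<theta>' where "X' \<in> Ob C" "arr (sh X') X \<theta>" "arr X (sh X') \<theta>'"
    "\<theta>' \<cdot> \<theta> = ident C (sh X')" "\<theta> \<cdot> \<theta>' = ident C X"
proof -
  obtain X' where X': "X' \<in> Ob C" "isomorphic C (sh X') X" using shift_ess_surj[OF assms] by blast
  show ?thesis using X'(2) by (rule isomorphicE) (use that X'(1) in blast)
qed

text \<open>A radical \<open>a[1]\<close> could fix only the zero morphism.\<close>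

lemma AR_endo:
  assumes AR: "AR_triangle C U V W u v w" and a: "arr U U a" and eq: "shm a \<cdot> w = w"
  shows "isomorphism C U U a"
proof (rule ccontr)
  assume "\<not> isomorphism C U U a"
  then have n: "\<not> isomorphism C (sh U) (sh U) (shm a)" using isomorphism_shift_iff a by blast
  have "local_object (sh U)" using AR_local[OF AR] local_object_shift_iff a by (auto simp: arr_def)
  then have "w = zero_mor W (sh U)"
    using left_zero_of_unit[OF _ shm_arr[OF a] n AR_arr(3)[OF AR]] eq by simp
  then show False using AR_nonzero[OF AR] by simp
qed

text \<open>
  If \<open>f\<close> does not extend along \<open>u\<close>, then \<open>f[1] w \<noteq> 0\<close>. The fibre of \<open>f[1] w\<close> maps to \<open>W\<close> by a morphism
  that is not a split epimorphism, hence is killed by \<open>w\<close>, so \<open>w\<close> factors through \<open>f[1] w\<close>, which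
  makes \<open>f\<close> split.
\<close>

lemma AR_extend:
  assumes AR: "AR_triangle C U V W u v w" and f: "arr U X f" "\<not> split_mono C U X f"
  obtains g where "arr V X g" "g \<cdot> u = f"
proof -
  note a = AR_arr[OF AR]
  have ob: "U \<in> Ob C" "W \<in> Ob C" "X \<in> Ob C" using a f by (auto simp: arr_def)
  define t where "t = shm f \<cdot> w"
  have t: "arr W (sh X) t" unfolding t_def using comp_arr[OF a(3) shm_arr[OF f(1)]] .
  have "t = zero_mor W (sh X)"
  proof (rule ccontr)
    assume nz: "t \<noteq> zero_mor W (sh X)"
    obtain Z b c where d: "dist C W (sh X) Z t b c"
      using dist_exists[of W "sh X" t] t by (auto simp: arr_def)
    note da = dist_arr[OF d]
    have obZ: "Z \<in> Ob C" using da by (auto simp: arr_def)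
    obtain Z' \<theta> \<theta>' where \<theta>: "Z' \<in> Ob C" "arr (sh Z') Z \<theta>" "arr Z (sh Z') \<theta>'"
      "\<theta>' \<cdot> \<theta> = ident C (sh Z')" "\<theta> \<cdot> \<theta>' = ident C Z" using shift_preimage[OF obZ] .
    obtain k where k: "arr Z' W k" "shm k = c \<cdot> \<theta>"
      using shm_surj[OF comp_arr[OF \<theta>(2) da(3)] \<theta>(1) ob(2)] .
    have "shm t \<cdot> (c \<cdot> \<theta>) = zero_mor (sh Z') (sh (sh X))"
      using dist_shift_comp_zero[OF d] assoc[OF \<theta>(2) da(3) shm_arr[OF t]]
        comp_zero_left[OF \<theta>(2), of "sh (sh X)"] shift_ob ob by simp
    then have tk: "t \<cdot> k = zero_mor Z' (sh X)"
      using shm_comp[OF k(1) t] k(2) shm_eq_zero[OF comp_arr[OF k(1) t]] by simp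
    have "\<not> split_epi C Z' W k"
    proof
      assume "split_epi C Z' W k"
      then obtain s where s: "arr W Z' s" "k \<cdot> s = ident C W" using k by (auto simp: split_epi_def arr_def)
      have "t = (t \<cdot> k) \<cdot> s" using assoc[OF s(1) k(1) t] s(2) id_right[OF t] by simp
      then show False using tk comp_zero_left[OF s(1), of "sh X"] shift_ob ob nz by simp
    qed
    then have wk: "w \<cdot> k = zero_mor Z' (sh U)" using AR_comp_zero[OF AR k(1)] by blast
    have "shm w \<cdot> c = shm w \<cdot> ((c \<cdot> \<theta>) \<cdot> \<theta>')"
      using assoc[OF \<theta>(3,2) da(3)] \<theta>(5) id_right[OF da(3)] by simp
    also have "\<dots> = shm (w \<cdot> k) \<cdot> \<theta>'"
      using assoc[OF \<theta>(3) comp_arr[OF \<theta>(2) da(3)] shm_arr[OF a(3)]] shm_comp[OF k(1) a(3)] k(2) by simp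
    also have "\<dots> = zero_mor Z (sh (sh U))"
      using wk shm_zero[OF \<theta>(1) shift_ob[OF ob(1)]] comp_zero_left[OF \<theta>(3)] shift_ob ob by simp
    finally obtain g' where g': "arr (sh X) (sh U) g'" "g' \<cdot> t = w"
      using dist_extend_first[OF d a(3)] by blast
    obtain g where g: "arr X U g" "shm g = g'" using shm_surj[OF g'(1) ob(3,1)] .
    have "shm (g \<cdot> f) \<cdot> w = w"
      using shm_comp[OF f(1) g(1)] g(2) g'(2) assoc[OF a(3) shm_arr[OF f(1)] shm_arr[OF g(1)]]
      by (simp add: t_def)
    then have "isomorphism C U U (g \<cdot> f)" using AR_endo[OF AR comp_arr[OF f(1) g(1)]] by blast
    then show False using split_mono_of_iso_comp[OF f(1) g(1)] f(2) by blast
  qed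
  then obtain g where "arr V X g" "g \<cdot> u = f"
    using dist_extend_first[OF AR_dist[OF AR] f(1)] by (auto simp: t_def)
  then show ?thesis using that by blast
qed

lemma AR_extend_shift_zero:
  assumes AR: "AR_triangle C U V W u v w" and f: "arr U X f" "\<not> split_mono C U X f"
  shows "shm f \<cdot> w = zero_mor W (sh X)"
proof -
  note a = AR_arr[OF AR]
  obtain g where g: "arr V X g" "g \<cdot> u = f" using AR_extend[OF AR f] .
  have "shm f \<cdot> w = shm g \<cdot> (shm u \<cdot> w)"
    using shm_comp[OF a(1) g(1)] g(2) assoc[OF a(3) shm_arr[OF a(1)] shm_arr[OF g(1)]] by simp
  then show ?thesis
    using dist_shift_comp_zero[OF AR_dist[OF AR]] comp_zero_right[OF shm_arr[OF g(1)]] a(3) by (simp add: arr_def)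
qed

text \<open>In the cone of \<open>g\<close>, the morphism \<open>b\<close> out of
  \<open>U[1]\<close> comes from some \<open>k : U \<rightarrow> Q'\<close>. If \<open>k\<close>
  were a split monomorphism, \<open>g\<close> would vanish; so \<open>k\<close> extends over
  \<open>u\<close>, hence \<open>b \<cdot> w = 0\<close>, and \<open>w\<close> lifts along
  \<open>g\<close>. This takes the place of Serre duality.\<close>

lemma AR_serre:
  assumes AR: "AR_triangle C U V W u v w" and g: "arr Y (sh U) g" "g \<noteq> zero_mor Y (sh U)"
  obtains h where "arr W Y h" "g \<cdot> h = w"
proof -
  note a = AR_arr[OF AR]
  have ob: "U \<in> Ob C" "W \<in> Ob C" "Y \<in> Ob C" using a g by (auto simp: arr_def)
  obtain Q b c where d: "dist C Y (sh U) Q g b c" using dist_exists[of Y "sh U" g] g by (auto simp: arr_def)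
  note da = dist_arr[OF d]
  have obQ: "Q \<in> Ob C" using da by (auto simp: arr_def)
  obtain Q' \<theta> \<theta>' where \<theta>: "Q' \<in> Ob C" "arr (sh Q') Q \<theta>" "arr Q (sh Q') \<theta>'"
    "\<theta>' \<cdot> \<theta> = ident C (sh Q')" "\<theta> \<cdot> \<theta>' = ident C Q" using shift_preimage[OF obQ] .
  obtain k where k: "arr U Q' k" "shm k = \<theta>' \<cdot> b"
    using shm_surj[OF comp_arr[OF da(2) \<theta>(3)] ob(1) \<theta>(1)] .
  have kg: "shm k \<cdot> g = zero_mor Y (sh Q')"
    using assoc[OF g(1) da(2) \<theta>(3)] k(2) dist_comp_zero[OF d] comp_zero_right[OF \<theta>(3) ob(3)] by simp
  have "\<not> split_mono C U Q' k"
  proof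
    assume "split_mono C U Q' k"
    then obtain r where r: "arr Q' U r" "r \<cdot> k = ident C U" using k by (auto simp: split_mono_def arr_def)
    have "g = shm r \<cdot> (shm k \<cdot> g)"
      using assoc[OF g(1) shm_arr[OF k(1)] shm_arr[OF r(1)]] shm_comp[OF k(1) r(1)] r(2)
        shift_ident[OF ob(1)] id_left[OF g(1)] by simp
    then show False using kg comp_zero_right[OF shm_arr[OF r(1)] ob(3)] g(2) by simp
  qed
  then have kw: "shm k \<cdot> w = zero_mor W (sh Q')" using AR_extend_shift_zero[OF AR k(1)] by blast
  have "b \<cdot> w = \<theta> \<cdot> ((\<theta>' \<cdot> b) \<cdot> w)"
    using assoc[OF a(3) comp_arr[OF da(2) \<theta>(3)] \<theta>(2)] assoc[OF da(2) \<theta>(3,2)] \<theta>(5) id_left[OF da(2)] by simp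
  then have "b \<cdot> w = zero_mor W Q" using kw k(2) comp_zero_right[OF \<theta>(2) ob(2)] by simp
  then show ?thesis using dist_lift[OF d a(3)] that by blast
qed

lemma split_epi_postcomp_iso:
  assumes "arr X Y f" "arr Y Y' \<phi>" "arr Y' Y \<psi>" "\<psi> \<cdot> \<phi> = ident C Y"
    and split: "split_epi C X Y' (\<phi> \<cdot> f)"
  shows "split_epi C X Y f"
proof -
  obtain s where s: "arr Y' X s" "(\<phi> \<cdot> f) \<cdot> s = ident C Y'"
    using split assms by (auto simp: split_epi_def arr_def)
  have fs: "arr Y X (s \<cdot> \<phi>)" using comp_arr assms s by blast
  have "f \<cdot> (s \<cdot> \<phi>) = \<psi> \<cdot> ((\<phi> \<cdot> f) \<cdot> (s \<cdot> \<phi>))"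
    using assoc[OF fs assms(1,2)] assoc[OF comp_arr[OF fs assms(1)] assms(2,3)] assms(4)
      id_left[OF comp_arr[OF fs assms(1)]] by simp
  also have "\<dots> = ident C Y"
    using assoc[OF assms(2) s(1) comp_arr[OF assms(1,2)]] s(2) id_left[OF assms(2)] assms(4) by simp
  finally show ?thesis using fs assms by (auto simp: split_epi_def arr_def)
qed

lemma split_epi_of_precomp:
  assumes "arr X' X \<theta>" "arr X Y f" "split_epi C X' Y (f \<cdot> \<theta>)"
  shows "split_epi C X Y f"
proof -
  obtain s where s: "arr Y X' s" "(f \<cdot> \<theta>) \<cdot> s = ident C Y"
    using assms by (auto simp: split_epi_def arr_def)
  then have "f \<cdot> (\<theta> \<cdot> s) = ident C Y" "arr Y X (\<theta> \<cdot> s)"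
    using assoc[OF s(1) assms(1,2)] comp_arr[OF s(1) assms(1)] by auto
  then show ?thesis using assms by (auto simp: split_epi_def arr_def)
qed

text \<open>Three rotations shift a triangle and reverse all signs. The lifting property is checked
  on a desuspension of the test object, and the sign of \<open>v\<close> is moved into the
  lift.\<close>

lemma AR_shift:
  assumes AR: "AR_triangle C U V W u v w"
  shows "AR_triangle C (sh U) (sh V) (sh W) (\<ominus>\<^bsub>Hom C (sh U) (sh V)\<^esub> shm u)
    (\<ominus>\<^bsub>Hom C (sh V) (sh W)\<^esub> shm v) (\<ominus>\<^bsub>Hom C (sh W) (sh (sh U))\<^esub> shm w)"
proof -
  note a = AR_arr[OF AR]
  have ob: "U \<in> Ob C" "V \<in> Ob C" "W \<in> Ob C" using a by (auto simp: arr_def)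
  have "shm w \<noteq> zero_mor (sh W) (sh (sh U))" using shm_eq_zero[OF a(3)] AR_nonzero[OF AR] by blast
  then have nz: "\<ominus>\<^bsub>Hom C (sh W) (sh (sh U))\<^esub> shm w \<noteq> zero_mor (sh W) (sh (sh U))"
    using neg_eq_zero_iff[OF shm_arr[OF a(3)]] by simp
  have ind: "indecomposable C (sh U)" "indecomposable C (sh W)"
    using AR indecomposable_shift_iff ob by (auto simp: AR_triangle_def)
  have "\<exists>g \<in> mor C X (sh V). f = (\<ominus>\<^bsub>Hom C (sh V) (sh W)\<^esub> shm v) \<cdot> g"
    if X: "X \<in> Ob C" and fm: "f \<in> mor C X (sh W)" and ns: "\<not> split_epi C X (sh W) f" for X f
  proof -
    have f: "arr X (sh W) f" using X fm shift_ob ob by (simp add: arr_def)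
    obtain X' \<theta> \<theta>' where \<theta>: "X' \<in> Ob C" "arr (sh X') X \<theta>" "arr X (sh X') \<theta>'"
      "\<theta>' \<cdot> \<theta> = ident C (sh X')" "\<theta> \<cdot> \<theta>' = ident C X" using shift_preimage[OF X] .
    obtain f' where f': "arr X' W f'" "shm f' = f \<cdot> \<theta>" using shm_surj[OF comp_arr[OF \<theta>(2) f] \<theta>(1) ob(3)] .
    have "\<not> split_epi C X' W f'"
    proof
      assume "split_epi C X' W f'"
      then obtain s where s: "arr W X' s" "f' \<cdot> s = ident C W" using f' by (auto simp: split_epi_def arr_def)
      then have "shm f' \<cdot> shm s = ident C (sh W)"
        using shm_comp[OF s(1) f'(1)] shift_ident[OF ob(3)] by simp
      then have "split_epi C (sh X') (sh W) (f \<cdot> \<theta>)"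
        using shm_arr[OF s(1)] shm_arr[OF f'(1)] f'(2) by (auto simp: split_epi_def arr_def)
      then show False using split_epi_of_precomp[OF \<theta>(2) f] ns by blast
    qed
    then obtain g where g: "arr X' V g" "v \<cdot> g = f'" using AR_lift[OF AR f'(1)] by blast
    have sg: "arr X (sh V) (shm g \<cdot> \<theta>')" using comp_arr[OF \<theta>(3) shm_arr[OF g(1)]] .
    have "f = (f \<cdot> \<theta>) \<cdot> \<theta>'" using assoc[OF \<theta>(3,2) f] \<theta>(5) id_right[OF f] by simp
    also have "\<dots> = shm v \<cdot> (shm g \<cdot> \<theta>')"
      using f'(2) g(2) shm_comp[OF g(1) a(2)] assoc[OF \<theta>(3) shm_arr[OF g(1)] shm_arr[OF a(2)]] by simp
    also have "\<dots> = (\<ominus>\<^bsub>Hom C (sh V) (sh W)\<^esub> shm v) \<cdot> (\<ominus>\<^bsub>Hom C X (sh V)\<^esub> (shm g \<cdot> \<theta>'))"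
      using comp_neg_left[OF neg_arr[OF sg] shm_arr[OF a(2)]] comp_neg_right[OF shm_arr[OF a(2)] sg]
        neg_neg[OF comp_arr[OF sg shm_arr[OF a(2)]]] by simp
    finally show ?thesis using neg_arr[OF sg] by (auto simp: arr_def)
  qed
  then show ?thesis using dist_shift[OF AR_dist[OF AR]] nz ind unfolding AR_triangle_def by blast
qed

section \<open>Isomorphism invariance and uniqueness of Auslander-Reiten triangles\<close>

lemma AR_iso_third:
  assumes AR: "AR_triangle C U V W u v w" and iso: "isomorphic C W W'"
  obtains v' w' where "AR_triangle C U V W' u v' w'"
proof -
  note a = AR_arr[OF AR]
  have ob: "U \<in> Ob C" "V \<in> Ob C" "W \<in> Ob C" using a by (auto simp: arr_def)
  obtain \<phi> \<psi> where \<phi>: "arr W W' \<phi>" "arr W' W \<psi>" "\<psi> \<cdot> \<phi> = ident C W" "\<phi> \<cdot> \<psi> = ident C W'"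
    "isomorphism C W W' \<phi>" "isomorphism C W' W \<psi>" using iso by (rule isomorphicE)
  have obW': "W' \<in> Ob C" using \<phi> by (auto simp: arr_def)
  have v': "arr V W' (\<phi> \<cdot> v)" using comp_arr a \<phi> by blast
  have w': "arr W' (sh U) (w \<cdot> \<psi>)" using comp_arr a \<phi> by blast
  have w\<psi>\<phi>: "(w \<cdot> \<psi>) \<cdot> \<phi> = w" using assoc[OF \<phi>(1,2) a(3)] \<phi>(3) id_right[OF a(3)] by simp
  have d: "dist C U V W' u (\<phi> \<cdot> v) (w \<cdot> \<psi>)"
  proof (rule dist_iso[OF AR_dist[OF AR] _ isomorphism_ident[OF ob(1)] isomorphism_ident[OF ob(2)] \<phi>(5)])
    show "candidate_triangle C U V W' u (\<phi> \<cdot> v) (w \<cdot> \<psi>)"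
      using a v' w' by (auto simp: candidate_triangle_def arr_def)
    show "ident C V \<cdot> u = u \<cdot> ident C U" using id_left id_right a by metis
    show "\<phi> \<cdot> v = \<phi> \<cdot> v \<cdot> ident C V" using id_right[OF v'] by simp
    show "shm (ident C U) \<cdot> w = w \<cdot> \<psi> \<cdot> \<phi>" using w\<psi>\<phi> shift_ident[OF ob(1)] id_left[OF a(3)] by simp
  qed
  have "w \<cdot> \<psi> \<noteq> zero_mor W' (sh U)"
    using w\<psi>\<phi> comp_zero_left[OF \<phi>(1) shift_ob[OF ob(1)]] AR_nonzero[OF AR] by metis
  moreover have "indecomposable C W'" using AR indecomposable_iso iso by (auto simp: AR_triangle_def)
  moreover have "\<exists>g \<in> mor C X V. f = (\<phi> \<cdot> v) \<cdot> g"
    if X: "X \<in> Ob C" and fm: "f \<in> mor C X W'" and ns: "\<not> split_epi C X W' f" for X f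
  proof -
    have f: "arr X W' f" using X fm obW' by (simp add: arr_def)
    have f': "arr X W (\<psi> \<cdot> f)" using comp_arr[OF f \<phi>(2)] .
    have "\<not> split_epi C X W (\<psi> \<cdot> f)" using split_epi_postcomp_iso[OF f \<phi>(2,1,4)] ns by blast
    then obtain g where g: "arr X V g" "v \<cdot> g = \<psi> \<cdot> f" using AR_lift[OF AR f'] by blast
    have "f = \<phi> \<cdot> (v \<cdot> g)" using g(2) assoc[OF f \<phi>(2,1)] \<phi>(4) id_left[OF f] by simp
    then have "f = (\<phi> \<cdot> v) \<cdot> g" using assoc[OF g(1) a(2) \<phi>(1)] by simp
    then show ?thesis using g(1) by (auto simp: arr_def)
  qed
  ultimately have "AR_triangle C U V W' u (\<phi> \<cdot> v) (w \<cdot> \<psi>)"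
    using d AR unfolding AR_triangle_def by blast
  then show ?thesis using that by blast
qed

lemma AR_iso_first:
  assumes AR: "AR_triangle C U V W u v w" and iso: "isomorphic C U U'"
  obtains u' w' where "AR_triangle C U' V W u' v w'"
proof -
  note a = AR_arr[OF AR]
  have ob: "U \<in> Ob C" "V \<in> Ob C" "W \<in> Ob C" using a by (auto simp: arr_def)
  obtain \<phi> \<psi> where \<phi>: "arr U U' \<phi>" "arr U' U \<psi>" "\<psi> \<cdot> \<phi> = ident C U" "\<phi> \<cdot> \<psi> = ident C U'"
    "isomorphism C U U' \<phi>" "isomorphism C U' U \<psi>" using iso by (rule isomorphicE)
  have u': "arr U' V (u \<cdot> \<psi>)" using comp_arr a \<phi> by blast
  have w': "arr W (sh U') (shm \<phi> \<cdot> w)" using comp_arr[OF a(3) shm_arr[OF \<phi>(1)]] .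
  have d: "dist C U' V W (u \<cdot> \<psi>) v (shm \<phi> \<cdot> w)"
  proof (rule dist_iso[OF AR_dist[OF AR] _ \<phi>(5) isomorphism_ident[OF ob(2)] isomorphism_ident[OF ob(3)]])
    show "candidate_triangle C U' V W (u \<cdot> \<psi>) v (shm \<phi> \<cdot> w)"
      using a u' w' by (auto simp: candidate_triangle_def arr_def)
    show "ident C V \<cdot> u = u \<cdot> \<psi> \<cdot> \<phi>" using assoc[OF \<phi>(1,2) a(1)] \<phi>(3) id_right[OF a(1)] id_left[OF a(1)] by simp
    show "ident C W \<cdot> v = v \<cdot> ident C V" using id_right[OF a(2)] id_left[OF a(2)] by simp
    show "shm \<phi> \<cdot> w = shm \<phi> \<cdot> w \<cdot> ident C W" using id_right[OF w'] by simp
  qed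
  have "w = shm \<psi> \<cdot> (shm \<phi> \<cdot> w)"
    using assoc[OF a(3) shm_arr[OF \<phi>(1)] shm_arr[OF \<phi>(2)]] shm_comp[OF \<phi>(1,2)] \<phi>(3) shift_ident[OF ob(1)]
      id_left[OF a(3)] by simp
  then have "shm \<phi> \<cdot> w \<noteq> zero_mor W (sh U')"
    using comp_zero_right[OF shm_arr[OF \<phi>(2)] ob(3)] AR_nonzero[OF AR] by metis
  moreover have "indecomposable C U'" using AR indecomposable_iso iso by (auto simp: AR_triangle_def)
  ultimately have "AR_triangle C U' V W (u \<cdot> \<psi>) v (shm \<phi> \<cdot> w)"
    using d AR unfolding AR_triangle_def by blast
  then show ?thesis using that by blast
qed

text \<open>The component on \<open>W\<close> is the identity. A diagram chase shows that \<phi> has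
  no kernel; a right inverse is then built by lifting \<open>v'\<close> along \<open>v\<close> and
  correcting the error, which comes from \<open>U'\<close>, by means of the inverse of
  \<open>g\<close>.\<close>

lemma dist_five_lemma:
  assumes d: "dist C U V W u v w" and d': "dist C U' V' W u' v' w'"
    and \<phi>: "arr V V' \<phi>" "v' \<cdot> \<phi> = v" and g: "isomorphism C U U' g" "arr U U' g" "\<phi> \<cdot> u = u' \<cdot> g" "shm g \<cdot> w = w'"
  shows "isomorphism C V V' \<phi>"
proof -
  note a = dist_arr[OF d] and a' = dist_arr[OF d']
  have ob: "U \<in> Ob C" "V \<in> Ob C" "W \<in> Ob C" "U' \<in> Ob C" "V' \<in> Ob C" using a a' by (auto simp: arr_def)
  obtain h where h: "arr U' U h" "g \<cdot> h = ident C U'" using isomorphismE[OF g(1) ob(1,4)] by metis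
  have sg: "isomorphism C (sh U) (sh U') (shm g)" using isomorphism_shift_iff[OF g(2)] g(1) by simp
  have mono: "f = zero_mor M V" if f: "arr M V f" "\<phi> \<cdot> f = zero_mor M V'" for M f
  proof -
    have obM: "M \<in> Ob C" using f by (auto simp: arr_def)
    have "v \<cdot> f = v' \<cdot> (\<phi> \<cdot> f)" using assoc[OF f(1) \<phi>(1) a'(2)] \<phi>(2) by simp
    then have "v \<cdot> f = zero_mor M W" using f(2) comp_zero_right[OF a'(2) obM] by simp
    then obtain k where k: "arr M U k" "u \<cdot> k = f" using dist_lift[OF d f(1)] by blast
    have gk: "arr M U' (g \<cdot> k)" using comp_arr k(1) g(2) by blast
    have "u' \<cdot> (g \<cdot> k) = zero_mor M V'"
      using assoc[OF k(1) g(2) a'(1)] assoc[OF k(1) a(1) \<phi>(1)] g(3) k(2) f(2) by simp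
    then obtain l where l: "arr (sh M) W l" "w' \<cdot> l = shm (g \<cdot> k)" using dist_lift_third[OF d' gk] by blast
    have "shm g \<cdot> (w \<cdot> l) = shm g \<cdot> shm k"
      using l(2) g(4) assoc[OF l(1) a(3) shm_arr[OF g(2)]] shm_comp[OF k(1) g(2)] by simp
    then have "w \<cdot> l = shm k"
      using iso_cancel_left[OF sg comp_arr[OF l(1) a(3)] shm_arr[OF k(1)]] shift_ob ob by blast
    then have "shm (u \<cdot> k) = (shm u \<cdot> w) \<cdot> l"
      using shm_comp[OF k(1) a(1)] assoc[OF l(1) a(3) shm_arr[OF a(1)]] by simp
    then have "shm (u \<cdot> k) = zero_mor (sh M) (sh V)"
      using dist_shift_comp_zero[OF d] comp_zero_left[OF l(1)] shift_ob ob by simp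
    then show ?thesis using shm_eq_zero[OF comp_arr[OF k(1) a(1)]] k(2) by simp
  qed
  have wv: "arr V' (sh U) (w \<cdot> v')" using comp_arr[OF a'(2) a(3)] .
  have "shm g \<cdot> (w \<cdot> v') = shm g \<cdot> zero_mor V' (sh U)"
    using assoc[OF a'(2) a(3) shm_arr[OF g(2)]] g(4) dist_comp_zero'[OF d'] comp_zero_right[OF shm_arr[OF g(2)] ob(5)]
    by simp
  then have "w \<cdot> v' = zero_mor V' (sh U)"
    using iso_cancel_left[OF sg wv zero_arr] shift_ob ob by blast
  then obtain s where s: "arr V' V s" "v \<cdot> s = v'" using dist_lift'[OF d a'(2)] by blast
  have \<phi>s: "arr V' V' (\<phi> \<cdot> s)" using comp_arr s \<phi> by blast
  have "v' \<cdot> diff_mor V' V' (ident C V') (\<phi> \<cdot> s) = zero_mor V' W"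
    using comp_diff_right[OF a'(2) ident_arr[OF ob(5)] \<phi>s] id_right[OF a'(2)] assoc[OF s(1) \<phi>(1) a'(2)] \<phi>(2) s(2)
      diff_eq_zero_iff[OF a'(2) a'(2)] by simp
  then obtain k where k: "arr V' U' k" "u' \<cdot> k = diff_mor V' V' (ident C V') (\<phi> \<cdot> s)"
    using dist_lift[OF d' diff_arr[OF ident_arr[OF ob(5)] \<phi>s]] by blast
  have uhk: "arr V' V (u \<cdot> (h \<cdot> k))" using comp_arr[OF comp_arr[OF k(1) h(1)] a(1)] .
  define r where "r = add_mor V' V s (u \<cdot> (h \<cdot> k))"
  have r: "arr V' V r" unfolding r_def using add_arr s uhk by blast
  have "\<phi> \<cdot> (u \<cdot> (h \<cdot> k)) = u' \<cdot> (g \<cdot> (h \<cdot> k))"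
    using assoc[OF comp_arr[OF k(1) h(1)] a(1) \<phi>(1)] g(3) assoc[OF comp_arr[OF k(1) h(1)] g(2) a'(1)] by simp
  also have "g \<cdot> (h \<cdot> k) = k" using assoc[OF k(1) h(1) g(2)] h(2) id_left[OF k(1)] by simp
  finally have \<phi>r: "\<phi> \<cdot> r = ident C V'"
    using comp_add_right[OF \<phi>(1) s(1) uhk] k(2) add_diff_mor(1)[OF \<phi>s ident_arr[OF ob(5)]] by (simp add: r_def)
  have r\<phi>: "arr V V (r \<cdot> \<phi>)" using comp_arr r \<phi> by blast
  have "\<phi> \<cdot> diff_mor V V (r \<cdot> \<phi>) (ident C V) = zero_mor V V'"
    using comp_diff_right[OF \<phi>(1) r\<phi> ident_arr[OF ob(2)]] assoc[OF \<phi>(1) r \<phi>(1)] \<phi>r id_left[OF \<phi>(1)]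
      id_right[OF \<phi>(1)] diff_eq_zero_iff[OF \<phi>(1) \<phi>(1)] by simp
  then have "r \<cdot> \<phi> = ident C V"
    using mono[OF diff_arr[OF r\<phi> ident_arr[OF ob(2)]]] diff_eq_zero_iff[OF r\<phi> ident_arr[OF ob(2)]] by simp
  then show ?thesis using isomorphismI \<phi>(1) r \<phi>r by blast
qed

text \<open>As \<open>v\<close> is not a split epimorphism, it factors through \<open>v'\<close>.
  After rotation the resulting square, with the identity of \<open>W\<close>, sits in the first two
  places, so the axiom on morphisms of triangles supplies the component on
  \<open>U[1]\<close>.\<close>

lemma AR_morphism:
  assumes AR: "AR_triangle C U V W u v w" and AR': "AR_triangle C U' V' W u' v' w'"
  obtains \<phi> g where "arr V V' \<phi>" "v' \<cdot> \<phi> = v" "arr U U' g" "\<phi> \<cdot> u = u' \<cdot> g" "shm g \<cdot> w = w'"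
proof -
  note a = AR_arr[OF AR] and a' = AR_arr[OF AR']
  have ob: "U \<in> Ob C" "V \<in> Ob C" "W \<in> Ob C" "U' \<in> Ob C" "V' \<in> Ob C" using a a' by (auto simp: arr_def)
  obtain \<phi> where \<phi>: "arr V V' \<phi>" "v' \<cdot> \<phi> = v" using AR_lift[OF AR' a(2) AR_not_split_epi[OF AR]] .
  have "ident C W \<cdot> v = v' \<cdot> \<phi>" using \<phi>(2) id_left[OF a(2)] by simp
  then obtain h where h: "h \<in> mor C (sh U) (sh U')" "h \<cdot> w = w' \<cdot> ident C W"
    "shm \<phi> \<cdot> (\<ominus>\<^bsub>Hom C (sh U) (sh V)\<^esub> shm u) = (\<ominus>\<^bsub>Hom C (sh U') (sh V')\<^esub> shm u') \<cdot> h"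
    using dist_morphism[OF dist_rotate'[OF AR_dist[OF AR]] dist_rotate'[OF AR_dist[OF AR']], of \<phi> "ident C W"]
      \<phi>(1) ident_arr[OF ob(3)] by (auto simp: arr_def)
  have h': "arr (sh U) (sh U') h" using h(1) shift_ob ob by (simp add: arr_def)
  obtain g where g: "arr U U' g" "shm g = h" using shm_surj[OF h' ob(1,4)] .
  have "\<ominus>\<^bsub>Hom C (sh U) (sh V')\<^esub> shm (\<phi> \<cdot> u) = \<ominus>\<^bsub>Hom C (sh U) (sh V')\<^esub> shm (u' \<cdot> g)"
    using h(3) comp_neg_right[OF shm_arr[OF \<phi>(1)] shm_arr[OF a(1)]] comp_neg_left[OF h' shm_arr[OF a'(1)]]
      shm_comp[OF a(1) \<phi>(1)] shm_comp[OF g(1) a'(1)] g(2) by simp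
  then have "shm (\<phi> \<cdot> u) = shm (u' \<cdot> g)"
    using neg_inject shm_arr[OF comp_arr[OF a(1) \<phi>(1)]] shm_arr[OF comp_arr[OF g(1) a'(1)]] by blast
  then have "\<phi> \<cdot> u = u' \<cdot> g" using shm_inject comp_arr[OF a(1) \<phi>(1)] comp_arr[OF g(1) a'(1)] by blast
  moreover have "shm g \<cdot> w = w'" using h(2) g(2) id_right[OF a'(3)] by simp
  ultimately show ?thesis using that \<phi> g by blast
qed

text \<open>The comparison morphisms in both directions compose to an endomorphism of
  \<open>U\<close> fixing \<open>w\<close>, an isomorphism by \<open>AR_endo\<close>; between local
  objects \<open>g\<close> is then itself invertible.\<close>

lemma AR_unique:
  assumes AR: "AR_triangle C U V W u v w" and AR': "AR_triangle C U' V' W' u' v' w'" and iso: "isomorphic C W W'"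
  shows "isomorphic C U U'" "isomorphic C V V'"
proof -
  obtain v'' w'' where AR'': "AR_triangle C U' V' W u' v'' w''"
    using AR_iso_third[OF AR' isomorphic_sym[OF iso]] .
  note a = AR_arr[OF AR] and a' = AR_arr[OF AR'']
  have ob: "U \<in> Ob C" "V \<in> Ob C" "U' \<in> Ob C" "V' \<in> Ob C" using a a' by (auto simp: arr_def)
  obtain \<phi> g where \<phi>: "arr V V' \<phi>" "v'' \<cdot> \<phi> = v" and g: "arr U U' g" "\<phi> \<cdot> u = u' \<cdot> g" "shm g \<cdot> w = w''"
    using AR_morphism[OF AR AR''] .
  obtain \<phi>' g' where g': "arr U' U g'" "shm g' \<cdot> w'' = w" using AR_morphism[OF AR'' AR] .
  have "shm (g' \<cdot> g) \<cdot> w = w"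
    using shm_comp[OF g(1) g'(1)] assoc[OF a(3) shm_arr[OF g(1)] shm_arr[OF g'(1)]] g(3) g'(2) by simp
  then have "split_mono C U U' g"
    using split_mono_of_iso_comp[OF g(1) g'(1)] AR_endo[OF AR comp_arr[OF g(1) g'(1)]] by blast
  then have isog: "isomorphism C U U' g"
    using split_mono_iso[OF g(1)] AR_local[OF AR] AR_local[OF AR''] local_objectD by blast
  then show "isomorphic C U U'" using isomorphicI ob by blast
  show "isomorphic C V V'"
    using dist_five_lemma[OF AR_dist[OF AR] AR_dist[OF AR''] \<phi> isog g] isomorphicI ob by blast
qed

text \<open>The identity of \<open>X\<close> is the sum of the endomorphisms
  \<open>r \<cdot> ((i j \<cdot> p j) \<cdot> f)\<close>; by locality one of them is invertible, so
  that \<open>p j \<cdot> f\<close> is a split monomorphism between local objects.\<close>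

lemma summand_of_split_mono:
  assumes b: "biproduct M Ys i p" and loc: "\<And>Y. Y \<in> set Ys \<Longrightarrow> local_object Y" and X: "local_object X"
    and f: "arr X M f" "split_mono C X M f"
  shows "\<exists>j < length Ys. isomorphic C X (Ys ! j)"
proof -
  obtain r where r: "arr M X r" "r \<cdot> f = ident C X" using f by (auto simp: split_mono_def arr_def)
  have ob: "X \<in> Ob C" "M \<in> Ob C" using f by (auto simp: arr_def)
  have arrs: "arr (Ys ! j) M (i j)" "arr M (Ys ! j) (p j)" if "j < length Ys" for j
    using b that by (auto simp: biproduct_def)
  have ip: "arr M M (i j \<cdot> p j)" if "j < length Ys" for j using arrs[OF that] comp_arr by blast
  have ipf: "arr X M ((i j \<cdot> p j) \<cdot> f)" if "j < length Ys" for j using ip[OF that] f comp_arr by blast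
  have "r \<cdot> ((\<Oplus>\<^bsub>Hom C M M\<^esub> j \<in> {..<length Ys}. i j \<cdot> p j) \<cdot> f) =
    r \<cdot> (\<Oplus>\<^bsub>Hom C X M\<^esub> j \<in> {..<length Ys}. (i j \<cdot> p j) \<cdot> f)"
    using comp_finsum_left[OF _ f(1) ob(2), of "{..<length Ys}" "\<lambda>j. i j \<cdot> p j"] ip by simp
  also have "\<dots> = (\<Oplus>\<^bsub>Hom C X X\<^esub> j \<in> {..<length Ys}. r \<cdot> ((i j \<cdot> p j) \<cdot> f))"
    using comp_finsum_right[OF _ r(1) ob(1), of "{..<length Ys}" "\<lambda>j. (i j \<cdot> p j) \<cdot> f"] ipf by simp
  finally have "isomorphism C X X (\<Oplus>\<^bsub>Hom C X X\<^esub> j \<in> {..<length Ys}. r \<cdot> ((i j \<cdot> p j) \<cdot> f))"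
    using b id_left[OF f(1)] r(2) isomorphism_ident[OF ob(1)] by (simp add: biproduct_def)
  then obtain j where j: "j < length Ys" "isomorphism C X X (r \<cdot> ((i j \<cdot> p j) \<cdot> f))"
    using iso_of_finsum[OF X, of "{..<length Ys}" "\<lambda>j. r \<cdot> ((i j \<cdot> p j) \<cdot> f)"] comp_arr[OF ipf r(1)] by auto
  have pf: "arr X (Ys ! j) (p j \<cdot> f)" using comp_arr f arrs[OF j(1)] by blast
  have "r \<cdot> ((i j \<cdot> p j) \<cdot> f) = (r \<cdot> i j) \<cdot> (p j \<cdot> f)"
    using assoc[OF f(1) arrs(2,1)[OF j(1)]] assoc[OF pf arrs(1)[OF j(1)] r(1)] by simp
  then have "split_mono C X (Ys ! j) (p j \<cdot> f)"
    using split_mono_of_iso_comp[OF pf comp_arr[OF arrs(1)[OF j(1)] r(1)]] j(2) by simp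
  then have "isomorphism C X (Ys ! j) (p j \<cdot> f)"
    using split_mono_iso[OF pf] local_objectD[OF X] loc j(1) by simp
  then show ?thesis using j(1) isomorphicI pf by (auto simp: arr_def)
qed

text \<open>\<open>f\<close> lifts to some \<open>g\<close> with \<open>f = v \<cdot> g\<close>.
  Since \<open>v\<close> is not a split epimorphism, irreducibility makes \<open>g\<close> a split
  monomorphism.\<close>

lemma AR_summand_of_irreducible:
  assumes AR: "AR_triangle C U V W u v w" and b: "biproduct V Ys i p"
    and ind: "\<And>Y. Y \<in> set Ys \<Longrightarrow> indecomposable C Y" and X: "indecomposable C X"
    and f: "irreducible_mor C X W f"
  shows "\<exists>j < length Ys. isomorphic C X (Ys ! j)"
proof -
  note a = AR_arr[OF AR]
  have fa: "arr X W f" and ns: "\<not> split_epi C X W f" using f by (auto simp: irreducible_mor_def arr_def)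
  obtain g where g: "arr X V g" "v \<cdot> g = f" using AR_lift[OF AR fa ns] .
  then have "split_mono C X V g"
    using f AR_not_split_epi[OF AR] a(2) by (auto simp: irreducible_mor_def arr_def)
  then show ?thesis
    using summand_of_split_mono[OF b _ _ g(1)] ind X indecomposable_iff_local by blast
qed

text \<open>If \<open>v \<cdot> i j = h \<cdot> k\<close> and \<open>h\<close> is not a split
  epimorphism, then \<open>h\<close> lifts to some \<open>l\<close> into \<open>V\<close>, and the
  error \<open>i j - l \<cdot> k\<close> comes from \<open>U\<close>. Projecting to the summand
  writes the identity as a sum of an endomorphism through \<open>k\<close> and one through
  \<open>u\<close>. By locality \<open>k\<close> or \<open>u\<close> is a split monomorphism, and
  the latter is excluded.\<close>

lemma AR_irreducible_right:
  assumes AR: "AR_triangle C U V W u v w" and b: "biproduct V Ys i p" and j: "j < length Ys"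
    and ind: "indecomposable C (Ys ! j)"
  shows "irreducible_mor C (Ys ! j) W (v \<cdot> i j)"
proof -
  note a = AR_arr[OF AR]
  let ?X = "Ys ! j"
  have ij: "arr ?X V (i j)" and pj: "arr V ?X (p j)" and pi: "p j \<cdot> i j = ident C ?X"
    using b j by (auto simp: biproduct_def)
  have ob: "?X \<in> Ob C" "W \<in> Ob C" using ij a by (auto simp: arr_def)
  have X: "local_object ?X" using ind indecomposable_iff_local by simp
  have f: "arr ?X W (v \<cdot> i j)" using comp_arr[OF ij a(2)] .
  have ne: "\<not> split_epi C ?X W (v \<cdot> i j)" using split_epi_of_precomp[OF ij a(2)] AR_not_split_epi[OF AR] by blast
  have nm: "\<not> split_mono C ?X W (v \<cdot> i j)"
    using split_mono_iso[OF f _ local_objectD(2)[OF X]] AR_local[OF AR] ne isomorphism_split ob by blast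
  have "split_mono C ?X Z k \<or> split_epi C Z W h"
    if Z: "Z \<in> Ob C" and k: "k \<in> mor C ?X Z" and h: "h \<in> mor C Z W" and eq: "v \<cdot> i j = h \<cdot> k" for Z k h
  proof (rule ccontr)
    assume n: "\<not> ?thesis"
    have ka: "arr ?X Z k" and ha: "arr Z W h" using Z k h ob by (auto simp: arr_def)
    obtain l where l: "arr Z V l" "v \<cdot> l = h" using AR_lift[OF AR ha] n by blast
    have lk: "arr ?X V (l \<cdot> k)" using comp_arr ka l by blast
    have "v \<cdot> diff_mor ?X V (i j) (l \<cdot> k) = zero_mor ?X W"
      using comp_diff_right[OF a(2) ij lk] assoc[OF ka l(1) a(2)] l(2) eq diff_eq_zero_iff[OF f f] by simp
    then obtain m where m: "arr ?X U m" "u \<cdot> m = diff_mor ?X V (i j) (l \<cdot> k)"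
      using dist_lift[OF AR_dist[OF AR] diff_arr[OF ij lk]] by blast
    have pu: "arr U ?X (p j \<cdot> u)" using comp_arr a pj by blast
    have pum: "arr ?X ?X ((p j \<cdot> u) \<cdot> m)" using comp_arr[OF m(1) pu] .
    have pl: "arr Z ?X (p j \<cdot> l)" using comp_arr[OF l(1) pj] .
    have plk: "arr ?X ?X ((p j \<cdot> l) \<cdot> k)" using comp_arr[OF ka pl] .
    have "(p j \<cdot> u) \<cdot> m = diff_mor ?X ?X (ident C ?X) ((p j \<cdot> l) \<cdot> k)"
      using assoc[OF m(1) a(1) pj] m(2) comp_diff_right[OF pj ij lk] pi assoc[OF ka l(1) pj] by simp
    then consider "isomorphism C ?X ?X ((p j \<cdot> l) \<cdot> k)" | "isomorphism C ?X ?X ((p j \<cdot> u) \<cdot> m)"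
      using local_object_cases[OF X plk] by metis
    then show False
    proof cases
      case 1
      then show False using split_mono_of_iso_comp[OF ka pl] n by blast
    next
      case 2
      then have "split_epi C U ?X (p j \<cdot> u)" using split_epi_of_iso_comp[OF pu m(1)] by blast
      then have "isomorphism C U ?X (p j \<cdot> u)"
        using split_epi_iso[OF pu _ local_objectD(2)[OF X]] AR_local[OF AR] by blast
      then obtain q where q: "arr ?X U q" "q \<cdot> (p j \<cdot> u) = ident C U"
        using isomorphismE[of U ?X "p j \<cdot> u"] ob a(1) by (auto simp: arr_def)
      then have "(q \<cdot> p j) \<cdot> u = ident C U" "arr V U (q \<cdot> p j)"
        using assoc[OF a(1) pj q(1)] comp_arr[OF pj q(1)] by auto
      then show False using AR_not_split_mono[OF AR] a(1) by (auto simp: split_mono_def arr_def)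
    qed
  qed
  then show ?thesis using ne nm f by (auto simp: irreducible_mor_def arr_def)
qed

text \<open>The dual argument, with \<open>AR_extend\<close> in place of the defining lifting
  property; the error \<open>p j - h \<cdot> l\<close> now factors through \<open>W\<close>.\<close>

lemma AR_irreducible_left:
  assumes AR: "AR_triangle C U V W u v w" and b: "biproduct V Ys i p" and j: "j < length Ys"
    and ind: "indecomposable C (Ys ! j)"
  shows "irreducible_mor C U (Ys ! j) (p j \<cdot> u)"
proof -
  note a = AR_arr[OF AR]
  let ?X = "Ys ! j"
  have ij: "arr ?X V (i j)" and pj: "arr V ?X (p j)" and pi: "p j \<cdot> i j = ident C ?X"
    using b j by (auto simp: biproduct_def)
  have ob: "?X \<in> Ob C" "U \<in> Ob C" using ij a by (auto simp: arr_def)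
  have X: "local_object ?X" using ind indecomposable_iff_local by simp
  have f: "arr U ?X (p j \<cdot> u)" using comp_arr[OF a(1) pj] .
  have nm: "\<not> split_mono C U ?X (p j \<cdot> u)"
  proof
    assume "split_mono C U ?X (p j \<cdot> u)"
    then obtain q where q: "arr ?X U q" "q \<cdot> (p j \<cdot> u) = ident C U" using f by (auto simp: split_mono_def arr_def)
    then have "(q \<cdot> p j) \<cdot> u = ident C U" "arr V U (q \<cdot> p j)"
      using assoc[OF a(1) pj q(1)] comp_arr[OF pj q(1)] by auto
    then show False using AR_not_split_mono[OF AR] a(1) by (auto simp: split_mono_def arr_def)
  qed
  have ne: "\<not> split_epi C U ?X (p j \<cdot> u)"
    using split_epi_iso[OF f _ local_objectD(2)[OF X]] AR_local[OF AR] nm isomorphism_split ob by blast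
  have "split_mono C U Z k \<or> split_epi C Z ?X h"
    if Z: "Z \<in> Ob C" and k: "k \<in> mor C U Z" and h: "h \<in> mor C Z ?X" and eq: "p j \<cdot> u = h \<cdot> k" for Z k h
  proof (rule ccontr)
    assume n: "\<not> ?thesis"
    have ka: "arr U Z k" and ha: "arr Z ?X h" using Z k h ob by (auto simp: arr_def)
    obtain l where l: "arr V Z l" "l \<cdot> u = k" using AR_extend[OF AR ka] n by blast
    have hl: "arr V ?X (h \<cdot> l)" using comp_arr ha l by blast
    have "diff_mor V ?X (p j) (h \<cdot> l) \<cdot> u = zero_mor U ?X"
      using comp_diff_left[OF a(1) pj hl] assoc[OF a(1) l(1) ha] l(2) eq diff_eq_zero_iff[OF f f] by simp
    then obtain m where m: "arr W ?X m" "m \<cdot> v = diff_mor V ?X (p j) (h \<cdot> l)"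
      using dist_extend[OF AR_dist[OF AR] diff_arr[OF pj hl]] by blast
    have vi: "arr ?X W (v \<cdot> i j)" using comp_arr a ij by blast
    have li: "arr ?X Z (l \<cdot> i j)" using comp_arr[OF ij l(1)] .
    have hli: "arr ?X ?X (h \<cdot> (l \<cdot> i j))" using comp_arr[OF li ha] .
    have "m \<cdot> (v \<cdot> i j) = diff_mor ?X ?X (ident C ?X) (h \<cdot> (l \<cdot> i j))"
      using assoc[OF ij a(2) m(1)] m(2) comp_diff_left[OF ij pj hl] pi assoc[OF ij l(1) ha] by simp
    then consider "isomorphism C ?X ?X (h \<cdot> (l \<cdot> i j))" | "isomorphism C ?X ?X (m \<cdot> (v \<cdot> i j))"
      using local_object_cases[OF X hli] by metis
    then show False
    proof cases
      case 1
      then show False using split_epi_of_iso_comp[OF ha li] n by blast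
    next
      case 2
      then have "split_mono C ?X W (v \<cdot> i j)" using split_mono_of_iso_comp[OF vi m(1)] by blast
      then have "isomorphism C ?X W (v \<cdot> i j)"
        using split_mono_iso[OF vi _ local_objectD(2)[OF X]] AR_local[OF AR] by blast
      then have "split_epi C ?X W (v \<cdot> i j)" using isomorphism_split a(2) ob by (auto simp: arr_def)
      then show False using split_epi_of_precomp[OF ij a(2)] AR_not_split_epi[OF AR] by blast
    qed
  qed
  then show ?thesis using ne nm f by (auto simp: irreducible_mor_def arr_def)
qed

end

section \<open>Dimensions of morphism spaces\<close>

context krull_schmidt_triangulated
begin

abbreviation hom_dim :: "'o \<Rightarrow> 'o \<Rightarrow> nat" where
  "hom_dim X Y \<equiv> vectorspace.dim K (Hom C X Y)"

lemma fin_dim_indecomposable: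
  "indecomposable C X \<Longrightarrow> indecomposable C Y \<Longrightarrow> vectorspace.fin_dim K (Hom C X Y)"
  using hom_fin by (simp add: hom_finite_def)

lemma hom_direct_sum:
  assumes M: "indecomposable C M" and X: "direct_sum C X Ys"
    and ind: "\<And>Y. Y \<in> set Ys \<Longrightarrow> indecomposable C Y"
  shows "vectorspace.fin_dim K (Hom C M X) \<and> hom_dim M X = (\<Sum>j<length Ys. hom_dim M (Ys ! j))"
proof -
  obtain i p where b: "biproduct X Ys i p" using X by (auto simp: direct_sum_iff)
  have ob: "M \<in> Ob C" "X \<in> Ob C" using M indecomposable_ob b by (auto simp: biproduct_def)
  have arrs: "arr (Ys ! j) X (i j)" "arr X (Ys ! j) (p j)" and obY: "Ys ! j \<in> Ob C" if "j < length Ys" for j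
    using b that by (auto simp: biproduct_def)
  show ?thesis
  proof (rule dim_direct_sum[where P = "\<lambda>j f. p j \<cdot> f"])
    fix j assume j: "j < length Ys"
    show "vectorspace K (Hom C M (Ys ! j))" using vectorspace_Hom ob obY[OF j] by blast
    show "vectorspace.fin_dim K (Hom C M (Ys ! j))" using fin_dim_indecomposable M ind j by simp
    show "(\<lambda>f. p j \<cdot> f) \<in> module_hom K (Hom C M X) (Hom C M (Ys ! j))"
      using comp_linear_right ob obY[OF j] arrs[OF j] by (auto simp: arr_def)
    fix g assume "g \<in> mor C M (Ys ! j)"
    then have g: "arr M (Ys ! j) g" using ob obY[OF j] by (simp add: arr_def)
    have "p l \<cdot> (i j \<cdot> g) = (if l = j then g else zero_mor M (Ys ! l))" if l: "l < length Ys" for l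
      using assoc[OF g arrs(1)[OF j] arrs(2)[OF l]] b j l id_left[OF g] comp_zero_left[OF g obY[OF l]]
      by (auto simp: biproduct_def)
    then show "\<exists>f\<in>mor C M X. p j \<cdot> f = g \<and> (\<forall>l<length Ys. l \<noteq> j \<longrightarrow> p l \<cdot> f = zero_mor M (Ys ! l))"
      using comp_arr[OF g arrs(1)[OF j]] j by (intro bexI[of _ "i j \<cdot> g"]) (auto simp: arr_def)
  next
    fix f assume "f \<in> mor C M X" "\<And>j. j < length Ys \<Longrightarrow> p j \<cdot> f = zero_mor M (Ys ! j)"
    then show "f = zero_mor M X" using biproduct_jointly_mono[OF b] ob by (simp add: arr_def)
  qed (rule vectorspace_Hom[OF ob])
qed

lemma fin_dim_Hom:
  assumes "indecomposable C M" "X \<in> Ob C" shows "vectorspace.fin_dim K (Hom C M X)"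
proof -
  obtain Ys where "direct_sum C X Ys" "\<forall>Y \<in> set Ys. indecomposable C Y"
    using decomposition[OF assms(2)] .
  then show ?thesis using hom_direct_sum[OF assms(1)] by blast
qed

lemma hom_dim_iso:
  assumes "indecomposable C M" "indecomposable C X" "isomorphic C X Y"
  shows "hom_dim M Y = hom_dim M X"
  using hom_direct_sum[OF assms(1) direct_sum_single[OF isomorphic_sym[OF assms(3)]]] assms(2) by simp

lemma hom_dim_zero_iff:
  assumes "indecomposable C M" "X \<in> Ob C"
  shows "hom_dim M X = 0 \<longleftrightarrow> \<not> nonzero_hom C M X"
proof -
  interpret vectorspace K "Hom C M X" using assms indecomposable_ob vectorspace_Hom by blast
  have "dim = 0" if "carrier (Hom C M X) = {\<zero>\<^bsub>Hom C M X\<^esub>}"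
    using that dim0I span_zero span_closed by (metis span_empty already_in_span empty_subsetI Un_empty_left)
  moreover have "\<zero>\<^bsub>Hom C M X\<^esub> \<in> carrier (Hom C M X)" by simp
  ultimately show ?thesis
    using carrier_of_dim_zero[OF fin_dim_Hom[OF assms]] by (auto simp: nonzero_hom_def)
qed

text \<open>Apply \<open>Hom(M, -)\<close>. Exactness on the right can fail only through split
  epimorphisms \<open>M \<rightarrow> W\<close>; exactness on the left only through split
  epimorphisms \<open>M[1] \<rightarrow> W\<close>, as a kernel element, shifted, is such a morphism
  followed by \<open>w\<close>. These are the two excluded isomorphisms.\<close>

lemma AR_hom_dim:
  assumes AR: "AR_triangle C U V W u v w" and M: "indecomposable C M"
    and W: "\<not> isomorphic C M W" "\<not> isomorphic C (sh M) W"
  shows "hom_dim M V = hom_dim M U + hom_dim M W"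
proof (rule dim_short_exact[where S = "\<lambda>f. u \<cdot> f" and T = "\<lambda>f. v \<cdot> f"])
  note a = AR_arr[OF AR]
  have ob: "U \<in> Ob C" "V \<in> Ob C" "W \<in> Ob C" "M \<in> Ob C" using a M indecomposable_ob by (auto simp: arr_def)
  show "vectorspace K (Hom C M U)" "vectorspace K (Hom C M V)" "vectorspace K (Hom C M W)"
    using vectorspace_Hom ob by blast+
  show "vectorspace.fin_dim K (Hom C M V)" "vectorspace.fin_dim K (Hom C M U)"
    using fin_dim_Hom M ob by blast+
  show "(\<lambda>f. u \<cdot> f) \<in> module_hom K (Hom C M U) (Hom C M V)" "(\<lambda>f. v \<cdot> f) \<in> module_hom K (Hom C M V) (Hom C M W)"
    using comp_linear_right ob a by (auto simp: arr_def)
  have no_split: "\<not> split_epi C N W f" if N: "indecomposable C N" "\<not> isomorphic C N W" and f: "arr N W f" for N f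
    using split_epi_iso[OF f] N AR_local[OF AR] local_objectD indecomposable_iff_local isomorphicI f
    by (auto simp: arr_def)
  have surj: "\<exists>g. arr M V g \<and> v \<cdot> g = f" if "arr M W f" for f
    using AR_lift[OF AR that no_split[OF M W(1) that]] by blast
  show "(\<lambda>f. v \<cdot> f) ` mor C M V = mor C M W"
    using surj comp_arr[OF _ a(2)] ob unfolding arr_def by blast
  have inj: "f = zero_mor M U" if f: "arr M U f" "u \<cdot> f = zero_mor M V" for f
  proof -
    obtain g where g: "arr (sh M) W g" "w \<cdot> g = shm f" using dist_lift_third[OF AR_dist[OF AR] f] .
    have "indecomposable C (sh M)" using M indecomposable_shift_iff ob by blast
    then have "w \<cdot> g = zero_mor (sh M) (sh U)" using AR_comp_zero[OF AR g(1)] no_split W(2) g(1) by blast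
    then show ?thesis using g(2) shm_eq_zero[OF f(1)] by simp
  qed
  show "inj_on (\<lambda>f. u \<cdot> f) (mor C M U)"
  proof (rule inj_onI)
    fix f g assume "f \<in> mor C M U" "g \<in> mor C M U" and eq: "u \<cdot> f = u \<cdot> g"
    then have f: "arr M U f" and g: "arr M U g" using ob by (auto simp: arr_def)
    have "u \<cdot> diff_mor M U f g = zero_mor M V"
      using comp_diff_right[OF a(1) f g] eq diff_eq_zero_iff[OF comp_arr[OF g a(1)] comp_arr[OF g a(1)]] by simp
    then show "f = g" using inj[OF diff_arr[OF f g]] diff_eq_zero_iff[OF f g] by simp
  qed
  show "(\<lambda>f. u \<cdot> f) ` mor C M U = {f \<in> mor C M V. v \<cdot> f = zero_mor M W}"
  proof (intro equalityI subsetI)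
    fix f assume "f \<in> (\<lambda>f. u \<cdot> f) ` mor C M U"
    then obtain g where g: "arr M U g" "f = u \<cdot> g" using ob by (auto simp: arr_def)
    then show "f \<in> {f \<in> mor C M V. v \<cdot> f = zero_mor M W}"
      using comp_arr[OF g(1) a(1)] assoc[OF g(1) a(1,2)] dist_comp_zero[OF AR_dist[OF AR]]
        comp_zero_left[OF g(1) ob(3)] by (simp add: arr_def)
  next
    fix f assume "f \<in> {f \<in> mor C M V. v \<cdot> f = zero_mor M W}"
    then have "arr M V f" "v \<cdot> f = zero_mor M W" using ob by (auto simp: arr_def)
    then obtain g where "arr M U g" "u \<cdot> g = f" using dist_lift[OF AR_dist[OF AR]] by blast
    then show "f \<in> (\<lambda>f. u \<cdot> f) ` mor C M U" by (auto simp: arr_def)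
  qed
qed

text \<open>
  The subspace \<open>w \<circ> Hom(M, X)\<close> is additive in \<open>M\<close> and vanishes at the indecomposables not isomorphic
  to \<open>X\<close>, so its dimension counts the summands isomorphic to \<open>X\<close>.
\<close>

definition socle_space :: "'m \<Rightarrow> 'o \<Rightarrow> 'o \<Rightarrow> 'o \<Rightarrow> ('k, 'm) module" where
  "socle_space w X U M = Hom C M (sh U) \<lparr>carrier := (\<lambda>f. w \<cdot> f) ` mor C M X\<rparr>"

lemma socle_subspace:
  assumes w: "arr X (sh U) w" and M: "M \<in> Ob C"
  shows "subspace K ((\<lambda>f. w \<cdot> f) ` mor C M X) (Hom C M (sh U))"
proof -
  interpret linear_map K "Hom C M X" "Hom C M (sh U)" "\<lambda>f. w \<cdot> f" by (rule postcomp_linear[OF w M])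
  show ?thesis using imT_is_subspace by (simp add: im_def)
qed

text \<open>The construction is contravariant in \<open>M\<close>, so the projections are
  restrictions along the injections; an element \<open>w \<cdot> f\<close> over one summand is
  extended by \<open>f \<cdot> p j\<close>.\<close>

lemma socle_direct_sum:
  assumes w: "arr X (sh U) w" and U: "indecomposable C U" and M: "direct_sum C M Ys"
    and ind: "\<And>Y. Y \<in> set Ys \<Longrightarrow> indecomposable C Y"
  shows "vectorspace.fin_dim K (socle_space w X U M) \<and>
    vectorspace.dim K (socle_space w X U M) = (\<Sum>j<length Ys. vectorspace.dim K (socle_space w X U (Ys ! j)))"
proof -
  obtain i p where b: "biproduct M Ys i p" using M by (auto simp: direct_sum_iff)
  have ob: "M \<in> Ob C" "X \<in> Ob C" "U \<in> Ob C" "sh U \<in> Ob C"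
    using b w U indecomposable_ob by (auto simp: biproduct_def arr_def)
  have arrs: "arr (Ys ! j) M (i j)" "arr M (Ys ! j) (p j)" and obY: "Ys ! j \<in> Ob C" if "j < length Ys" for j
    using b that by (auto simp: biproduct_def)
  have vs: "vectorspace K (socle_space w X U N)" if "N \<in> Ob C" for N
  proof -
    interpret vectorspace K "Hom C N (sh U)" using vectorspace_Hom that ob by blast
    show ?thesis unfolding socle_space_def using socle_subspace[OF w that] by (rule subspace_is_vs)
  qed
  have mem: "g \<in> carrier (socle_space w X U N) \<longleftrightarrow> (\<exists>f. arr N X f \<and> g = w \<cdot> f)" if "N \<in> Ob C" for N g
    using that ob by (auto simp: socle_space_def arr_def)
  show ?thesis
  proof (rule dim_direct_sum[where P = "\<lambda>j g. g \<cdot> i j"])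
    fix j assume j: "j < length Ys"
    show "vectorspace K (socle_space w X U (Ys ! j))" using vs obY[OF j] by blast
    show "vectorspace.fin_dim K (socle_space w X U (Ys ! j))"
    proof -
      interpret vectorspace K "Hom C (Ys ! j) (sh U)" using vectorspace_Hom obY[OF j] ob by blast
      have "fin_dim" using fin_dim_Hom ind j ob by simp
      then show ?thesis
        unfolding socle_space_def using subspace_fin_dim(1) socle_subspace[OF w obY[OF j]] by blast
    qed
    have img: "(w \<cdot> f) \<cdot> i j = w \<cdot> (f \<cdot> i j)" if "arr M X f" for f
      using assoc[OF arrs(1)[OF j] that w] .
    show "(\<lambda>g. g \<cdot> i j) \<in> module_hom K (socle_space w X U M) (socle_space w X U (Ys ! j))"
    proof -
      have "(\<lambda>g. g \<cdot> i j) \<in> module_hom K (Hom C M (sh U)) (Hom C (Ys ! j) (sh U))"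
        using comp_linear_left ob obY[OF j] arrs[OF j] by (auto simp: arr_def)
      moreover have "g \<cdot> i j \<in> carrier (socle_space w X U (Ys ! j))" if "g \<in> carrier (socle_space w X U M)" for g
        using that img comp_arr[OF arrs(1)[OF j]] mem[OF ob(1)] mem[OF obY[OF j]] by auto
      moreover have "carrier (socle_space w X U M) \<subseteq> mor C M (sh U)"
        using mem[OF ob(1)] comp_arr[OF _ w] by (auto simp: arr_def)
      ultimately show ?thesis unfolding socle_space_def by (intro module_hom_restrict) auto
    qed
    fix g assume "g \<in> carrier (socle_space w X U (Ys ! j))"
    then obtain f where f: "arr (Ys ! j) X f" "g = w \<cdot> f" using mem[OF obY[OF j]] by blast
    have fp: "arr M X (f \<cdot> p j)" using comp_arr[OF arrs(2)[OF j] f(1)] .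
    have g: "arr (Ys ! j) (sh U) g" using f comp_arr[OF f(1) w] by simp
    have "(w \<cdot> (f \<cdot> p j)) \<cdot> i l = (if l = j then g else zero_mor (Ys ! l) (sh U))" if l: "l < length Ys" for l
    proof -
      have "(w \<cdot> (f \<cdot> p j)) \<cdot> i l = (g \<cdot> p j) \<cdot> i l"
        using assoc[OF arrs(2)[OF j] f(1) w] f(2) by simp
      also have "\<dots> = g \<cdot> (p j \<cdot> i l)" using assoc[OF arrs(1)[OF l] arrs(2)[OF j] g] .
      also have "\<dots> = (if l = j then g else zero_mor (Ys ! l) (sh U))"
        using b j l id_right[OF g] comp_zero_right[OF g obY[OF l]] by (auto simp: biproduct_def)
      finally show ?thesis .
    qed
    then show "\<exists>h\<in>carrier (socle_space w X U M). h \<cdot> i j = g \<and>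
        (\<forall>l<length Ys. l \<noteq> j \<longrightarrow> h \<cdot> i l = \<zero>\<^bsub>socle_space w X U (Ys ! l)\<^esub>)"
      using fp mem[OF ob(1)] j by (intro bexI[of _ "w \<cdot> (f \<cdot> p j)"]) (auto simp: socle_space_def)
  next
    fix g assume g: "g \<in> carrier (socle_space w X U M)"
      and "\<And>j. j < length Ys \<Longrightarrow> g \<cdot> i j = \<zero>\<^bsub>socle_space w X U (Ys ! j)\<^esub>"
    then have "\<And>j. j < length Ys \<Longrightarrow> g \<cdot> i j = zero_mor (Ys ! j) (sh U)" by (simp add: socle_space_def)
    moreover have "arr M (sh U) g" using g unfolding mem[OF ob(1)] by (auto intro: comp_arr[OF _ w])
    ultimately show "g = \<zero>\<^bsub>socle_space w X U M\<^esub>"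
      using biproduct_jointly_epi[OF b] by (simp add: socle_space_def)
  qed (rule vs[OF ob(1)])
qed

lemma AR_socle_count:
  assumes AR: "AR_triangle C U V X u v w" and M: "direct_sum C M Ys"
    and ind: "\<And>Y. Y \<in> set Ys \<Longrightarrow> indecomposable C Y"
  shows "vectorspace.dim K (socle_space w X U M) =
    length (filter (isomorphic C X) Ys) * vectorspace.dim K (socle_space w X U X)"
proof -
  note a = AR_arr[OF AR]
  have ob: "X \<in> Ob C" "U \<in> Ob C" "sh U \<in> Ob C" using a shift_ob by (auto simp: arr_def)
  have ind': "indecomposable C U" "indecomposable C X" using AR by (auto simp: AR_triangle_def)
  let ?d = "\<lambda>Y. vectorspace.dim K (socle_space w X U Y)"
  have iso: "?d Y = ?d X" if "isomorphic C X Y" for Y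
    using socle_direct_sum[OF a(3) ind'(1) direct_sum_single[OF isomorphic_sym[OF that]]] ind' by simp
  have other: "?d Y = 0" if Y: "indecomposable C Y" "\<not> isomorphic C X Y" for Y
  proof -
    have obY: "Y \<in> Ob C" using Y indecomposable_ob by blast
    have zero: "w \<cdot> f = zero_mor Y (sh U)" if f: "arr Y X f" for f
    proof (rule AR_comp_zero[OF AR f], rule notI)
      assume "split_epi C Y X f"
      then have "isomorphism C Y X f"
        using split_epi_iso[OF f] Y AR_local[OF AR] local_objectD indecomposable_iff_local by blast
      then show False using Y(2) isomorphicI isomorphic_sym ob obY by blast
    qed
    interpret vectorspace K "Hom C Y (sh U)" using vectorspace_Hom obY ob by blast
    interpret S: vectorspace K "socle_space w X U Y"
      unfolding socle_space_def using socle_subspace[OF a(3) obY] by (rule subspace_is_vs)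
    have "carrier (socle_space w X U Y) = {\<zero>\<^bsub>socle_space w X U Y\<^esub>}"
      using zero zero_arr[OF obY ob(1)] obY ob by (auto simp: socle_space_def arr_def image_iff)
    then have "S.gen_set {}" using S.span_empty by simp
    then show ?thesis using S.gen_ge_dim[of "{}"] by simp
  qed
  have "(\<Sum>j<length Ys. ?d (Ys ! j)) = sum_list (map ?d Ys)"
    by (simp add: sum_list_sum_nth atLeast0LessThan)
  also have "\<dots> = length (filter (isomorphic C X) Ys) * ?d X"
    using ind by (induction Ys) (auto simp: iso other)
  finally show ?thesis using socle_direct_sum[OF a(3) ind'(1) M ind] by simp
qed

text \<open>The space contains \<open>w\<close> itself.\<close>

lemma AR_socle_pos:
  assumes AR: "AR_triangle C U V X u v w"
  shows "0 < vectorspace.dim K (socle_space w X U X)"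
proof (rule ccontr)
  assume "\<not> ?thesis"
  then have d0: "vectorspace.dim K (socle_space w X U X) = 0" by simp
  note a = AR_arr[OF AR]
  have ob: "X \<in> Ob C" "U \<in> Ob C" "sh U \<in> Ob C" using a shift_ob by (auto simp: arr_def)
  have ind': "indecomposable C U" "indecomposable C X" using AR by (auto simp: AR_triangle_def)
  have fd: "vectorspace.fin_dim K (socle_space w X U X)"
    using socle_direct_sum[OF a(3) ind'(1) direct_sum_single[OF isomorphic_refl[OF ob(1)]]] ind' by simp
  interpret vectorspace K "Hom C X (sh U)" using vectorspace_Hom ob by blast
  interpret S: vectorspace K "socle_space w X U X"
    unfolding socle_space_def using socle_subspace[OF a(3) ob(1)] by (rule subspace_is_vs)
  have "w \<in> carrier (socle_space w X U X)"
    using ident_arr[OF ob(1)] image_eqI[of w "\<lambda>f. w \<cdot> f", OF id_right[OF a(3), symmetric]]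
    by (simp add: socle_space_def arr_def)
  then show False using S.carrier_of_dim_zero[OF fd d0] AR_nonzero[OF AR] by (simp add: socle_space_def)
qed

text \<open>Both counts, multiplied by the same positive dimension, give the dimension of the socle
  space at \<open>V'\<close>. This is the part of Krull-Schmidt uniqueness used for valuations; the
  triangle ending at \<open>X\<close> provides the test functor.\<close>

lemma summand_count_unique:
  assumes AR: "AR_triangle C U E X u v w" and V: "direct_sum C V Ys" and V': "direct_sum C V' Zs"
    and iso: "isomorphic C V V'"
    and ind: "\<And>Y. Y \<in> set Ys \<Longrightarrow> indecomposable C Y" "\<And>Y. Y \<in> set Zs \<Longrightarrow> indecomposable C Y"
  shows "length (filter (isomorphic C X) Ys) = length (filter (isomorphic C X) Zs)"
  using AR_socle_count[OF AR direct_sum_iso[OF V iso] ind(1)] AR_socle_count[OF AR V' ind(2)] AR_socle_pos[OF AR]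
  by simp

end

section \<open>Non-zero morphisms out of a component\<close>

context krull_schmidt_triangulated
begin

lemma biproduct_comp_nonzero:
  assumes b: "biproduct X Ys i p" and f: "arr X Z f" and g: "arr W X g" and nz: "f \<cdot> g \<noteq> zero_mor W Z"
  shows "\<exists>j < length Ys. (f \<cdot> i j) \<cdot> (p j \<cdot> g) \<noteq> zero_mor W Z"
proof (rule ccontr)
  assume none: "\<not> ?thesis"
  have ob: "X \<in> Ob C" "Z \<in> Ob C" "W \<in> Ob C" using f g by (auto simp: arr_def)
  have arrs: "arr (Ys ! j) X (i j)" "arr X (Ys ! j) (p j)" if "j < length Ys" for j
    using b that by (auto simp: biproduct_def)
  have ip: "arr X X (i j \<cdot> p j)" if "j < length Ys" for j using arrs[OF that] comp_arr by blast
  have fip: "arr X Z (f \<cdot> (i j \<cdot> p j))" if "j < length Ys" for j using comp_arr[OF ip[OF that] f] .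
  have "(f \<cdot> (i j \<cdot> p j)) \<cdot> g = zero_mor W Z" if j: "j < length Ys" for j
  proof -
    have "(f \<cdot> i j) \<cdot> (p j \<cdot> g) = (f \<cdot> (i j \<cdot> p j)) \<cdot> g"
      using assoc[OF arrs(2,1)[OF j] f] assoc[OF g arrs(2)[OF j] comp_arr[OF arrs(1)[OF j] f]] by simp
    then show ?thesis using none j by simp
  qed
  then have "(\<Oplus>\<^bsub>Hom C W Z\<^esub> j \<in> {..<length Ys}. (f \<cdot> (i j \<cdot> p j)) \<cdot> g) = zero_mor W Z"
    using ob by (intro finsum_zero_mor) auto
  moreover have "(f \<cdot> (\<Oplus>\<^bsub>Hom C X X\<^esub> j \<in> {..<length Ys}. i j \<cdot> p j)) \<cdot> g =
      (\<Oplus>\<^bsub>Hom C W Z\<^esub> j \<in> {..<length Ys}. (f \<cdot> (i j \<cdot> p j)) \<cdot> g)"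
    using comp_finsum_right[OF _ f ob(1), of "{..<length Ys}" "\<lambda>j. i j \<cdot> p j"] ip
      comp_finsum_left[OF _ g ob(2), of "{..<length Ys}" "\<lambda>j. f \<cdot> (i j \<cdot> p j)"] fip by simp
  ultimately show False using b nz id_right[OF f] by (simp add: biproduct_def)
qed

lemma AR_vertexE:
  assumes "x \<in> AR_vertices C" obtains X where "indecomposable C X" "x = iso_class C X"
  using assms by (auto simp: AR_vertices_def)

lemma AR_vertex_member:
  assumes "x \<in> AR_vertices C" "X \<in> x" shows "indecomposable C X" "x = iso_class C X"
proof -
  obtain Y where Y: "indecomposable C Y" "x = iso_class C Y" using assms(1) by (rule AR_vertexE)
  then have iso: "isomorphic C Y X" using assms(2) mem_iso_class by simp
  then show "indecomposable C X" using indecomposable_iso Y by blast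
  then show "x = iso_class C X" using Y iso iso_class_eq_iff indecomposable_ob by blast
qed

lemma self_mem_iso_class: "indecomposable C X \<Longrightarrow> X \<in> iso_class C X"
  using isomorphic_refl indecomposable_ob mem_iso_class by blast

lemma AR_arrow_of_irreducible:
  "indecomposable C X \<Longrightarrow> indecomposable C Y \<Longrightarrow> irreducible_mor C X Y f \<Longrightarrow>
    (iso_class C X, iso_class C Y) \<in> AR_arrows C"
  using self_mem_iso_class by (auto simp: AR_arrows_def AR_vertices_def)

text \<open>\<open>g\<close> extends over the left almost split \<open>u\<close>, and the non-zero
  composite survives on some indecomposable summand of \<open>V\<close>. Carrying the prefix
  \<open>r\<close> along keeps the composites from \<open>N\<close> non-zero at every later
  stage.\<close>

lemma irreducible_step:
  assumes X: "indecomposable C X" "AR_triangle C X V W u v w" and r: "arr N X r" and g: "arr X M g"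
    and nz: "g \<cdot> r \<noteq> zero_mor N M" and ns: "\<not> split_mono C X M g"
  obtains X' a g' where "indecomposable C X'" "(iso_class C X, iso_class C X') \<in> AR_arrows C" "arr X X' a"
    "\<not> split_mono C X X' a" "arr X' M g'" "g' \<cdot> (a \<cdot> r) \<noteq> zero_mor N M"
proof -
  note a = AR_arr[OF X(2)]
  obtain g1 where g1: "arr V M g1" "g1 \<cdot> u = g" using AR_extend[OF X(2) g ns] .
  obtain Ys where Ys: "direct_sum C V Ys" "\<forall>Y \<in> set Ys. indecomposable C Y"
    using decomposition a by (auto simp: arr_def)
  obtain i p where b: "biproduct V Ys i p" using Ys by (auto simp: direct_sum_iff)
  have "g1 \<cdot> (u \<cdot> r) \<noteq> zero_mor N M" using assoc[OF r a(1) g1(1)] g1(2) nz by simp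
  then obtain j where j: "j < length Ys" "(g1 \<cdot> i j) \<cdot> (p j \<cdot> (u \<cdot> r)) \<noteq> zero_mor N M"
    using biproduct_comp_nonzero[OF b g1(1) comp_arr[OF r a(1)]] by blast
  have arrs: "arr (Ys ! j) V (i j)" "arr V (Ys ! j) (p j)" using b j by (auto simp: biproduct_def)
  have ind: "indecomposable C (Ys ! j)" using Ys(2) j(1) by simp
  have irr: "irreducible_mor C X (Ys ! j) (p j \<cdot> u)" using AR_irreducible_left[OF X(2) b j(1) ind] .
  show ?thesis
  proof (rule that[OF ind AR_arrow_of_irreducible[OF X(1) ind irr] comp_arr[OF a(1) arrs(2)] _ comp_arr[OF arrs(1) g1(1)]])
    show "\<not> split_mono C X (Ys ! j) (p j \<cdot> u)" using irr by (simp add: irreducible_mor_def)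
    show "(g1 \<cdot> i j) \<cdot> ((p j \<cdot> u) \<cdot> r) \<noteq> zero_mor N M" using j(2) assoc[OF r a(1) arrs(2)] by simp
  qed
qed

text \<open>
  A variant of the Harada--Sai lemma: in an infinite chain of radical morphisms with non-zero
  composites \<open>r n\<close> from \<open>N\<close>, an isomorphism class \<open>X\<close> occurring infinitely often gives a decreasing
  sequence of subspaces \<open>Hom(X\<^sub>n, X) \<circ> r n\<close> of \<open>Hom(N, X)\<close>, which stabilises; then \<open>r n\<close> is a radical
  multiple of itself.
\<close>

lemma no_infinite_radical_chain:
  fixes X :: "nat \<Rightarrow> 'o"
  assumes N: "indecomposable C N" and X: "\<And>n. indecomposable C (X n)"
    and r: "\<And>n. arr N (X n) (r n)" "\<And>n. r n \<noteq> zero_mor N (X n)"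
    and a: "\<And>n. arr (X n) (X (Suc n)) (a n)" "\<And>n. \<not> split_mono C (X n) (X (Suc n)) (a n)"
    and ra: "\<And>n. r (Suc n) = a n \<cdot> r n"
    and fin: "finite (range (\<lambda>n. iso_class C (X n)))"
  shows False
proof -
  have ob: "N \<in> Ob C" "X n \<in> Ob C" for n using N X indecomposable_ob by auto
  obtain m where m: "infinite {n. iso_class C (X n) = iso_class C (X m)}"
    using pigeonhole_infinite[of UNIV "\<lambda>n. iso_class C (X n)"] fin by auto
  define Y where "Y = X m"
  define L where "L n = (\<lambda>b. b \<cdot> r n) ` mor C (X n) Y" for n
  have obY: "Y \<in> Ob C" using ob by (simp add: Y_def)
  interpret vectorspace K "Hom C N Y" using vectorspace_Hom ob obY by blast
  have sub: "subspace K (L n) (Hom C N Y)" for n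
  proof -
    interpret L: linear_map K "Hom C (X n) Y" "Hom C N Y" "\<lambda>b. b \<cdot> r n" by (rule precomp_linear[OF r(1) obY])
    show ?thesis using L.imT_is_subspace by (simp add: L.im_def L_def)
  qed
  have dec: "L (Suc n) \<subseteq> L n" for n
  proof
    fix h assume "h \<in> L (Suc n)"
    then obtain b where b: "arr (X (Suc n)) Y b" "h = b \<cdot> r (Suc n)" using ob obY by (auto simp: L_def arr_def)
    then have "h = (b \<cdot> a n) \<cdot> r n" using assoc[OF r(1) a(1) b(1)] ra by simp
    then show "h \<in> L n" using comp_arr[OF a(1) b(1)] by (auto simp: L_def arr_def)
  qed
  obtain k where k: "\<forall>n\<ge>k. L (Suc n) = L n"
    using decreasing_subspaces_stabilise[of L, OF fin_dim_Hom[OF N obY] sub dec] by blast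
  obtain n where n: "n \<ge> k" "iso_class C (X n) = iso_class C (X m)"
  proof -
    have "\<not> {n. iso_class C (X n) = iso_class C (X m)} \<subseteq> {..<k}"
      using m finite_subset by blast
    then show ?thesis using that by (auto simp: subset_iff not_less)
  qed
  then have "isomorphic C (X n) Y" using iso_class_eq_iff ob by (simp add: Y_def)
  then obtain \<theta> \<theta>' where \<theta>: "arr (X n) Y \<theta>" "arr Y (X n) \<theta>'" "\<theta>' \<cdot> \<theta> = ident C (X n)"
    by (rule isomorphicE)
  have "\<theta> \<cdot> r n \<in> L n" using \<theta>(1) by (auto simp: L_def arr_def)
  then have "\<theta> \<cdot> r n \<in> L (Suc n)" using k n(1) by simp
  then obtain b where b: "arr (X (Suc n)) Y b" "\<theta> \<cdot> r n = b \<cdot> r (Suc n)" using ob obY by (auto simp: L_def arr_def)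
  have tb: "arr (X (Suc n)) (X n) (\<theta>' \<cdot> b)" using comp_arr b \<theta> by blast
  have ba: "arr (X n) Y (b \<cdot> a n)" using comp_arr b a by blast
  have "r n = \<theta>' \<cdot> (b \<cdot> (a n \<cdot> r n))"
    using assoc[OF r(1) \<theta>(1,2)] \<theta>(3) id_left[OF r(1)] b(2) ra by simp
  also have "\<dots> = ((\<theta>' \<cdot> b) \<cdot> a n) \<cdot> r n"
    using assoc[OF r(1) a(1) b(1)] assoc[OF r(1) ba \<theta>(2)] assoc[OF a(1) b(1) \<theta>(2)] by simp
  finally have "r n = ((\<theta>' \<cdot> b) \<cdot> a n) \<cdot> r n" .
  moreover have "\<not> isomorphism C (X n) (X n) ((\<theta>' \<cdot> b) \<cdot> a n)"
    using split_mono_of_iso_comp[OF a(1) tb] a(2) by blast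
  ultimately have "r n = zero_mor N (X n)"
    using left_zero_of_unit[OF _ comp_arr[OF a(1) tb] _ r(1)] X indecomposable_iff_local by blast
  then show False using r(2) by blast
qed

text \<open>If no path reached \<open>M\<close>, the remaining factor \<open>g\<close> would never
  be an isomorphism, hence never a split monomorphism; factoring could go on for ever and would
  produce the chain forbidden by \<open>no_infinite_radical_chain\<close>.\<close>

lemma path_of_nonzero_hom:
  assumes start: "\<And>X. indecomposable C X \<Longrightarrow> iso_class C X \<in> \<Gamma> \<Longrightarrow> \<exists>V W u v w. AR_triangle C X V W u v w"
    and closed: "\<And>x y. x \<in> \<Gamma> \<Longrightarrow> (x, y) \<in> AR_arrows C \<Longrightarrow> y \<in> \<Gamma>"
    and N: "indecomposable C N" "iso_class C N \<in> \<Gamma>"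
    and fin: "finite {x \<in> \<Gamma>. \<exists>X \<in> x. nonzero_hom C N X}"
    and M: "indecomposable C M" "nonzero_hom C N M"
  shows "(iso_class C N, iso_class C M) \<in> (AR_arrows C \<inter> \<Gamma> \<times> \<Gamma>)\<^sup>*"
proof (rule ccontr)
  let ?A = "AR_arrows C \<inter> \<Gamma> \<times> \<Gamma>"
  assume none: "\<not> ?thesis"
  \<comment> \<open>A state consists of the current object, the morphism \<open>r\<close> already
    composed from \<open>N\<close> and the remaining morphism \<open>g\<close> to \<open>M\<close>;
    \<open>Q\<close> joins two states by a radical morphism.\<close>
  define P where "P = (\<lambda>(X, r, g). indecomposable C X \<and> iso_class C X \<in> \<Gamma> \<and>
    (iso_class C N, iso_class C X) \<in> ?A\<^sup>* \<and> arr N X r \<and> arr X M g \<and> g \<cdot> r \<noteq> zero_mor N M)"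
  define Q where "Q = (\<lambda>(X, r :: 'm, g :: 'm) (X', r', g' :: 'm). \<exists>a. arr X X' a \<and> \<not> split_mono C X X' a \<and> r' = a \<cdot> r)"
  have ob: "N \<in> Ob C" "M \<in> Ob C" using N M indecomposable_ob by auto
  obtain f where f: "arr N M f" "f \<noteq> zero_mor N M" using M(2) ob by (auto simp: nonzero_hom_def arr_def)
  have P0: "P (N, ident C N, f)"
    using N f ident_arr[OF ob(1)] id_right[OF f(1)] by (simp add: P_def)
  have step: "\<exists>t. P t \<and> Q s t" if s: "P s" for s
  proof -
    obtain X r g where s_eq: "s = (X, r, g)" by (cases s)
    have X: "indecomposable C X" "iso_class C X \<in> \<Gamma>" "(iso_class C N, iso_class C X) \<in> ?A\<^sup>*"
      and r: "arr N X r" and g: "arr X M g" "g \<cdot> r \<noteq> zero_mor N M" using s by (auto simp: s_eq P_def)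
    have ns: "\<not> split_mono C X M g"
    proof
      assume "split_mono C X M g"
      then have "isomorphism C X M g"
        using split_mono_iso[OF g(1)] X(1) M(1) indecomposable_iff_local local_objectD by blast
      then have "iso_class C X = iso_class C M"
        using iso_class_eq_iff isomorphicI indecomposable_ob X(1) M(1) by blast
      then show False using X(3) none by simp
    qed
    obtain V W u v w where AR: "AR_triangle C X V W u v w" using start X by blast
    obtain X' a g' where X': "indecomposable C X'" "(iso_class C X, iso_class C X') \<in> AR_arrows C" "arr X X' a"
      "\<not> split_mono C X X' a" "arr X' M g'" "g' \<cdot> (a \<cdot> r) \<noteq> zero_mor N M"
      using irreducible_step[OF X(1) AR r g ns] .
    have "iso_class C X' \<in> \<Gamma>" using closed X(2) X'(2) by blast
    then have "P (X', a \<cdot> r, g')"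
      using X X' comp_arr[OF r X'(3)] by (auto simp: P_def intro: rtrancl_into_rtrancl)
    moreover have "Q s (X', a \<cdot> r, g')" using X' by (auto simp: s_eq Q_def)
    ultimately show ?thesis by blast
  qed
  obtain s where s: "\<And>n. P (s n)" "\<And>n. Q (s n) (s (Suc n))"
    using dependent_nat_choice[of "\<lambda>_. P" "\<lambda>_. Q"] P0 step by metis
  define X where "X n = fst (s n)" for n
  define r where "r n = fst (snd (s n))" for n
  define g where "g n = snd (snd (s n))" for n
  have s_eq: "s n = (X n, r n, g n)" for n by (simp add: X_def r_def g_def)
  have Pn: "indecomposable C (X n)" "iso_class C (X n) \<in> \<Gamma>" "arr N (X n) (r n)" "arr (X n) M (g n)"
    "g n \<cdot> r n \<noteq> zero_mor N M" for n using s(1)[of n] by (auto simp: s_eq P_def)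
  have r_nz: "r n \<noteq> zero_mor N (X n)" for n using Pn(5)[of n] comp_zero_right[OF Pn(4) ob(1), of n] by metis
  have "\<forall>n. \<exists>a. arr (X n) (X (Suc n)) a \<and> \<not> split_mono C (X n) (X (Suc n)) a \<and> r (Suc n) = a \<cdot> r n"
    using s(2) by (simp add: s_eq Q_def)
  then obtain a where a: "\<And>n. arr (X n) (X (Suc n)) (a n)" "\<And>n. \<not> split_mono C (X n) (X (Suc n)) (a n)"
    "\<And>n. r (Suc n) = a n \<cdot> r n" by metis
  have "range (\<lambda>n. iso_class C (X n)) \<subseteq> {x \<in> \<Gamma>. \<exists>X \<in> x. nonzero_hom C N X}"
  proof
    fix x assume "x \<in> range (\<lambda>n. iso_class C (X n))"
    then obtain n where x: "x = iso_class C (X n)" by blast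
    have "nonzero_hom C N (X n)" using Pn(3)[of n] r_nz[of n] by (auto simp: nonzero_hom_def arr_def)
    then show "x \<in> {x \<in> \<Gamma>. \<exists>X \<in> x. nonzero_hom C N X}"
      using Pn(2)[of n] self_mem_iso_class[OF Pn(1)] x by blast
  qed
  then have "finite (range (\<lambda>n. iso_class C (X n)))" using fin finite_subset by blast
  then show False 
    using no_infinite_radical_chain[where X = X and r = r and a = a, OF N(1) Pn(1) Pn(3) r_nz a] by blast
qed

end

section \<open>The component and its covering\<close>

lemma finite_range_periodic:
  fixes f :: "int \<Rightarrow> 'a"
  assumes k: "0 < k" and per: "\<And>m. f (m + k) = f m"
  shows "finite (range f)"
proof -
  have nat_mult: "f (m + int j * k) = f m" for m j
  proof (induction j)
    case (Suc j)
    then show ?case using per[of "m + int j * k"] by (simp add: algebra_simps)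
  qed simp
  have mult: "f (m + j * k) = f m" for m j
  proof (cases "0 \<le> j")
    case True
    then show ?thesis using nat_mult[of m "nat j"] by simp
  next
    case False
    then show ?thesis using nat_mult[of "m + j * k" "nat (- j)"] by simp
  qed
  have "f m \<in> f ` {0..<k}" for m
  proof -
    have "f (m mod k) = f m" using mult[of "m mod k" "m div k"] by simp
    moreover have "m mod k \<in> {0..<k}" using k by simp
    ultimately show ?thesis by (metis image_eqI)
  qed
  then have "range f \<subseteq> f ` {0..<k}" by blast
  then show ?thesis by (rule finite_subset) simp
qed

context krull_schmidt_triangulated
begin

section \<open>Translates, arrows and valuations on isomorphism classes\<close>

lemma component_vertices:
  assumes "AR_component C \<Gamma>" shows "\<Gamma> \<subseteq> AR_vertices C"
proof
  fix y assume "y \<in> \<Gamma>"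
  then obtain x where x: "x \<in> AR_vertices C" "(x, y) \<in> (AR_arrows C \<union> (AR_arrows C)\<inverse>)\<^sup>*"
    using assms by (auto simp: AR_component_def)
  show "y \<in> AR_vertices C"
    using x(2,1) by (cases rule: rtranclE) (auto simp: AR_arrows_def)
qed

lemma AR_translate_relI:
  assumes AR: "AR_triangle C U V W u v w" shows "AR_translate_rel C (iso_class C W) (iso_class C U)"
proof -
  have ind: "indecomposable C U" "indecomposable C W" using AR by (auto simp: AR_triangle_def)
  then have "iso_class C U \<in> AR_vertices C" "iso_class C W \<in> AR_vertices C" by (auto simp: AR_vertices_def)
  then show ?thesis
    unfolding AR_translate_rel_def using AR self_mem_iso_class[OF ind(1)] self_mem_iso_class[OF ind(2)] by blast
qed

text \<open>The relation only mentions some representatives; isomorphism invariance moves the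
  triangle to the given one.\<close>

lemma AR_translate_rel_ending:
  assumes rel: "AR_translate_rel C y x" and W: "indecomposable C W" "y = iso_class C W"
  obtains U V u v w where "AR_triangle C U V W u v w" "x = iso_class C U"
proof -
  obtain W' U V u v w where AR: "W' \<in> y" "U \<in> x" "AR_triangle C U V W' u v w" and x: "x \<in> AR_vertices C"
    using rel by (auto simp: AR_translate_rel_def)
  have "isomorphic C W' W" using AR(1) W mem_iso_class isomorphic_sym by blast
  then obtain v' w' where "AR_triangle C U V W u v' w'" using AR_iso_third[OF AR(3)] by blast
  moreover have "x = iso_class C U" using AR_vertex_member[OF x AR(2)] by simp
  ultimately show ?thesis using that by blast
qed

lemma AR_translate_rel_starting:
  assumes rel: "AR_translate_rel C y x" and U: "indecomposable C U" "x = iso_class C U"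
  obtains V W u v w where "AR_triangle C U V W u v w" "y = iso_class C W"
proof -
  obtain W U' V u v w where AR: "W \<in> y" "U' \<in> x" "AR_triangle C U' V W u v w" and y: "y \<in> AR_vertices C"
    using rel by (auto simp: AR_translate_rel_def)
  have "isomorphic C U' U" using AR(2) U mem_iso_class isomorphic_sym by blast
  then obtain u' w' where "AR_triangle C U V W u' v w'" using AR_iso_first[OF AR(3)] by blast
  moreover have "y = iso_class C W" using AR_vertex_member[OF y AR(1)] by simp
  ultimately show ?thesis using that by blast
qed

lemma AR_translate_rel_unique:
  assumes "AR_translate_rel C y x" "AR_translate_rel C y x'" shows "x = x'"
proof -
  obtain W where W: "indecomposable C W" "y = iso_class C W"
    using assms(1) AR_vertexE by (auto simp: AR_translate_rel_def)
  obtain U V u v w where 1: "AR_triangle C U V W u v w" "x = iso_class C U"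
    using AR_translate_rel_ending[OF assms(1) W] .
  obtain U' V' u' v' w' where 2: "AR_triangle C U' V' W u' v' w'" "x' = iso_class C U'"
    using AR_translate_rel_ending[OF assms(2) W] .
  have "isomorphic C U U'" using AR_unique(1)[OF 1(1) 2(1)] isomorphic_refl indecomposable_ob W(1) by blast
  then show ?thesis using 1(2) 2(2) iso_class_eq_iff by (auto simp: isomorphic_def)
qed

lemma AR_translate_eq: assumes "AR_translate_rel C y x" shows "AR_translate C y = x"
  unfolding AR_translate_def
proof (rule the_equality)
  show "AR_translate_rel C y x" by (rule assms)
  fix x' assume "AR_translate_rel C y x'"
  then show "x' = x" using assms by (rule AR_translate_rel_unique)
qed

lemma AR_arrows_into:
  assumes AR: "AR_triangle C U V W u v w" and V: "direct_sum C V Ys"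
    and ind: "\<And>Y. Y \<in> set Ys \<Longrightarrow> indecomposable C Y"
  shows "{x. (x, iso_class C W) \<in> AR_arrows C} = iso_class C ` set Ys"
proof (intro equalityI subsetI)
  obtain i p where b: "biproduct V Ys i p" using V by (auto simp: direct_sum_iff)
  have W: "indecomposable C W" using AR by (simp add: AR_triangle_def)
  {
    fix x assume "x \<in> iso_class C ` set Ys"
    then obtain j where j: "j < length Ys" "x = iso_class C (Ys ! j)" by (auto simp: in_set_conv_nth)
    then show "x \<in> {x. (x, iso_class C W) \<in> AR_arrows C}"
      using AR_irreducible_right[OF AR b j(1)] ind AR_arrow_of_irreducible[OF _ W] by simp
  next
    fix x assume "x \<in> {x. (x, iso_class C W) \<in> AR_arrows C}"
    then obtain X Y f where x: "x \<in> AR_vertices C" "X \<in> x" "Y \<in> iso_class C W" "irreducible_mor C X Y f"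
      by (auto simp: AR_arrows_def)
    have X: "indecomposable C X" "x = iso_class C X" using AR_vertex_member x by auto
    have "isomorphic C W Y" using x mem_iso_class by blast
    then obtain v' w' where AR': "AR_triangle C U V Y u v' w'" using AR_iso_third[OF AR] by blast
    obtain j where j: "j < length Ys" "isomorphic C X (Ys ! j)"
      using AR_summand_of_irreducible[OF AR' b ind X(1) x(4)] by blast
    have mem: "Ys ! j \<in> set Ys" using j(1) by simp
    have "x = iso_class C (Ys ! j)"
      unfolding X(2) using iso_class_eq_iff indecomposable_ob[OF X(1)] indecomposable_ob[OF ind[OF mem]] j(2) by blast
    then show "x \<in> iso_class C ` set Ys" using mem by blast
  }
qed

text \<open>The definite description ranges over all representatives and all triangles ending at
  them, so it rests on uniqueness of the middle term and of multiplicities. The triangle ending at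
  \<open>X\<close> serves the latter.\<close>

lemma AR_valuation_eq:
  assumes AR: "AR_triangle C U V W u v w" and V: "direct_sum C V Ys"
    and ind: "\<And>Y. Y \<in> set Ys \<Longrightarrow> indecomposable C Y"
    and X: "AR_triangle C U\<^sub>X V\<^sub>X X u\<^sub>X v\<^sub>X w\<^sub>X"
  shows "fst (AR_valuation C (iso_class C X) (iso_class C W)) = length (filter (isomorphic C X) Ys)"
proof -
  have indX: "indecomposable C X" and indW: "indecomposable C W" using AR X by (auto simp: AR_triangle_def)
  have "(THE a. \<exists>X' \<in> iso_class C X. \<exists>Y \<in> iso_class C W. \<exists>U V u v w. AR_triangle C U V Y u v w \<and> summand_mult C V X' a) =
    length (filter (isomorphic C X) Ys)"
  proof (rule the_equality)
    show "\<exists>X' \<in> iso_class C X. \<exists>Y \<in> iso_class C W. \<exists>U V u v w. AR_triangle C U V Y u v w \<and>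
        summand_mult C V X' (length (filter (isomorphic C X) Ys))"
      using self_mem_iso_class[OF indX] self_mem_iso_class[OF indW] AR V ind unfolding summand_mult_def by blast
    fix a assume "\<exists>X' \<in> iso_class C X. \<exists>Y \<in> iso_class C W. \<exists>U V u v w. AR_triangle C U V Y u v w \<and> summand_mult C V X' a"
    then obtain X' Y U' V' u' v' w' Zs where 1: "isomorphic C X X'" "isomorphic C W Y" "AR_triangle C U' V' Y u' v' w'"
      and Zs: "direct_sum C V' Zs" "\<forall>Z \<in> set Zs. indecomposable C Z" "a = length (filter (isomorphic C X') Zs)"
      unfolding summand_mult_def using mem_iso_class by blast
    have "isomorphic C V V'" using AR_unique(2)[OF AR 1(3,2)] .
    then have "length (filter (isomorphic C X) Ys) = length (filter (isomorphic C X) Zs)"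
      using summand_count_unique[OF X V Zs(1)] ind Zs(2) by blast
    moreover have "isomorphic C X = isomorphic C X'"
      using 1(1) isomorphic_sym isomorphic_trans by blast
    ultimately show "a = length (filter (isomorphic C X) Ys)" using Zs(3) by simp
  qed
  then show ?thesis by (simp add: AR_valuation_def)
qed

definition class_dim :: "'o \<Rightarrow> 'o set \<Rightarrow> nat" where
  "class_dim M x = hom_dim M (SOME X. X \<in> x)"

lemma class_dim_eq:
  assumes "indecomposable C M" "indecomposable C X"
  shows "class_dim M (iso_class C X) = hom_dim M X"
proof -
  have "(SOME Y. Y \<in> iso_class C X) \<in> iso_class C X"
    using self_mem_iso_class[OF assms(2)] someI[of "\<lambda>Y. Y \<in> iso_class C X" X] by blast
  then show ?thesis
    unfolding class_dim_def using hom_dim_iso[OF assms] mem_iso_class by blast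
qed

text \<open>\<open>Hom(M, V)\<close> decomposes over the summands of \<open>V\<close>; grouping
  these by class brings out their multiplicities, which are the first components of the valuations.
  The predecessors need triangles of their own for \<open>AR_valuation_eq\<close>.\<close>

lemma class_dim_additive:
  assumes AR: "AR_triangle C U V W u v w" and M: "indecomposable C M"
    and W: "\<not> isomorphic C M W" "\<not> isomorphic C (sh M) W"
    and ending: "\<And>X. indecomposable C X \<Longrightarrow> (iso_class C X, iso_class C W) \<in> AR_arrows C \<Longrightarrow>
      \<exists>U V u v w. AR_triangle C U V X u v w"
  shows "class_dim M (iso_class C U) + class_dim M (iso_class C W) =
    (\<Sum>x | (x, iso_class C W) \<in> AR_arrows C. fst (AR_valuation C x (iso_class C W)) * class_dim M x)"
proof -
  have ind: "indecomposable C U" "indecomposable C W" using AR by (auto simp: AR_triangle_def)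
  have "V \<in> Ob C" using AR_arr[OF AR] by (auto simp: arr_def)
  then obtain Ys where Ys: "direct_sum C V Ys" "\<forall>Y \<in> set Ys. indecomposable C Y" using decomposition by metis
  let ?c = "iso_class C"
  have arrows: "{x. (x, ?c W) \<in> AR_arrows C} = ?c ` set Ys" using AR_arrows_into[OF AR Ys(1)] Ys(2) by blast
  have "hom_dim M V = (\<Sum>Y\<leftarrow>Ys. hom_dim M Y)"
    using hom_direct_sum[OF M Ys(1)] Ys(2) by (simp add: sum_list_sum_nth atLeast0LessThan)
  also have "map (hom_dim M) Ys = map (class_dim M) (map ?c Ys)"
    using Ys(2) class_dim_eq[OF M] by simp
  also have "sum_list \<dots> = (\<Sum>x\<in>?c ` set Ys. count_list (map ?c Ys) x * class_dim M x)"
    by (subst sum_list_map_eq_sum_count) simp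
  also have "\<dots> = (\<Sum>x\<in>?c ` set Ys. fst (AR_valuation C x (?c W)) * class_dim M x)"
  proof (rule sum.cong[OF refl])
    fix x assume x: "x \<in> ?c ` set Ys"
    then obtain X where X: "X \<in> set Ys" "x = ?c X" by blast
    then have indX: "indecomposable C X" using Ys(2) by simp
    have "(?c X, ?c W) \<in> AR_arrows C" using arrows x X(2) by blast
    then obtain U' V' u' v' w' where "AR_triangle C U' V' X u' v' w'" using ending indX by blast
    then have "fst (AR_valuation C (?c X) (?c W)) = length (filter (isomorphic C X) Ys)"
      using AR_valuation_eq[OF AR Ys(1)] Ys(2) by blast
    moreover have "count_list (map ?c Ys) (?c X) = length (filter (isomorphic C X) Ys)"
      using Ys(2) iso_class_eq_iff[OF indecomposable_ob[OF indX] indecomposable_ob]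
      by (induction Ys) (auto dest: isomorphic_sym)
    ultimately show "count_list (map ?c Ys) x * class_dim M x = fst (AR_valuation C x (?c W)) * class_dim M x"
      by (simp add: X(2))
  qed
  finally show ?thesis
    using AR_hom_dim[OF AR M W] arrows class_dim_eq[OF M] ind by simp
qed

lemma component_translate_rel:
  assumes st: "stable_component C \<Gamma>" and y: "y \<in> \<Gamma>"
  shows "\<exists>x\<in>\<Gamma>. AR_translate_rel C y x" "\<exists>x\<in>\<Gamma>. AR_translate_rel C x y"
proof -
  have *: "\<forall>n. \<exists>N \<in> \<Gamma>. AR_translate_power C n y N" using st y unfolding stable_component_def by blast
  show "\<exists>x\<in>\<Gamma>. AR_translate_rel C y x" using *[rule_format, of 1] by (auto simp: AR_translate_power_def)
  show "\<exists>x\<in>\<Gamma>. AR_translate_rel C x y" using *[rule_format, of "-1"] by (auto simp: AR_translate_power_def)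
qed

lemma component_AR_ending:
  assumes st: "stable_component C \<Gamma>" and W: "indecomposable C W" "iso_class C W \<in> \<Gamma>"
  obtains U V u v w where "AR_triangle C U V W u v w" "iso_class C U \<in> \<Gamma>"
proof -
  obtain x where x: "x \<in> \<Gamma>" "AR_translate_rel C (iso_class C W) x" using component_translate_rel(1)[OF st W(2)] by blast
  show ?thesis using AR_translate_rel_ending[OF x(2) W(1) refl] x(1) that by metis
qed

lemma component_AR_starting:
  assumes st: "stable_component C \<Gamma>" and U: "indecomposable C U" "iso_class C U \<in> \<Gamma>"
  obtains V W u v w where "AR_triangle C U V W u v w" "iso_class C W \<in> \<Gamma>"
proof -
  obtain x where x: "x \<in> \<Gamma>" "AR_translate_rel C x (iso_class C U)" using component_translate_rel(2)[OF st U(2)] by blast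
  show ?thesis using AR_translate_rel_starting[OF x(2) U(1) refl] x(1) that by metis
qed

lemma component_closed:
  assumes "stable_component C \<Gamma>" "x \<in> \<Gamma>"
  shows "(x, y) \<in> AR_arrows C \<Longrightarrow> y \<in> \<Gamma>" "(y, x) \<in> AR_arrows C \<Longrightarrow> y \<in> \<Gamma>"
  using assms unfolding stable_component_def by blast+

end

section \<open>The covering of the component by \<int>T\<close>

locale tree_class_component = krull_schmidt_triangulated K C
  for K :: "('k, 'r) ring_scheme" and C :: "('k, 'o, 'm, 'z) tri_cat_scheme" (structure) +
  fixes \<Gamma> :: "'o set set" and T :: "'v valued_graph" and \<Omega> :: "('v \<times> 'v) set"
    and G :: "(int \<times> 'v \<Rightarrow> int \<times> 'v) set" and \<pi> :: "int \<times> 'v \<Rightarrow> 'o set"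
    and c d :: "'v \<Rightarrow> real"
  assumes stable: "stable_component C \<Gamma>"
    and tree: "valued_tree T"
    and orient: "orientation T \<Omega>"
    and automorphisms: "\<And>g. g \<in> G \<Longrightarrow> quiver_automorphism (Z_quiver T \<Omega>) g"
    and cov: "covering (Z_quiver T \<Omega>) (AR_subquiver C \<Gamma>) \<pi>"
    and fibres: "\<And>p q. p \<in> q_verts (Z_quiver T \<Omega>) \<Longrightarrow> q \<in> q_verts (Z_quiver T \<Omega>) \<Longrightarrow>
      \<pi> p = \<pi> q \<longleftrightarrow> (\<exists>g\<in>G. g p = q)"
    and weights: "finite_type_weights T c d"
begin

lemma vertices: "\<Gamma> \<subseteq> AR_vertices C"
  using component_vertices stable unfolding stable_component_def by blast

lemma finite_verts: "finite (verts T)"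
  using weights by (simp add: finite_type_weights_def)

lemma edges_eq: "edges T = \<Omega> \<union> \<Omega>\<inverse>" and \<Omega>_antisym: "\<Omega> \<inter> \<Omega>\<inverse> = {}"
  using orient by (auto simp: orientation_def)

lemma \<Omega>_verts: "(x, y) \<in> \<Omega> \<Longrightarrow> x \<in> verts T \<and> y \<in> verts T"
  using tree edges_eq by (auto simp: valued_tree_def)

lemma Z_verts: "q_verts (Z_quiver T \<Omega>) = UNIV \<times> verts T"
  by (simp add: Z_quiver_def)

lemma Z_arrow_iff: "((n, x), (m, y)) \<in> q_arrows (Z_quiver T \<Omega>) \<longleftrightarrow>
    (m = n \<and> (x, y) \<in> \<Omega>) \<or> (m = n + 1 \<and> (y, x) \<in> \<Omega>)"
  by (auto simp: Z_quiver_def)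

lemma cover_mem: "x \<in> verts T \<Longrightarrow> \<pi> (n, x) \<in> \<Gamma>"
  using cov by (auto simp: covering_def Z_verts AR_subquiver_def)

lemma coverE:
  assumes "y \<in> \<Gamma>" obtains n x where "x \<in> verts T" "y = \<pi> (n, x)"
proof -
  have "\<pi> ` (UNIV \<times> verts T) = \<Gamma>" using cov by (simp add: covering_def Z_verts AR_subquiver_def)
  then show ?thesis using assms that by auto
qed

lemma cover_translate: "x \<in> verts T \<Longrightarrow> AR_translate C (\<pi> (n, x)) = \<pi> (n - 1, x)"
  using cov by (auto simp: covering_def Z_verts AR_subquiver_def Z_quiver_def)

lemma cover_valuation:
  "(p, q) \<in> q_arrows (Z_quiver T \<Omega>) \<Longrightarrow> AR_valuation C (\<pi> p) (\<pi> q) = val T (snd p) (snd q)"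
proof -
  assume "(p, q) \<in> q_arrows (Z_quiver T \<Omega>)"
  then have "q_val (AR_subquiver C \<Gamma>) (\<pi> p) (\<pi> q) = q_val (Z_quiver T \<Omega>) p q"
    using cov unfolding covering_def by blast
  then show ?thesis by (simp add: AR_subquiver_def Z_quiver_def)
qed

lemma cover_predecessors:
  assumes "x \<in> verts T"
  shows "bij_betw \<pi> {p. (p, (n, x)) \<in> q_arrows (Z_quiver T \<Omega>)} {z. (z, \<pi> (n, x)) \<in> AR_arrows C}"
proof -
  have "bij_betw \<pi> {p. (p, (n, x)) \<in> q_arrows (Z_quiver T \<Omega>)} {z. (z, \<pi> (n, x)) \<in> AR_arrows C \<inter> \<Gamma> \<times> \<Gamma>}"
    using cov assms by (auto simp: covering_def AR_subquiver_def Z_verts)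
  moreover have "{z. (z, \<pi> (n, x)) \<in> AR_arrows C \<inter> \<Gamma> \<times> \<Gamma>} = {z. (z, \<pi> (n, x)) \<in> AR_arrows C}"
    using component_closed(2)[OF stable] cover_mem[OF assms] by blast
  ultimately show ?thesis by simp
qed

lemma cover_successors:
  assumes "x \<in> verts T"
  shows "bij_betw \<pi> {p. ((n, x), p) \<in> q_arrows (Z_quiver T \<Omega>)} {z. (\<pi> (n, x), z) \<in> AR_arrows C}"
proof -
  have "bij_betw \<pi> {p. ((n, x), p) \<in> q_arrows (Z_quiver T \<Omega>)} {z. (\<pi> (n, x), z) \<in> AR_arrows C \<inter> \<Gamma> \<times> \<Gamma>}"
    using cov assms by (auto simp: covering_def AR_subquiver_def Z_verts)
  moreover have "{z. (\<pi> (n, x), z) \<in> AR_arrows C \<inter> \<Gamma> \<times> \<Gamma>} = {z. (\<pi> (n, x), z) \<in> AR_arrows C}"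
    using component_closed(1)[OF stable] cover_mem[OF assms] by blast
  ultimately show ?thesis by simp
qed

text \<open>The mesh ending at \<open>(n + 1, x)\<close> starts at \<open>(n, x)\<close>; its middle
  vertices are the \<open>(n + 1, z)\<close> with \<open>z \<rightarrow> x\<close> in \<Omega> and
  the \<open>(n, z)\<close> with \<open>x \<rightarrow> z\<close> in \<Omega>. In both cases the
  valuation is read from \<open>z\<close> to \<open>x\<close>, and its first component is the
  multiplicity in the middle term.\<close>

lemma cover_additive:
  assumes x: "x \<in> verts T" and M: "indecomposable C M"
    and generic: "\<pi> (n + 1, x) \<noteq> iso_class C M" "\<pi> (n + 1, x) \<noteq> iso_class C (sh M)"
  shows "class_dim M (\<pi> (n, x)) + class_dim M (\<pi> (n + 1, x)) =
    (\<Sum>z\<in>verts T. if (z, x) \<in> \<Omega> then fst (val T z x) * class_dim M (\<pi> (n + 1, z)) else 0) +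
    (\<Sum>z\<in>verts T. if (x, z) \<in> \<Omega> then fst (val T z x) * class_dim M (\<pi> (n, z)) else 0)"
proof -
  obtain W where W: "indecomposable C W" "\<pi> (n + 1, x) = iso_class C W"
    using cover_mem[OF x] vertices AR_vertexE by blast
  then have W\<Gamma>: "iso_class C W \<in> \<Gamma>" using cover_mem[OF x] by metis
  obtain U V u v w where AR: "AR_triangle C U V W u v w" using component_AR_ending[OF stable W(1) W\<Gamma>] .
  have obM: "M \<in> Ob C" "sh M \<in> Ob C" "W \<in> Ob C" using M W shift_ob indecomposable_ob by auto
  have nM: "\<not> isomorphic C M W" "\<not> isomorphic C (sh M) W"
    using generic W(2) iso_class_eq_iff obM by metis+
  have U: "iso_class C U = \<pi> (n, x)"
    using AR_translate_eq[OF AR_translate_relI[OF AR]] cover_translate[OF x, of "n + 1"] W(2) by simp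
  have "\<exists>U V u v w. AR_triangle C U V X u v w" if "indecomposable C X" "(iso_class C X, iso_class C W) \<in> AR_arrows C" for X
    using component_AR_ending[OF stable that(1)] component_closed(2)[OF stable W\<Gamma> that(2)] by metis
  then have "class_dim M (\<pi> (n, x)) + class_dim M (\<pi> (n + 1, x)) =
      (\<Sum>z | (z, \<pi> (n + 1, x)) \<in> AR_arrows C. fst (AR_valuation C z (\<pi> (n + 1, x))) * class_dim M z)"
    using class_dim_additive[OF AR M nM] U W(2) by simp
  also have "\<dots> = (\<Sum>p | (p, (n + 1, x)) \<in> q_arrows (Z_quiver T \<Omega>).
      fst (AR_valuation C (\<pi> p) (\<pi> (n + 1, x))) * class_dim M (\<pi> p))"
    by (rule sum.reindex_bij_betw[OF cover_predecessors[OF x], symmetric])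
  also have "\<dots> = (\<Sum>p | (p, (n + 1, x)) \<in> q_arrows (Z_quiver T \<Omega>). fst (val T (snd p) x) * class_dim M (\<pi> p))"
    using cover_valuation by (intro sum.cong) auto
  also have "{p. (p, (n + 1, x)) \<in> q_arrows (Z_quiver T \<Omega>)} =
      Pair (n + 1) ` {z \<in> verts T. (z, x) \<in> \<Omega>} \<union> Pair n ` {z \<in> verts T. (x, z) \<in> \<Omega>}"
    using \<Omega>_verts by (auto simp: Z_arrow_iff)
  also have "(\<Sum>p \<in> \<dots>. fst (val T (snd p) x) * class_dim M (\<pi> p)) =
      (\<Sum>z | z \<in> verts T \<and> (z, x) \<in> \<Omega>. fst (val T z x) * class_dim M (\<pi> (n + 1, z))) +
      (\<Sum>z | z \<in> verts T \<and> (x, z) \<in> \<Omega>. fst (val T z x) * class_dim M (\<pi> (n, z)))"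
    using finite_verts
    by (subst sum.union_disjoint) (auto simp: sum.reindex inj_on_def)
  finally show ?thesis using finite_verts by (simp add: sum.inter_filter)
qed

text \<open>The group element identifying the two points commutes with the translation, so it
  identifies their translates in both directions.\<close>

lemma fibre_translate:
  assumes x: "x \<in> verts T" "x' \<in> verts T" and eq: "\<pi> (n, x) = \<pi> (n', x')"
  shows "\<pi> (n + j, x) = \<pi> (n' + j, x')"
proof -
  obtain g where g: "g \<in> G" "g (n, x) = (n', x')" using fibres[of "(n, x)" "(n', x')"] eq x by (auto simp: Z_verts)
  have g_verts: "g (m, x) \<in> UNIV \<times> verts T" for m
    using automorphisms[OF g(1)] x(1) by (auto simp: quiver_automorphism_def Bij_def bij_betw_def Z_verts)
  have g_trans: "g (m - 1, x) = (fst (g (m, x)) - 1, snd (g (m, x)))" for m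
    using automorphisms[OF g(1)] x(1) by (auto simp: quiver_automorphism_def Z_verts Z_quiver_def split: prod.splits)
  have "g (n + j, x) = (n' + j, x')"
  proof (induction j rule: int_induct[where k = 0])
    case base
    then show ?case using g by simp
  next
    case (step1 i)
    then show ?case using g_trans[of "n + (i + 1)"] by (auto simp: prod_eq_iff)
  next
    case (step2 i)
    then show ?case using g_trans[of "n + i"] by (simp add: algebra_simps)
  qed
  then show ?thesis
    using fibres[of "(n + j, x)" "(n' + j, x')"] g(1) x by (auto simp: Z_verts)
qed

text \<open>The points of column \<open>y\<close> next to \<open>(n + j k, x)\<close>, for all
  \<open>j\<close>, map to successors of one and the same vertex. That vertex has finitely many
  successors, so two of these points are identified.\<close>

lemma periodic_neighbour:
  assumes xy: "(x, y) \<in> edges T" and k: "0 < k" and per: "\<pi> (n, x) = \<pi> (n + k, x)"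
  shows "\<exists>n' k'. 0 < k' \<and> \<pi> (n', y) = \<pi> (n' + k', y)"
proof -
  have v: "x \<in> verts T" "y \<in> verts T" using xy tree by (auto simp: valued_tree_def)
  \<comment> \<open>The arrow from column \<open>x\<close> to column \<open>y\<close> stays in its
    slice or advances by one, depending on the orientation of the edge.\<close>
  define e :: int where "e = (if (x, y) \<in> \<Omega> then 0 else 1)"
  have arrow: "((m, x), (m + e, y)) \<in> q_arrows (Z_quiver T \<Omega>)" for m
    using xy edges_eq by (auto simp: Z_arrow_iff e_def)
  have mult: "\<pi> (n + int j * k, x) = \<pi> (n, x)" for j
  proof (induction j)
    case (Suc j)
    then show ?case using fibre_translate[OF v(1) v(1) per, of "int j * k"] by (simp add: algebra_simps)
  qed simp
  have "{p. ((n, x), p) \<in> q_arrows (Z_quiver T \<Omega>)} \<subseteq> {n, n + 1} \<times> verts T"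
    using \<Omega>_verts by (auto simp: Z_arrow_iff)
  then have "finite {p. ((n, x), p) \<in> q_arrows (Z_quiver T \<Omega>)}"
    by (rule finite_subset) (simp add: finite_verts)
  then have fin: "finite {z. (\<pi> (n, x), z) \<in> AR_arrows C}"
    using bij_betw_finite[OF cover_successors[OF v(1)]] by blast
  have "range (\<lambda>j. \<pi> (n + int j * k + e, y)) \<subseteq> {z. (\<pi> (n, x), z) \<in> AR_arrows C}"
  proof
    fix z assume "z \<in> range (\<lambda>j. \<pi> (n + int j * k + e, y))"
    then obtain j where z: "z = \<pi> (n + int j * k + e, y)" by blast
    then have "z \<in> \<pi> ` {p. ((n + int j * k, x), p) \<in> q_arrows (Z_quiver T \<Omega>)}" using arrow by blast
    then show "z \<in> {z. (\<pi> (n, x), z) \<in> AR_arrows C}"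
      using bij_betw_imp_surj_on[OF cover_successors[OF v(1), of "n + int j * k"]] mult by auto
  qed
  then have "finite (range (\<lambda>j. \<pi> (n + int j * k + e, y)))" using fin finite_subset by blast
  then have "\<not> inj (\<lambda>j. \<pi> (n + int j * k + e, y))" using finite_imageD infinite_UNIV_nat by blast
  then obtain i j where ij: "i \<noteq> j" "\<pi> (n + int i * k + e, y) = \<pi> (n + int j * k + e, y)"
    unfolding inj_def by blast
  then obtain i j where ij: "i < j" "\<pi> (n + int i * k + e, y) = \<pi> (n + int j * k + e, y)"
    by (metis nat_neq_iff)
  then have "0 < (int j - int i) * k" using k by simp
  moreover have "n + int j * k + e = (n + int i * k + e) + (int j - int i) * k" by (simp add: algebra_simps)
  ultimately show ?thesis using ij(2) by metis
qed

text \<open>Periodicity spreads along the connected tree, so each of the finitely many columns has a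
  finite image.\<close>

lemma finite_of_periodic:
  assumes x: "x \<in> verts T" and k: "0 < k" and per: "\<pi> (n, x) = \<pi> (n + k, x)"
  shows "finite \<Gamma>"
proof -
  have all: "\<exists>n k. 0 < k \<and> \<pi> (n, y) = \<pi> (n + k, y)" if "y \<in> verts T" for y
  proof -
    have "(x, y) \<in> (edges T)\<^sup>*" using tree x that by (simp add: valued_tree_def)
    then show ?thesis
    proof (induction rule: rtrancl_induct)
      case (step y z)
      then show ?case using periodic_neighbour by blast
    qed (use k per in blast)
  qed
  have "finite (range (\<lambda>n. \<pi> (n, y)))" if y: "y \<in> verts T" for y
  proof -
    obtain n k where nk: "0 < k" "\<pi> (n, y) = \<pi> (n + k, y)" using all[OF y] by blast
    have step: "\<pi> (m, y) = \<pi> (m + k, y)" for m using fibre_translate[OF y y nk(2), of "m - n"] by (simp add: algebra_simps)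
    then show ?thesis using finite_range_periodic[OF nk(1), of "\<lambda>n. \<pi> (n, y)"] by simp
  qed
  then have "finite (\<Union>y\<in>verts T. range (\<lambda>n. \<pi> (n, y)))" using finite_verts by blast
  moreover have "\<Gamma> \<subseteq> (\<Union>y\<in>verts T. range (\<lambda>n. \<pi> (n, y)))"
  proof
    fix z assume "z \<in> \<Gamma>"
    then obtain n y where "y \<in> verts T" "z = \<pi> (n, y)" by (rule coverE)
    then show "z \<in> (\<Union>y\<in>verts T. range (\<lambda>n. \<pi> (n, y)))" by blast
  qed
  ultimately show ?thesis by (rule finite_subset[rotated])
qed

lemma edge_valuation_symmetrizable:
  "(z, x) \<in> edges T \<Longrightarrow> d x * real (fst (val T z x)) = d z * real (fst (val T x z))"
  using weights by (auto simp: finite_type_weights_def)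

lemma finite_support:
  assumes M: "indecomposable C M"
  shows "finite {x \<in> \<Gamma>. class_dim M x \<noteq> 0}"
proof (cases "finite \<Gamma>")
  case False
  \<comment> \<open>Reversing \<Omega> exchanges the two sums of a mesh, which makes the sequence of
    slices going to the left additive as well; hence both orientations.\<close>
  have form: "finite_type_form (verts T) \<Omega>' (\<lambda>z x. fst (val T z x)) c d" if "\<Omega>' = \<Omega> \<or> \<Omega>' = \<Omega>\<inverse>" for \<Omega>'
  proof -
    have "\<Omega>' \<union> \<Omega>'\<inverse> = edges T" "\<Omega>' \<inter> \<Omega>'\<inverse> = {}" using that edges_eq \<Omega>_antisym by auto
    then show ?thesis
      using weights edge_valuation_symmetrizable by unfold_locales (auto simp: finite_type_weights_def)
  qed
  define bad where "bad = {(n, x). x \<in> verts T \<and> \<pi> (n, x) \<in> {iso_class C M, iso_class C (sh M)}}"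
  \<comment> \<open>Two points of a column over the same vertex differ by a period, which
    \<open>finite_of_periodic\<close> excludes for infinite \<Gamma>.\<close>
  have "finite {n. \<pi> (n, x) = y}" if x: "x \<in> verts T" for x y
  proof (rule ccontr)
    assume "infinite {n. \<pi> (n, x) = y}"
    then obtain n where n: "\<pi> (n, x) = y" using not_finite_existsD by blast
    have "\<not> {n. \<pi> (n, x) = y} \<subseteq> {n}"
      using \<open>infinite {n. \<pi> (n, x) = y}\<close> finite_subset by blast
    then obtain m where m: "\<pi> (m, x) = y" "m \<noteq> n" by blast
    have "\<exists>n k. 0 < k \<and> \<pi> (n, x) = \<pi> (n + k, x)"
    proof (cases "m < n")
      case True
      then show ?thesis using m n by (intro exI[of _ m] exI[of _ "n - m"]) simp
    next
      case False
      then show ?thesis using m n by (intro exI[of _ n] exI[of _ "m - n"]) simp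
    qed
    then show False using finite_of_periodic[OF x] False by blast
  qed
  then have "finite (\<Union>x\<in>verts T. \<Union>y\<in>{iso_class C M, iso_class C (sh M)}. (\<lambda>n. (n, x)) ` {n. \<pi> (n, x) = y})"
    using finite_verts by blast
  moreover have "bad \<subseteq> (\<Union>x\<in>verts T. \<Union>y\<in>{iso_class C M, iso_class C (sh M)}. (\<lambda>n. (n, x)) ` {n. \<pi> (n, x) = y})"
    by (auto simp: bad_def)
  ultimately have "finite (fst ` bad)" using finite_subset finite_imageI by blast
  then have fin: "finite ((\<lambda>n. \<bar>n\<bar>) ` fst ` bad)" by simp
  \<comment> \<open>The inserted 0 makes the maximum meaningful when there is no exceptional
    mesh.\<close>
  define B where "B = Max (insert 0 ((\<lambda>n. \<bar>n\<bar>) ` fst ` bad))"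
  have B: "\<bar>n\<bar> \<le> B" if "x \<in> verts T" "\<pi> (n, x) \<in> {iso_class C M, iso_class C (sh M)}" for n x
  proof -
    have "(n, x) \<in> bad" using that by (simp add: bad_def)
    then have "\<bar>n\<bar> \<in> (\<lambda>n. \<bar>n\<bar>) ` fst ` bad" by force
    then show ?thesis unfolding B_def using fin by simp
  qed
  \<comment> \<open>A mesh is exceptional only through its end vertex, so the tail may start in
    slice \<open>B\<close> itself: its first mesh ends in slice \<open>B + 1\<close>.\<close>
  have upper: "class_dim M (\<pi> (n, x)) = 0" if x: "x \<in> verts T" and n: "B \<le> n" for n x
  proof -
    interpret finite_type_form "verts T" \<Omega> "\<lambda>z x. fst (val T z x)" c d using form by blast
    have "class_dim M (\<pi> (B + int k, x)) = 0" for k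
    proof (rule additive_zero[OF _ x, where f = "\<lambda>k x. class_dim M (\<pi> (B + int k, x))"])
      fix k x assume x: "x \<in> verts T"
      have eq: "B + int (Suc k) = B + int k + 1" by simp
      have "\<pi> (B + int k + 1, x) \<notin> {iso_class C M, iso_class C (sh M)}" using B[OF x, of "B + int k + 1"] by auto
      then show "class_dim M (\<pi> (B + int k, x)) + class_dim M (\<pi> (B + int (Suc k), x)) =
        (\<Sum>z\<in>verts T. if (z, x) \<in> \<Omega> then fst (val T z x) * class_dim M (\<pi> (B + int (Suc k), z)) else 0) +
        (\<Sum>z\<in>verts T. if (x, z) \<in> \<Omega> then fst (val T z x) * class_dim M (\<pi> (B + int k, z)) else 0)"
        unfolding eq using cover_additive[OF x M, of "B + int k"] by simp
    qed
    from this[of "nat (n - B)"] show ?thesis using n by simp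
  qed
  \<comment> \<open>Going left, the mesh between the slices \<open>l\<close> and
    \<open>l + 1\<close> ends in slice \<open>l + 1\<close>, the one nearer to the start; this
    already has to lie below \<open>- B\<close>, hence the start at \<open>- B - 1\<close>.\<close>
  have lower: "class_dim M (\<pi> (n, x)) = 0" if x: "x \<in> verts T" and n: "n \<le> - B - 1" for n x
  proof -
    interpret finite_type_form "verts T" "\<Omega>\<inverse>" "\<lambda>z x. fst (val T z x)" c d using form by blast
    have "class_dim M (\<pi> (- B - 1 - int k, x)) = 0" for k
    proof (rule additive_zero[OF _ x, where f = "\<lambda>k x. class_dim M (\<pi> (- B - 1 - int k, x))"])
      fix k x assume x: "x \<in> verts T"
      define l where "l = - B - 1 - int (Suc k)"
      have eq: "- B - 1 - int k = l + 1" by (simp add: l_def)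
      have "\<pi> (- B - 1 - int k, x) \<notin> {iso_class C M, iso_class C (sh M)}" using B[OF x, of "- B - 1 - int k"] by auto
      then show "class_dim M (\<pi> (- B - 1 - int k, x)) + class_dim M (\<pi> (- B - 1 - int (Suc k), x)) =
        (\<Sum>z\<in>verts T. if (z, x) \<in> \<Omega>\<inverse> then fst (val T z x) * class_dim M (\<pi> (- B - 1 - int (Suc k), z)) else 0) +
        (\<Sum>z\<in>verts T. if (x, z) \<in> \<Omega>\<inverse> then fst (val T z x) * class_dim M (\<pi> (- B - 1 - int k, z)) else 0)"
        unfolding eq l_def[symmetric] using cover_additive[OF x M, of l] by (simp add: add.commute)
    qed
    from this[of "nat (- B - 1 - n)"] show ?thesis using n by simp
  qed
  have "{x \<in> \<Gamma>. class_dim M x \<noteq> 0} \<subseteq> \<pi> ` ({- B..B} \<times> verts T)"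
  proof
    fix y assume y: "y \<in> {x \<in> \<Gamma>. class_dim M x \<noteq> 0}"
    then obtain n x where nx: "x \<in> verts T" "y = \<pi> (n, x)" using coverE by blast
    then have "- B \<le> n \<and> n \<le> B" using upper[OF nx(1), of n] lower[OF nx(1), of n] y by fastforce
    then show "y \<in> \<pi> ` ({- B..B} \<times> verts T)" using nx by auto
  qed
  then show ?thesis by (rule finite_subset) (simp add: finite_verts)
qed simp

end

section \<open>Shift and translation\<close>

lemma funpow_closed: "(\<And>y. y \<in> A \<Longrightarrow> f y \<in> A) \<Longrightarrow> y \<in> A \<Longrightarrow> (f ^^ n) y \<in> A"
  by (induction n) auto

text \<open>Relative to a set, because \<tau> is a definite description that is meaningful only
  where triangles exist.\<close>

lemma funpow_commute_on:
  assumes f: "\<And>y. y \<in> A \<Longrightarrow> f y \<in> A" and g: "\<And>y. y \<in> A \<Longrightarrow> g y \<in> A"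
    and comm: "\<And>y. y \<in> A \<Longrightarrow> f (g y) = g (f y)" and y: "y \<in> A"
  shows "(f ^^ m) ((g ^^ n) y) = (g ^^ n) ((f ^^ m) y)"
proof -
  have one: "f ((g ^^ n) z) = (g ^^ n) (f z)" if z: "z \<in> A" for z
  proof (induction n)
    case (Suc n)
    then show ?case using comm[OF funpow_closed[of A g z n, OF g z]] by simp
  qed simp
  show ?thesis
  proof (induction m)
    case (Suc m)
    then show ?case using one[OF funpow_closed[of A f y m, OF f y]] by simp
  qed simp
qed

lemma funpow_comp_on:
  assumes f: "\<And>y. y \<in> A \<Longrightarrow> f y \<in> A" and g: "\<And>y. y \<in> A \<Longrightarrow> g y \<in> A"
    and comm: "\<And>y. y \<in> A \<Longrightarrow> f (g y) = g (f y)" and y: "y \<in> A"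
  shows "((\<lambda>y. f (g y)) ^^ n) y = (f ^^ n) ((g ^^ n) y)"
proof (induction n)
  case (Suc n)
  have "(f ^^ n) ((g ^^ 1) ((g ^^ n) y)) = (g ^^ 1) ((f ^^ n) ((g ^^ n) y))"
    using funpow_commute_on[of A f g, OF f g comm] funpow_closed[of A g y n, OF g y] by blast
  then show ?case using Suc by simp
qed simp

lemma funpow_inj_on:
  assumes f: "\<And>y. y \<in> A \<Longrightarrow> f y \<in> A" and inj: "inj_on f A" and "y \<in> A" "z \<in> A" "(f ^^ n) y = (f ^^ n) z"
  shows "y = z"
  using assms(5)
proof (induction n)
  case (Suc n)
  then show ?case
    using inj_onD[OF inj, of "(f ^^ n) y" "(f ^^ n) z"] funpow_closed[of A f, OF f] assms(3,4) by simp
qed simp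

context krull_schmidt_triangulated
begin

lemma shift_power_ob: "X \<in> Ob C \<Longrightarrow> (sh ^^ n) X \<in> Ob C"
  by (induction n) (auto simp: shift_ob)

lemma isomorphic_shift_power_iff:
  "X \<in> Ob C \<Longrightarrow> Y \<in> Ob C \<Longrightarrow> isomorphic C ((sh ^^ n) X) ((sh ^^ n) Y) \<longleftrightarrow> isomorphic C X Y"
  by (induction n) (simp_all add: isomorphic_shift_iff shift_power_ob)

lemma shift_power_add: "(sh ^^ (m + n)) X = (sh ^^ m) ((sh ^^ n) X)"
  by (simp add: funpow_add)

text \<open>Two exponents replace a signed one: the shift cannot be inverted on objects, but common
  powers cancel by full faithfulness. In this symmetric form relations can be chained by raising
  both sides to a common power.\<close>

lemma shift_orbit_rel_iff:
  assumes X: "indecomposable C X" and Y: "indecomposable C Y"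
  shows "(iso_class C X, iso_class C Y) \<in> shift_orbit_rel C \<longleftrightarrow> (\<exists>a b. isomorphic C ((sh ^^ a) X) ((sh ^^ b) Y))"
proof
  have ob: "X \<in> Ob C" "Y \<in> Ob C" using X Y indecomposable_ob by auto
  {
    assume "(iso_class C X, iso_class C Y) \<in> shift_orbit_rel C"
    then obtain X' Y' n where c: "iso_class C X = iso_class C X'" "iso_class C Y = iso_class C Y'"
      and ind: "indecomposable C X'" "indecomposable C Y'"
      and n: "isomorphic C ((sh ^^ n) X') Y' \<or> isomorphic C ((sh ^^ n) Y') X'"
      by (auto simp: shift_orbit_rel_def)
    have ob': "X' \<in> Ob C" "Y' \<in> Ob C" using ind indecomposable_ob by auto
    have iso: "isomorphic C X X'" "isomorphic C Y Y'" using c iso_class_eq_iff ob ob' by auto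
    have ison: "isomorphic C ((sh ^^ n) X) ((sh ^^ n) X')" "isomorphic C ((sh ^^ n) Y) ((sh ^^ n) Y')"
      using iso isomorphic_shift_power_iff ob ob' by auto
    from n have "isomorphic C ((sh ^^ n) X) Y \<or> isomorphic C X ((sh ^^ n) Y)"
    proof
      assume "isomorphic C ((sh ^^ n) X') Y'"
      then show ?thesis using isomorphic_trans[OF isomorphic_trans[OF ison(1)] isomorphic_sym[OF iso(2)]] by blast
    next
      assume "isomorphic C ((sh ^^ n) Y') X'"
      then show ?thesis
        using isomorphic_sym[OF isomorphic_trans[OF isomorphic_trans[OF ison(2)] isomorphic_sym[OF iso(1)]]] by blast
    qed
    then have "isomorphic C ((sh ^^ n) X) ((sh ^^ 0) Y) \<or> isomorphic C ((sh ^^ 0) X) ((sh ^^ n) Y)" by simp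
    then show "\<exists>a b. isomorphic C ((sh ^^ a) X) ((sh ^^ b) Y)" by blast
  next
    assume "\<exists>a b. isomorphic C ((sh ^^ a) X) ((sh ^^ b) Y)"
    then obtain a b where ab: "isomorphic C ((sh ^^ a) X) ((sh ^^ b) Y)" by blast
    have "\<exists>n. isomorphic C ((sh ^^ n) X) Y \<or> isomorphic C ((sh ^^ n) Y) X"
    proof (cases "b \<le> a")
      case True
      then have "isomorphic C ((sh ^^ b) ((sh ^^ (a - b)) X)) ((sh ^^ b) Y)"
        using ab shift_power_add[of b "a - b" X] by simp
      then show ?thesis using isomorphic_shift_power_iff shift_power_ob ob by blast
    next
      case False
      then have "isomorphic C ((sh ^^ a) X) ((sh ^^ a) ((sh ^^ (b - a)) Y))"
        using ab shift_power_add[of a "b - a" Y] by simp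
      then show ?thesis using isomorphic_shift_power_iff shift_power_ob ob isomorphic_sym by blast
    qed
    then show "(iso_class C X, iso_class C Y) \<in> shift_orbit_rel C"
      using X Y by (auto simp: shift_orbit_rel_def)
  }
qed

lemma shift_orbit_rel_vertices: "(x, y) \<in> shift_orbit_rel C \<Longrightarrow> x \<in> AR_vertices C \<and> y \<in> AR_vertices C"
  by (auto simp: shift_orbit_rel_def AR_vertices_def)

lemma equiv_shift_orbit_rel: "equiv (AR_vertices C) (shift_orbit_rel C)"
proof (rule equivI)
  show "shift_orbit_rel C \<subseteq> AR_vertices C \<times> AR_vertices C" using shift_orbit_rel_vertices by auto
  show "refl_on (AR_vertices C) (shift_orbit_rel C)"
  proof (rule refl_onI)
    fix x assume "x \<in> AR_vertices C"
    then obtain X where X: "indecomposable C X" "x = iso_class C X" by (rule AR_vertexE)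
    have "isomorphic C ((sh ^^ 0) X) ((sh ^^ 0) X)" using X isomorphic_refl indecomposable_ob by simp
    then show "(x, x) \<in> shift_orbit_rel C" using shift_orbit_rel_iff X by blast
  qed
  show "sym (shift_orbit_rel C)" by (auto simp: sym_def shift_orbit_rel_def)
  show "trans (shift_orbit_rel C)"
  proof (rule transI)
    fix x y z assume xy: "(x, y) \<in> shift_orbit_rel C" and yz: "(y, z) \<in> shift_orbit_rel C"
    obtain X where X: "indecomposable C X" "x = iso_class C X" using xy shift_orbit_rel_vertices AR_vertexE by metis
    obtain Y where Y: "indecomposable C Y" "y = iso_class C Y" using xy shift_orbit_rel_vertices AR_vertexE by metis
    obtain Z where Z: "indecomposable C Z" "z = iso_class C Z" using yz shift_orbit_rel_vertices AR_vertexE by metis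
    have ob: "X \<in> Ob C" "Y \<in> Ob C" "Z \<in> Ob C" using X Y Z indecomposable_ob by auto
    obtain a b where ab: "isomorphic C ((sh ^^ a) X) ((sh ^^ b) Y)" using xy shift_orbit_rel_iff X Y by blast
    obtain e f where ef: "isomorphic C ((sh ^^ e) Y) ((sh ^^ f) Z)" using yz shift_orbit_rel_iff Y Z by blast
    have "isomorphic C ((sh ^^ (e + a)) X) ((sh ^^ (e + b)) Y)"
      using ab isomorphic_shift_power_iff shift_power_ob ob by (simp add: shift_power_add)
    moreover have "isomorphic C ((sh ^^ (b + e)) Y) ((sh ^^ (b + f)) Z)"
      using ef isomorphic_shift_power_iff shift_power_ob ob by (simp add: shift_power_add)
    ultimately have "isomorphic C ((sh ^^ (e + a)) X) ((sh ^^ (b + f)) Z)"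
      using isomorphic_trans by (simp add: add.commute)
    then show "(x, z) \<in> shift_orbit_rel C" using shift_orbit_rel_iff X Z by blast
  qed
qed

definition shift_class :: "'o set \<Rightarrow> 'o set" where
  "shift_class x = iso_class C (sh (SOME X. X \<in> x))"

lemma shift_class_eq:
  assumes X: "indecomposable C X" shows "shift_class (iso_class C X) = iso_class C (sh X)"
proof -
  have "(SOME Y. Y \<in> iso_class C X) \<in> iso_class C X"
    using self_mem_iso_class[OF X] someI[of "\<lambda>Y. Y \<in> iso_class C X" X] by blast
  then have iso: "isomorphic C X (SOME Y. Y \<in> iso_class C X)" using mem_iso_class by blast
  have ob: "X \<in> Ob C" "(SOME Y. Y \<in> iso_class C X) \<in> Ob C" using iso by (auto simp: isomorphic_def)
  have "isomorphic C (sh X) (sh (SOME Y. Y \<in> iso_class C X))" using iso isomorphic_shift_iff ob by blast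
  then show ?thesis unfolding shift_class_def using iso_class_eq_iff shift_ob ob by blast
qed

lemma shift_class_power:
  assumes X: "indecomposable C X" shows "(shift_class ^^ n) (iso_class C X) = iso_class C ((sh ^^ n) X)"
proof -
  have ind: "indecomposable C ((sh ^^ n) X)" for n
    using X by (induction n) (auto simp: indecomposable_shift_iff indecomposable_ob)
  show ?thesis by (induction n) (simp_all add: shift_class_eq[OF ind])
qed

lemma shift_orbit_rel_power:
  assumes "x \<in> AR_vertices C" "(shift_class ^^ n) x \<in> AR_vertices C"
  shows "(x, (shift_class ^^ n) x) \<in> shift_orbit_rel C"
proof -
  obtain X where X: "indecomposable C X" "x = iso_class C X" using assms(1) by (rule AR_vertexE)
  have ob: "(sh ^^ n) X \<in> Ob C" using X indecomposable_ob shift_power_ob by blast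
  have "(sh ^^ n) X \<in> (shift_class ^^ n) x"
    using shift_class_power[OF X(1)] X(2) isomorphic_refl[OF ob] mem_iso_class by simp
  then have ind: "indecomposable C ((sh ^^ n) X)" using AR_vertex_member[OF assms(2)] by blast
  have "isomorphic C ((sh ^^ n) X) ((sh ^^ 0) ((sh ^^ n) X))" using isomorphic_refl[OF ob] by simp
  then have "(iso_class C X, iso_class C ((sh ^^ n) X)) \<in> shift_orbit_rel C"
    using shift_orbit_rel_iff[OF X(1) ind] by blast
  then show ?thesis using shift_class_power[OF X(1)] X(2) by simp
qed

end

section \<open>Non-zero morphisms, shift and translation inside the component\<close>

context tree_class_component
begin

abbreviation tau where "tau \<equiv> AR_translate C"

lemma rep:
  assumes "x \<in> \<Gamma>" obtains X where "indecomposable C X" "x = iso_class C X"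
  using assms vertices AR_vertexE by blast

lemma hom_path:
  assumes N: "indecomposable C N" "iso_class C N \<in> \<Gamma>" and M: "indecomposable C M" "nonzero_hom C N M"
  shows "(iso_class C N, iso_class C M) \<in> (AR_arrows C \<inter> \<Gamma> \<times> \<Gamma>)\<^sup>*"
proof (rule path_of_nonzero_hom[OF _ _ N _ M])
  show "\<exists>V W u v w. AR_triangle C X V W u v w" if "indecomposable C X" "iso_class C X \<in> \<Gamma>" for X
    using component_AR_starting[OF stable that] by metis
  show "y \<in> \<Gamma>" if "x \<in> \<Gamma>" "(x, y) \<in> AR_arrows C" for x y
    using component_closed(1)[OF stable that] .
  have "{x \<in> \<Gamma>. \<exists>X\<in>x. nonzero_hom C N X} \<subseteq> {x \<in> \<Gamma>. class_dim N x \<noteq> 0}"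
  proof
    fix x assume "x \<in> {x \<in> \<Gamma>. \<exists>X\<in>x. nonzero_hom C N X}"
    then obtain X where x: "x \<in> \<Gamma>" "X \<in> x" "nonzero_hom C N X" by blast
    then have X: "indecomposable C X" "x = iso_class C X" using AR_vertex_member vertices by blast+
    then show "x \<in> {x \<in> \<Gamma>. class_dim N x \<noteq> 0}"
      using x class_dim_eq[OF N(1) X(1)] hom_dim_zero_iff[OF N(1) indecomposable_ob[OF X(1)]] by simp
  qed
  then show "finite {x \<in> \<Gamma>. \<exists>X\<in>x. nonzero_hom C N X}" using finite_support[OF N(1)] finite_subset by blast
qed

lemma hom_closed:
  assumes N: "indecomposable C N" "iso_class C N \<in> \<Gamma>" and M: "indecomposable C M" "nonzero_hom C N M"
  shows "iso_class C M \<in> \<Gamma>"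
  using hom_path[OF N M] N(2) by (cases rule: rtranclE) auto

text \<open>By \<open>hom_closed\<close> all targets lie in \<Gamma>, so
  \<open>finite_support\<close>, which speaks of \<Gamma> only, bounds all of them.\<close>

lemma hom_classes_finite:
  assumes N: "indecomposable C N" "iso_class C N \<in> \<Gamma>"
  shows "finite (iso_class C ` {Y. indecomposable C Y \<and> nonzero_hom C N Y})"
proof -
  have "iso_class C ` {Y. indecomposable C Y \<and> nonzero_hom C N Y} \<subseteq> {x \<in> \<Gamma>. class_dim N x \<noteq> 0}"
  proof
    fix x assume "x \<in> iso_class C ` {Y. indecomposable C Y \<and> nonzero_hom C N Y}"
    then obtain Y where Y: "indecomposable C Y" "nonzero_hom C N Y" "x = iso_class C Y" by blast
    then show "x \<in> {x \<in> \<Gamma>. class_dim N x \<noteq> 0}"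
      using hom_closed[OF N Y(1,2)] class_dim_eq[OF N(1) Y(1)] hom_dim_zero_iff[OF N(1) indecomposable_ob[OF Y(1)]]
      by simp
  qed
  then show ?thesis using finite_support[OF N(1)] finite_subset by blast
qed

lemma translate_mem: "y \<in> \<Gamma> \<Longrightarrow> tau y \<in> \<Gamma>"
  by (erule coverE) (simp add: cover_translate cover_mem)

text \<open>Read on the cover: an identification of \<open>(n - 1, x)\<close> with
  \<open>(n' - 1, x')\<close> moves up by one slice.\<close>

lemma translate_inj: "inj_on tau \<Gamma>"
proof (rule inj_onI)
  fix y y' assume yy: "y \<in> \<Gamma>" "y' \<in> \<Gamma>" and eq: "tau y = tau y'"
  obtain n x where x: "x \<in> verts T" "y = \<pi> (n, x)" using yy(1) by (rule coverE)
  obtain n' x' where x': "x' \<in> verts T" "y' = \<pi> (n', x')" using yy(2) by (rule coverE)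
  have "\<pi> (n - 1, x) = \<pi> (n' - 1, x')" using eq cover_translate x x' by simp
  then show "y = y'" using fibre_translate[OF x(1) x'(1), of "n - 1" "n' - 1" 1] x(2) x'(2) by simp
qed

lemma translate_power: "x \<in> verts T \<Longrightarrow> (tau ^^ j) (\<pi> (n, x)) = \<pi> (n - int j, x)"
  by (induction j) (simp_all add: cover_translate algebra_simps)

text \<open>The connecting morphism \<open>W \<rightarrow> U[1]\<close> is non-zero, so \<open>(\<tau> W)[1]\<close> is reached from \<open>W\<close> inside the component.\<close>

lemma path_to_shifted_translate:
  assumes y: "y \<in> \<Gamma>"
  shows "(y, shift_class (tau y)) \<in> (AR_arrows C \<inter> \<Gamma> \<times> \<Gamma>)\<^sup>*"
proof -
  obtain W where W: "indecomposable C W" "y = iso_class C W" using y by (rule rep)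
  have W\<Gamma>: "iso_class C W \<in> \<Gamma>" using y W by simp
  obtain U V u v w where AR: "AR_triangle C U V W u v w" using component_AR_ending[OF stable W(1) W\<Gamma>] .
  have U: "indecomposable C U" using AR by (simp add: AR_triangle_def)
  have "nonzero_hom C W (sh U)" using AR_arr(3)[OF AR] AR_nonzero[OF AR] by (auto simp: nonzero_hom_def arr_def)
  then have "(y, iso_class C (sh U)) \<in> (AR_arrows C \<inter> \<Gamma> \<times> \<Gamma>)\<^sup>*"
    using hom_path[OF W(1) W\<Gamma>] U indecomposable_shift_iff indecomposable_ob W(2) by blast
  then show ?thesis using AR_translate_eq[OF AR_translate_relI[OF AR]] shift_class_eq[OF U] W(2) by simp
qed

lemma path_mem: "(y, z) \<in> (AR_arrows C \<inter> \<Gamma> \<times> \<Gamma>)\<^sup>* \<Longrightarrow> y \<in> \<Gamma> \<Longrightarrow> z \<in> \<Gamma>"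
  by (erule rtranclE) auto

text \<open>Every \<open>y\<close> in \<Gamma> is the translate of a vertex, from which a path
  inside \<Gamma> leads to \<open>y[1]\<close>.\<close>

lemma shift_class_mem:
  assumes y: "y \<in> \<Gamma>" shows "shift_class y \<in> \<Gamma>"
proof -
  obtain n x where x: "x \<in> verts T" "y = \<pi> (n, x)" using y by (rule coverE)
  then have "y = tau (\<pi> (n + 1, x))" using cover_translate[OF x(1), of "n + 1"] by simp
  then show ?thesis using path_to_shifted_translate[of "\<pi> (n + 1, x)"] path_mem cover_mem[OF x(1)] by metis
qed

lemma shift_class_inj: "inj_on shift_class \<Gamma>"
proof (rule inj_onI)
  fix x y assume xy: "x \<in> \<Gamma>" "y \<in> \<Gamma>" and eq: "shift_class x = shift_class y"
  obtain X where X: "indecomposable C X" "x = iso_class C X" using xy(1) by (rule rep)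
  obtain Y where Y: "indecomposable C Y" "y = iso_class C Y" using xy(2) by (rule rep)
  have ob: "X \<in> Ob C" "Y \<in> Ob C" using X Y indecomposable_ob by auto
  have "iso_class C (sh X) = iso_class C (sh Y)" using eq X Y shift_class_eq by simp
  then show "x = y"
    using X(2) Y(2) iso_class_eq_iff[OF shift_ob[OF ob(1)] shift_ob[OF ob(2)]] isomorphic_shift_iff[OF ob]
      iso_class_eq_iff[OF ob] by simp
qed

lemma shift_translate:
  assumes y: "y \<in> \<Gamma>" shows "shift_class (tau y) = tau (shift_class y)"
proof -
  obtain W where W: "indecomposable C W" "y = iso_class C W" using y by (rule rep)
  have W\<Gamma>: "iso_class C W \<in> \<Gamma>" using y W by simp
  obtain U V u v w where AR: "AR_triangle C U V W u v w" using component_AR_ending[OF stable W(1) W\<Gamma>] .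
  have U: "indecomposable C U" using AR by (simp add: AR_triangle_def)
  show ?thesis
    using AR_translate_eq[OF AR_translate_relI[OF AR]] AR_translate_eq[OF AR_translate_relI[OF AR_shift[OF AR]]]
      shift_class_eq[OF U] shift_class_eq[OF W(1)] W(2) by simp
qed

text \<open>Successors lift along the covering, and no arrow of \<int>T decreases the slice
  number.\<close>

lemma path_lift:
  assumes "(\<pi> (n, x), z) \<in> (AR_arrows C \<inter> \<Gamma> \<times> \<Gamma>)\<^sup>*" "x \<in> verts T"
  shows "\<exists>m y. n \<le> m \<and> y \<in> verts T \<and> z = \<pi> (m, y)"
  using assms(1)
proof (induction rule: rtrancl_induct)
  case base
  then show ?case using assms(2) by blast
next
  case (step z z')
  then obtain m y where my: "n \<le> m" "y \<in> verts T" "z = \<pi> (m, y)" by blast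
  have "z' \<in> {z. (\<pi> (m, y), z) \<in> AR_arrows C}" using step(2) my by blast
  then obtain q where q: "((m, y), q) \<in> q_arrows (Z_quiver T \<Omega>)" "z' = \<pi> q"
    using bij_betw_imp_surj_on[OF cover_successors[OF my(2), of m]] by blast
  obtain m' y' where q_eq: "q = (m', y')" by (cases q)
  have "m \<le> m'" "y' \<in> verts T" using q(1) \<Omega>_verts by (auto simp: q_eq Z_arrow_iff)
  then show ?case using q(2) q_eq my(1) order_trans by blast
qed

text \<open>Let \<Phi> be \<tau> followed by [1]. Its iterates on \<open>y\<close> lift to points of
  \<int>T with non-decreasing slice numbers, and two of them, for exponents \<open>a < b\<close>,
  share a column. If they are \<open>e\<close> slices apart, then \<open>e\<close> translations undo
  the \<open>b - a\<close> further steps.\<close>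

lemma shift_translate_periodic:
  assumes y: "y \<in> \<Gamma>"
  shows "\<exists>i c. 0 < i \<and> 0 < c \<and> (shift_class ^^ i) ((tau ^^ c) y) = y"
proof -
  let ?\<Phi> = "\<lambda>y. shift_class (tau y)"
  have \<Phi>_mem: "?\<Phi> z \<in> \<Gamma>" if "z \<in> \<Gamma>" for z using that translate_mem shift_class_mem by blast
  have \<Phi>_inj: "inj_on ?\<Phi> \<Gamma>"
    using translate_mem inj_onD[OF translate_inj] inj_onD[OF shift_class_inj] by (intro inj_onI) blast
  have \<Phi>_tau: "?\<Phi> (tau z) = tau (?\<Phi> z)" if "z \<in> \<Gamma>" for z using shift_translate translate_mem that by simp
  obtain n0 x0 where x0: "x0 \<in> verts T" "y = \<pi> (n0, x0)" using y by (rule coverE)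
  have "\<exists>q. \<forall>j. (snd (q j) \<in> verts T \<and> \<pi> (q j) = (?\<Phi> ^^ j) y) \<and> fst (q j) \<le> fst (q (Suc j))"
  proof (rule dependent_nat_choice)
    show "\<exists>q. snd q \<in> verts T \<and> \<pi> q = (?\<Phi> ^^ 0) y" using x0 by (intro exI[of _ "(n0, x0)"]) simp
    fix q j assume q: "snd q \<in> verts T \<and> \<pi> q = (?\<Phi> ^^ j) y"
    obtain n x where q_eq: "q = (n, x)" by (cases q)
    have x: "x \<in> verts T" "\<pi> (n, x) = (?\<Phi> ^^ j) y" using q q_eq by auto
    have "(\<pi> (n, x), ?\<Phi> (\<pi> (n, x))) \<in> (AR_arrows C \<inter> \<Gamma> \<times> \<Gamma>)\<^sup>*"
      using path_to_shifted_translate[OF cover_mem[OF x(1)]] .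
    then obtain m z where "n \<le> m" "z \<in> verts T" "?\<Phi> (\<pi> (n, x)) = \<pi> (m, z)" using path_lift x(1) by blast
    then show "\<exists>q'. (snd q' \<in> verts T \<and> \<pi> q' = (?\<Phi> ^^ Suc j) y) \<and> fst q \<le> fst q'"
      using x(2) q_eq by (intro exI[of _ "(m, z)"]) simp
  qed
  then obtain q where q: "\<And>j. snd (q j) \<in> verts T" "\<And>j. \<pi> (q j) = (?\<Phi> ^^ j) y" "\<And>j. fst (q j) \<le> fst (q (Suc j))"
    by blast
  have "range (\<lambda>j. snd (q j)) \<subseteq> verts T" using q(1) by auto
  then have "finite (range (\<lambda>j. snd (q j)))" using finite_verts by (rule finite_subset)
  then have "\<not> inj (\<lambda>j. snd (q j))" using finite_imageD infinite_UNIV_nat by blast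
  then obtain a b where "a \<noteq> b" "snd (q a) = snd (q b)" unfolding inj_def by blast
  then obtain a b where ab: "a < b" "snd (q a) = snd (q b)" by (metis nat_neq_iff)
  define x where "x = snd (q a)"
  define n where "n = fst (q a)"
  define e where "e = nat (fst (q b) - n)"
  define i where "i = b - a"
  have "n \<le> fst (q b)" unfolding n_def using lift_Suc_mono_le[of "\<lambda>j. fst (q j)" a b] q(3) ab(1) by simp
  then have qb: "q b = (n + int e, x)" and qa: "q a = (n, x)"
    using ab(2) by (auto simp: x_def n_def e_def prod_eq_iff)
  have x: "x \<in> verts T" using q(1) by (simp add: x_def)
  have i: "0 < i" "b = a + i" using ab(1) by (auto simp: i_def)
  have "(tau ^^ e) ((?\<Phi> ^^ b) y) = (?\<Phi> ^^ a) y"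
    using q(2)[of b] q(2)[of a] translate_power[OF x, of e "n + int e"] qa qb by simp
  moreover have "(?\<Phi> ^^ a) ((tau ^^ e) z) = (tau ^^ e) ((?\<Phi> ^^ a) z)" if "z \<in> \<Gamma>" for z
    by (rule funpow_commute_on[of \<Gamma> ?\<Phi> tau, OF \<Phi>_mem translate_mem \<Phi>_tau that])
  \<comment> \<open>As \<tau> commutes with \<Phi>, the common power \<open>a\<close> can be moved
    to the outside, where injectivity cancels it.\<close>
  ultimately have "(?\<Phi> ^^ a) ((tau ^^ e) ((?\<Phi> ^^ i) y)) = (?\<Phi> ^^ a) y"
    using funpow_closed[of \<Gamma> ?\<Phi> y i, OF \<Phi>_mem y] by (simp add: i(2) funpow_add)
  then have "(tau ^^ e) ((?\<Phi> ^^ i) y) = y"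
    using funpow_inj_on[of \<Gamma> ?\<Phi>, OF \<Phi>_mem \<Phi>_inj] funpow_closed[of \<Gamma> tau, OF translate_mem]
      funpow_closed[of \<Gamma> ?\<Phi> y i, OF \<Phi>_mem y] y by blast
  moreover have "(?\<Phi> ^^ i) y = (shift_class ^^ i) ((tau ^^ i) y)"
    by (rule funpow_comp_on[of \<Gamma> shift_class tau, OF shift_class_mem translate_mem shift_translate y])
  moreover have "(shift_class ^^ i) ((tau ^^ e) ((tau ^^ i) y)) = (tau ^^ e) ((shift_class ^^ i) ((tau ^^ i) y))"
    by (rule funpow_commute_on[of \<Gamma> shift_class tau, OF shift_class_mem translate_mem shift_translate
          funpow_closed[of \<Gamma> tau y i, OF translate_mem y]])
  \<comment> \<open>The \<open>i\<close> steps of \<Phi> contribute \<open>i\<close> further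
    translations, so the exponent \<open>e + i\<close> is positive even if
    \<open>e = 0\<close>.\<close>
  ultimately have "(shift_class ^^ i) ((tau ^^ (e + i)) y) = y" by (simp add: funpow_add)
  then show ?thesis using i(1) by (intro exI[of _ i] exI[of _ "e + i"]) simp
qed

text \<open>Since the shift exponent in the periodicity relation is positive, its outermost factor
  exhibits \<open>y\<close> as a shift.\<close>

lemma shift_class_surj:
  assumes y: "y \<in> \<Gamma>" obtains x where "x \<in> \<Gamma>" "y = shift_class x"
proof -
  obtain i e where ie: "0 < i" "(shift_class ^^ i) ((tau ^^ e) y) = y"
    using shift_translate_periodic[OF y] by blast
  obtain j where j: "i = Suc j" using ie(1) gr0_conv_Suc by blast
  have "(shift_class ^^ j) ((tau ^^ e) y) \<in> \<Gamma>"
    using funpow_closed[of \<Gamma> shift_class, OF shift_class_mem] funpow_closed[of \<Gamma> tau y e, OF translate_mem y] by blast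
  then show ?thesis using that ie(2) j by simp
qed

text \<open>Write \<open>N\<close> as \<open>U[1]\<close> and let \<open>W\<close> end the triangle
  starting at \<open>U\<close>. By \<open>AR_serre\<close> the connecting morphism factors through
  every non-zero \<open>M \<rightarrow> U[1]\<close>, which gives a non-zero
  \<open>W \<rightarrow> M\<close>. As \<open>W\<close> depends on \<open>N\<close> alone,
  finiteness of outgoing morphisms yields finiteness of incoming ones.\<close>

lemma hom_into_component:
  assumes N: "indecomposable C N" "iso_class C N \<in> \<Gamma>"
  obtains W where "indecomposable C W" "iso_class C W \<in> \<Gamma>"
    "\<forall>M \<in> Ob C. nonzero_hom C M N \<longrightarrow> nonzero_hom C W M"
proof -
  obtain x where x: "x \<in> \<Gamma>" "iso_class C N = shift_class x" using N(2) by (rule shift_class_surj)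
  obtain U where U: "indecomposable C U" "x = iso_class C U" using x(1) by (rule rep)
  have ob: "N \<in> Ob C" "U \<in> Ob C" "sh U \<in> Ob C" using N U indecomposable_ob shift_ob by auto
  have "isomorphic C N (sh U)" using x U shift_class_eq iso_class_eq_iff ob by simp
  then obtain \<theta> where \<theta>: "arr N (sh U) \<theta>" "isomorphism C N (sh U) \<theta>" by (rule isomorphicE)
  obtain V W u v w where AR: "AR_triangle C U V W u v w" "iso_class C W \<in> \<Gamma>"
    using component_AR_starting[OF stable U(1)] x(1) U(2) by metis
  have W: "indecomposable C W" using AR by (simp add: AR_triangle_def)
  have "nonzero_hom C W M" if M: "M \<in> Ob C" and nz: "nonzero_hom C M N" for M
  proof -
    obtain f where f: "arr M N f" "f \<noteq> zero_mor M N" using nz M ob by (auto simp: nonzero_hom_def arr_def)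
    have \<theta>f: "arr M (sh U) (\<theta> \<cdot> f)" using comp_arr f \<theta> by blast
    have "\<theta> \<cdot> f \<noteq> zero_mor M (sh U)"
      using iso_cancel_left[OF \<theta>(2) f(1) zero_arr[OF M ob(1)] ob(3)] comp_zero_right[OF \<theta>(1) M] f(2) by auto
    then obtain h where h: "arr W M h" "(\<theta> \<cdot> f) \<cdot> h = w" using AR_serre[OF AR(1) \<theta>f] by blast
    have "h \<noteq> zero_mor W M"
      using h(2) comp_zero_right[OF \<theta>f indecomposable_ob[OF W]] AR_nonzero[OF AR(1)] by auto
    then show ?thesis using h(1) by (auto simp: nonzero_hom_def arr_def)
  qed
  then show ?thesis using that W AR(2) by blast
qed

text \<open>For \<open>M\<close> outside \<Gamma>, a non-zero \<open>N \<rightarrow> M\<close>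
  contradicts \<open>hom_closed\<close> at once, and a non-zero \<open>M \<rightarrow> N\<close>
  does so through the object \<open>W\<close> of \<open>hom_into_component\<close>. Inside and
  outside would thus separate the category.\<close>

lemma contains_all_indecomposables:
  assumes con: "connected_category C" and X: "indecomposable C X"
  shows "iso_class C X \<in> \<Gamma>"
proof (rule ccontr)
  assume nX: "iso_class C X \<notin> \<Gamma>"
  define A where "A = {X. indecomposable C X \<and> iso_class C X \<in> \<Gamma>}"
  define B where "B = {X. indecomposable C X \<and> iso_class C X \<notin> \<Gamma>}"
  obtain x where "x \<in> verts T" using tree by (auto simp: valued_tree_def)
  then have "\<pi> (0, x) \<in> \<Gamma>" by (rule cover_mem)
  then obtain N where "indecomposable C N" "\<pi> (0, x) = iso_class C N" by (rule rep)
  then have A: "A \<noteq> {}" using \<open>\<pi> (0, x) \<in> \<Gamma>\<close> by (auto simp: A_def)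
  have B: "B \<noteq> {}" using X nX by (auto simp: B_def)
  have AB: "A \<inter> B = {}" "A \<union> B = {X. indecomposable C X}" by (auto simp: A_def B_def)
  have orth: "\<not> nonzero_hom C N M \<and> \<not> nonzero_hom C M N" if "N \<in> A" "M \<in> B" for N M
  proof -
    have N: "indecomposable C N" "iso_class C N \<in> \<Gamma>" and M: "indecomposable C M" "iso_class C M \<notin> \<Gamma>"
      using that by (auto simp: A_def B_def)
    obtain W where W: "indecomposable C W" "iso_class C W \<in> \<Gamma>" "\<forall>M \<in> Ob C. nonzero_hom C M N \<longrightarrow> nonzero_hom C W M"
      using hom_into_component[OF N] .
    show ?thesis using hom_closed[OF N M(1)] hom_closed[OF W(1,2) M(1)] W(3) M indecomposable_ob by blast
  qed
  show False
    using con unfolding connected_category_def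
    by (rule notE) (intro exI[of _ A] exI[of _ B] conjI ballI A B AB; use orth in blast)
qed

lemma locally_finite_category:
  assumes all: "\<And>X. indecomposable C X \<Longrightarrow> iso_class C X \<in> \<Gamma>"
  shows "locally_finite K C"
  unfolding locally_finite_def
proof (intro conjI allI impI hom_fin)
  fix X assume X: "indecomposable C X"
  obtain W where W: "indecomposable C W" "\<forall>M \<in> Ob C. nonzero_hom C M X \<longrightarrow> nonzero_hom C W M"
    using hom_into_component[OF X all[OF X]] by blast
  have "iso_class C ` {Y. indecomposable C Y \<and> (nonzero_hom C X Y \<or> nonzero_hom C Y X)} \<subseteq>
    iso_class C ` {Y. indecomposable C Y \<and> nonzero_hom C X Y} \<union> iso_class C ` {Y. indecomposable C Y \<and> nonzero_hom C W Y}"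
    using W(2) indecomposable_ob by blast
  then show "finite (iso_class C ` {Y. indecomposable C Y \<and> (nonzero_hom C X Y \<or> nonzero_hom C Y X)})"
    by (rule finite_subset) (use hom_classes_finite X W(1) all in blast)
qed

lemma has_AR_triangles_category:
  assumes all: "\<And>X. indecomposable C X \<Longrightarrow> iso_class C X \<in> \<Gamma>"
  shows "has_AR_triangles C"
  unfolding has_AR_triangles_def
proof (intro allI impI conjI)
  fix X assume X: "indecomposable C X"
  show "\<exists>U V u v w. AR_triangle C U V X u v w"
    by (rule component_AR_ending[OF stable X all[OF X]]) blast
  show "\<exists>V W u v w. AR_triangle C X V W u v w"
    by (rule component_AR_starting[OF stable X all[OF X]]) blast
qed

text \<open>The shift commutes with \<tau>, so a relation at slice 0 governs the whole column: going
  down applies \<tau>, going up uses its injectivity.\<close>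

lemma shift_power_cover:
  assumes x: "x \<in> verts T" and base: "(shift_class ^^ i) (\<pi> (- e, x)) = \<pi> (0, x)"
  shows "(shift_class ^^ i) (\<pi> (n - e, x)) = \<pi> (n, x)"
proof -
  have comm: "(shift_class ^^ i) (tau z) = tau ((shift_class ^^ i) z)" if "z \<in> \<Gamma>" for z
    using funpow_commute_on[of \<Gamma> shift_class tau, OF shift_class_mem translate_mem shift_translate that, of i 1] by simp
  show ?thesis
  proof (induction n rule: int_induct[where k = 0])
    case base
    then show ?case using assms(2) by simp
  next
    case (step1 n)
    have "tau ((shift_class ^^ i) (\<pi> (n + 1 - e, x))) = tau (\<pi> (n + 1, x))"
      using comm[OF cover_mem[OF x, of "n + 1 - e"]] cover_translate[OF x, of "n + 1 - e"]
        cover_translate[OF x, of "n + 1"] step1(2) by (simp add: algebra_simps)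
    then show ?case
      using inj_onD[OF translate_inj] funpow_closed[of \<Gamma> shift_class, OF shift_class_mem] cover_mem[OF x] by blast
  next
    case (step2 n)
    then show ?case
      using comm[OF cover_mem[OF x, of "n - e"]] cover_translate[OF x, of "n - e"] cover_translate[OF x, of n]
      by (simp add: algebra_simps)
  qed
qed

text \<open>In each of the finitely many columns the shift orbit of \<open>(n, x)\<close> is
  periodic in \<open>n\<close>, the period being the positive number of translations from
  \<open>shift_translate_periodic\<close>.\<close>

lemma finite_shift_orbits:
  assumes all: "\<And>X. indecomposable C X \<Longrightarrow> iso_class C X \<in> \<Gamma>"
  shows "finite (AR_vertices C // shift_orbit_rel C)"
proof -
  let ?R = "shift_orbit_rel C"
  have fin: "finite (range (\<lambda>n. ?R `` {\<pi> (n, x)}))" if x: "x \<in> verts T" for x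
  proof -
    obtain i e where ie: "0 < e" "(shift_class ^^ i) ((tau ^^ e) (\<pi> (0, x))) = \<pi> (0, x)"
      using shift_translate_periodic[OF cover_mem[OF x]] by blast
    have power: "(shift_class ^^ i) (\<pi> (n - int e, x)) = \<pi> (n, x)" for n
      using shift_power_cover[OF x, of i "int e"] ie(2) translate_power[OF x] by simp
    have "?R `` {\<pi> (n + int e, x)} = ?R `` {\<pi> (n, x)}" for n
    proof -
      have "(\<pi> (n, x), \<pi> (n + int e, x)) \<in> ?R"
        using shift_orbit_rel_power[of "\<pi> (n, x)" i] power[of "n + int e"] cover_mem[OF x] vertices
        by (simp add: subset_iff)
      then show ?thesis using equiv_class_eq[OF equiv_shift_orbit_rel] by blast
    qed
    then show ?thesis using finite_range_periodic[of "int e" "\<lambda>n. ?R `` {\<pi> (n, x)}"] ie(1) by simp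
  qed
  have "AR_vertices C // ?R \<subseteq> (\<Union>x\<in>verts T. range (\<lambda>n. ?R `` {\<pi> (n, x)}))"
  proof
    fix A assume "A \<in> AR_vertices C // ?R"
    then obtain y where y: "y \<in> AR_vertices C" "A = ?R `` {y}" by (rule quotientE)
    then have "y \<in> \<Gamma>" using all AR_vertexE by metis
    then obtain n x where "x \<in> verts T" "y = \<pi> (n, x)" by (rule coverE)
    then show "A \<in> (\<Union>x\<in>verts T. range (\<lambda>n. ?R `` {\<pi> (n, x)}))" using y(2) by blast
  qed
  moreover have "finite (\<Union>x\<in>verts T. range (\<lambda>n. ?R `` {\<pi> (n, x)}))" using fin finite_verts by blast
  ultimately show ?thesis by (rule finite_subset)
qed

end

theorem theorem1p1:
  fixes K :: "('k, 'r) ring_scheme"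
    and C :: "('k, 'o, 'm, 'z) tri_cat_scheme"
    and \<Gamma> :: "'o set set"
    and T :: "'v valued_graph"
  assumes "triangulated_category K C"
    and "hom_finite K C"
    and "krull_schmidt C"
    and "connected_category C"
    and "stable_component C \<Gamma>"
    and "has_tree_class (AR_subquiver C \<Gamma>) T"
    and "is_dynkin T"
  shows "(\<forall>X. indecomposable C X \<longrightarrow> iso_class C X \<in> \<Gamma>) \<and>
    locally_finite K C \<and>
    has_AR_triangles C \<and>
    finite (AR_vertices C // shift_orbit_rel C)"
proof -
  have tree: "valued_tree T" using assms(6) by (simp add: has_tree_class_def)
  obtain \<Omega> G \<pi> where cover: "orientation T \<Omega>" "\<forall>g \<in> G. quiver_automorphism (Z_quiver T \<Omega>) g"
    "covering (Z_quiver T \<Omega>) (AR_subquiver C \<Gamma>) \<pi>"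
    "\<forall>p \<in> q_verts (Z_quiver T \<Omega>). \<forall>q \<in> q_verts (Z_quiver T \<Omega>). \<pi> p = \<pi> q \<longleftrightarrow> (\<exists>g \<in> G. g p = q)"
    using assms(6) unfolding has_tree_class_def by blast
  obtain c d where weights: "finite_type_weights T c d" using dynkin_weights[OF tree assms(7)] by blast
  interpret triangulated_category K C by (rule assms(1))
  interpret tree_class_component K C \<Gamma> T \<Omega> G \<pi> c d
  proof unfold_locales
    show "hom_finite K C" "krull_schmidt C" "stable_component C \<Gamma>" by (fact assms)+
    show "valued_tree T" by (fact tree)
    show "orientation T \<Omega>" by (fact cover(1))
    show "quiver_automorphism (Z_quiver T \<Omega>) g" if "g \<in> G" for g using cover(2) that by blast
    show "covering (Z_quiver T \<Omega>) (AR_subquiver C \<Gamma>) \<pi>" by (fact cover(3))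
    show "\<pi> p = \<pi> q \<longleftrightarrow> (\<exists>g\<in>G. g p = q)"
      if "p \<in> q_verts (Z_quiver T \<Omega>)" "q \<in> q_verts (Z_quiver T \<Omega>)" for p q
      using cover(4) that by blast
    show "finite_type_weights T c d" by (fact weights)
  qed
  have all: "iso_class C X \<in> \<Gamma>" if "indecomposable C X" for X
    using contains_all_indecomposables assms(4) that by blast
  show ?thesis
    using all locally_finite_category[OF all] has_AR_triangles_category[OF all] finite_shift_orbits[OF all] by blast
qed

end
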